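(* Let $s\in\{+1,-1\}$, $d\ge2$, and fix any signed orthonormal basis of $L^2(\mathbb S^{d-1})$. Then $$\mathbb B_s(\mathbb S^{d-1})\ \ge\ \frac{2\,\Gamma(\frac{d+1}{2})^{\frac{2}{d-1}}}{(4e^{1/12})^{\frac{2}{d-1}}(d^2-1)^{1/2}},$$ and moreover $\mathbb B_+(\mathbb S^{d-1})\le\sqrt2$ and $\mathbb B_-(\mathbb S^{d-1})\le 2\sqrt2$.
   Context: $\mathbb S^{d-1}\subseteq\mathbb R^d$ is the unit sphere with geodesic distance $d_g(\omega,\nu)=\arccos\langle\omega,\nu\rangle$ and normalized surface measure $\bar\sigma$ ($\bar\sigma(\mathbb S^{d-1})=1$); $L^2(\mathbb S^{d-1})$ consists of real-valued square-integrable functions. $\mathcal H^d_n$ is the space of (real) spherical harmonics of degree $n$, $h_n=\dim\mathcal H^d_n$, and $\eta=(0,\dots,0,1)$ is the north pole. An orthonormal basis $\{Y_{n,j}\in\mathcal H^d_n: n\in\mathbb N, 1\le j\le h_n\}$ of $L^2(\mathbb S^{d-1})$ is signed if $Y_{n,j}(\eta)\ge0$ for all $n,j$, and $Y_{n,j}(\eta)>0$ for all $j$ whenever $n$ is sufficiently large. Write $\widehat f(n,j)=\int f Y_{n,j}\,d\bar\sigma$. For $s\in\{+1,-1\}$, $\mathcal B_s(\mathbb S^{d-1})$ is the set of continuous $f:\mathbb S^{d-1}\to\mathbb R$ with $\widehat f(0,1)\le0$, such that there is $N$ with $s\widehat f(n,j)\ge0$ for all $n\ge N$ and all $j$, and $sf(\eta)\le0$.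 For such $f$ let $\theta(f)=\inf\{\theta\in(0,\pi]: f(\omega)\ge0\text{ whenever }d_g(\omega,\eta)\ge\theta\}$ and $k(s\widehat f)=\min\{k\ge1: s\widehat f(n,j)\ge0\text{ for all }n\ge k\text{ and all }j\}$. Define $\mathbb B_s(\mathbb S^{d-1})=\inf_{f\in\mathcal B_s(\mathbb S^{d-1})\setminus\{0\}}(1-\cos\theta(f))^{1/2}k(s\widehat f)$. *)

theory Defs
  imports "HOL-Analysis.Analysis" "HOL-Library.Function_Algebras"
begin

text \<open>Points of R^d are vectors of type real^'d, d = CARD('d).
  The index type is linearly ordered so that the north pole (0,...,0,1)
  is the basis vector of the largest index.\<close>

definition north_pole :: "real^'d::{finite,wellorder}" where
  "north_pole = axis (Max (UNIV :: 'd set)) 1"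

text \<open>Normalized surface measure on the unit sphere, realised as the cone
  measure: the push-forward of the normalized Lebesgue measure on the unit
  ball under radial projection x \<mapsto> x/|x| (the point 0 is a null set).\<close>

definition radial_proj :: "real^'d::finite \<Rightarrow> real^'d" where
  "radial_proj x = (if x = 0 then (SOME u. u \<in> sphere 0 1) else x /\<^sub>R norm x)"

definition sigma_bar :: "(real^'d::finite) measure" where
  "sigma_bar = distr (uniform_measure lborel (ball 0 1))
                     (restrict_space borel (sphere 0 1)) radial_proj"

definition hom_poly :: "nat \<Rightarrow> (real^'d::finite \<Rightarrow> real) \<Rightarrow> bool" where
  "hom_poly n p \<longleftrightarrow> (\<exists>c :: ('d \<Rightarrow> nat) \<Rightarrow> real. \<forall>x.
      p x = (\<Sum>\<alpha>\<in>{\<alpha>. sum \<alpha> UNIV = n}. c \<alpha> * (\<Prod>i\<in>UNIV. (x $ i) ^ \<alpha> i)))"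

definition laplacian :: "(real^'d::finite \<Rightarrow> real) \<Rightarrow> real^'d \<Rightarrow> real" where
  "laplacian p x = (\<Sum>i\<in>UNIV. deriv (deriv (\<lambda>t. p (x + t *\<^sub>R axis i 1))) 0)"

definition hom_harm_poly :: "nat \<Rightarrow> (real^'d::finite \<Rightarrow> real) \<Rightarrow> bool" where
  "hom_harm_poly n p \<longleftrightarrow> hom_poly n p \<and> (\<forall>x. laplacian p x = 0)"

definition sph_harm :: "nat \<Rightarrow> (real^'d::finite \<Rightarrow> real) set" where
  "sph_harm n = {Y. \<exists>p. hom_harm_poly n p \<and>
                      (\<forall>x. Y x = (if x \<in> sphere 0 1 then p x else 0))}"

definition fun_dim :: "('a \<Rightarrow> real) set \<Rightarrow> nat" where
  "fun_dim V = vector_space.dim (\<lambda>c f x. c * f x) V"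

definition hdim :: "'d::finite itself \<Rightarrow> nat \<Rightarrow> nat" where
  "hdim _ n = fun_dim (sph_harm n :: (real^'d \<Rightarrow> real) set)"

definition signed_onb :: "(nat \<Rightarrow> nat \<Rightarrow> real^'d::{finite,wellorder} \<Rightarrow> real) \<Rightarrow> bool" where
  "signed_onb Y \<longleftrightarrow>
     (\<forall>n. \<forall>j\<in>{1..hdim TYPE('d) n}. Y n j \<in> sph_harm n) \<and>
     (\<forall>n j n' j'. j \<in> {1..hdim TYPE('d) n} \<longrightarrow> j' \<in> {1..hdim TYPE('d) n'} \<longrightarrow>
        (\<integral>x. Y n j x * Y n' j' x \<partial>sigma_bar) = (if n = n' \<and> j = j' then 1 else 0)) \<and>
     (\<forall>f. f \<in> borel_measurable sigma_bar \<longrightarrow> integrable sigma_bar (\<lambda>x. (f x)\<^sup>2) \<longrightarrow>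
        (\<forall>n. \<forall>j\<in>{1..hdim TYPE('d) n}. (\<integral>x. f x * Y n j x \<partial>sigma_bar) = 0) \<longrightarrow>
        (AE x in sigma_bar. f x = 0)) \<and>
     (\<forall>n. \<forall>j\<in>{1..hdim TYPE('d) n}. Y n j north_pole \<ge> 0) \<and>
     (\<exists>N. \<forall>n\<ge>N. \<forall>j\<in>{1..hdim TYPE('d) n}. Y n j north_pole > 0)"

definition fourier :: "(nat \<Rightarrow> nat \<Rightarrow> real^'d::finite \<Rightarrow> real) \<Rightarrow> (real^'d \<Rightarrow> real)
                         \<Rightarrow> nat \<Rightarrow> nat \<Rightarrow> real" where
  "fourier Y f n j = (\<integral>x. f x * Y n j x \<partial>sigma_bar)"

definition Bclass :: "(nat \<Rightarrow> nat \<Rightarrow> real^'d::{finite,wellorder} \<Rightarrow> real) \<Rightarrow> real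
                        \<Rightarrow> (real^'d::{finite,wellorder} \<Rightarrow> real) set" where
  "Bclass Y s = {f. continuous_on (sphere 0 1) f \<and> fourier Y f 0 1 \<le> 0 \<and>
      (\<exists>N. \<forall>n\<ge>N. \<forall>j\<in>{1..hdim TYPE('d) n}. s * fourier Y f n j \<ge> 0) \<and>
      s * f north_pole \<le> 0}"

text \<open>theta(f): the set whose infimum is taken; geodesic distance is arccos of the inner product.\<close>

definition theta_set :: "(real^'d::{finite,wellorder} \<Rightarrow> real) \<Rightarrow> real set" where
  "theta_set f = {\<theta>. 0 < \<theta> \<and> \<theta> \<le> pi \<and>
      (\<forall>\<omega>\<in>sphere 0 1. arccos (\<omega> \<bullet> north_pole) \<ge> \<theta> \<longrightarrow> f \<omega> \<ge> 0)}"

definition theta :: "(real^'d::{finite,wellorder} \<Rightarrow> real) \<Rightarrow> real" where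
  "theta f = Inf (theta_set f)"

definition kidx :: "(nat \<Rightarrow> nat \<Rightarrow> real^'d::{finite,wellorder} \<Rightarrow> real) \<Rightarrow> real \<Rightarrow> (real^'d::{finite,wellorder} \<Rightarrow> real) \<Rightarrow> nat" where
  "kidx Y s f = (LEAST k. 1 \<le> k \<and> (\<forall>n\<ge>k. \<forall>j\<in>{1..hdim TYPE('d) n}. s * fourier Y f n j \<ge> 0))"

text \<open>The quantity (1 - cos theta(f))^(1/2) k(s f^); it is +\<infinity> when no admissible
  theta exists (infimum of the empty set).\<close>

definition Bval :: "(nat \<Rightarrow> nat \<Rightarrow> real^'d::{finite,wellorder} \<Rightarrow> real) \<Rightarrow> real
                      \<Rightarrow> (real^'d::{finite,wellorder} \<Rightarrow> real) \<Rightarrow> ereal" where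
  "Bval Y s f = (if theta_set f = {} then \<infinity>
                 else ereal (sqrt (1 - cos (theta f)) * real (kidx Y s f)))"

definition BB :: "(nat \<Rightarrow> nat \<Rightarrow> real^'d::{finite,wellorder} \<Rightarrow> real) \<Rightarrow> real \<Rightarrow> ereal" where
  "BB Y s = (INF f\<in>{f \<in> Bclass Y s. \<exists>\<omega>\<in>sphere 0 1. f \<omega> \<noteq> 0}. Bval Y s f)"

end

theory Submission
  imports Defs "HOL-Complex_Analysis.Conformal_Mappings"
begin

text \<open>Average the problem over the stabiliser of the pole: with the zonal harmonics \<open>Z n\<close> put
  \<open>b n = \<langle>f, Z n\<rangle>\<close> and \<open>g = \<Sum>n. b n Z n / h\<^sub>n\<close>, so that \<open>f\<close> and \<open>g\<close> have equal integrals against every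
  continuous zonal function. Testing \<open>f\<close> against \<open>((1 + x \<bullet> \<eta>) / 2)\<^sup>m\<close>, a positive definite approximate
  identity at the pole \<open>\<eta>\<close>, the sign conditions give \<open>M = \<Sum>n. \<bar>b n\<bar> \<le> 2 \<Sum>n<k. \<bar>b n\<bar>\<close>. As \<open>f\<close> is
  nonnegative off the cap of radius \<open>\<theta>\<close> and has nonpositive mean, each \<open>\<bar>b n\<bar>\<close> is at most \<open>2 h\<^sub>n\<close> times
  the supremum of \<open>\<bar>g\<bar>\<close>, which is at most \<open>M\<close>, times the measure of the cap. If \<open>M > 0\<close> this yields
  \<open>1 \<le> 4 \<sigma>(cap) \<Sum>n<k. h\<^sub>n\<close>, and it remains to bound the cap and the dimensions. If \<open>M = 0\<close>, strict
  positivity of the basis at the pole makes \<open>f\<close> a polynomial vanishing off the cap, hence zero.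
  The upper bounds come from \<open>t\<^sup>2 - 1\<close> and \<open>t - t\<^sup>3\<close> with \<open>t = x \<bullet> \<eta>\<close>.

  No rotations are averaged and neither Green's formula nor the Riesz--Fischer theorem is used:
  reflections act transitively enough, zonal harmonics are unique by a dimension count, and kernels
  such as \<open>(1 + x \<bullet> y)\<^sup>m\<close> are finite sums \<open>\<Sum>w. u w x * u w y\<close>, so that Bessel's inequality
  already makes their zonal expansions absolutely convergent.\<close>

subsection \<open>Homogeneous polynomials and spherical harmonics\<close>

text \<open>The detour through \<open>g\<close> is forced: the sign conditions control only the
  numbers \<open>b n\<close>, and nothing bounds \<open>f\<close> itself by \<open>M\<close>,
  whereas \<open>\<bar>Z n\<bar> \<le> h\<^sub>n\<close> on the sphere bounds \<open>g\<close>. As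
  \<open>f\<close> and \<open>g\<close> are compared only through continuous zonal functions, the
  cap is cut off by a piecewise linear function of the height between c' < c instead of its
  indicator. The measure is then that of the larger cap at c', and c' tends to c afterwards.
  Likewise the infimum \<open>theta f\<close> is not shown to be attained: the bound holds at each
  admissible angle and extends to the closure by continuity. Numerically, the h_n with n < k sum to
  at most 2 k^(d-1) by counting monomials, and for c > 0 the cap has measure at most (1 -
  c^2)^((d-1)/2) 2^(d/2) / 2, by enclosing the cone over it in a compressed half ball. With 1 - c^2
  \<le> 2 (1 - c) this makes the (d-1)-st power of sqrt (1 - c) k at least sqrt 2 / (8 2^(d-1)), and
  the stated constant stays below that because Gamma((d+1)/2)^4 16^(d-1) \<le> 8 (d^2-1)^(d-1). For
  c \<le> 0 the product is at least 1 and the constant at most 1.\<close>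

lemma finite_multiindices: "finite {\<alpha> :: 'd::finite \<Rightarrow> nat. sum \<alpha> UNIV = n}"
proof -
  have "{\<alpha> :: 'd \<Rightarrow> nat. sum \<alpha> UNIV = n} \<subseteq> (UNIV :: 'd set) \<rightarrow>\<^sub>E {..n}"
  proof
    fix \<alpha> :: "'d \<Rightarrow> nat"
    assume "\<alpha> \<in> {\<alpha>. sum \<alpha> UNIV = n}"
    moreover have "\<alpha> i \<le> sum \<alpha> UNIV" for i
      by (rule member_le_sum) auto
    ultimately show "\<alpha> \<in> (UNIV :: 'd set) \<rightarrow>\<^sub>E {..n}"
      by auto
  qed
  then show ?thesis
    by (rule finite_subset) (simp add: finite_PiE)
qed

lemma hom_poly_sum:
  assumes "\<And>i. i \<in> I \<Longrightarrow> hom_poly n (p i)"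
  shows "hom_poly n (\<lambda>x. \<Sum>i\<in>I. p i x)"
proof -
  have "\<forall>i\<in>I. \<exists>c. \<forall>x. p i x = (\<Sum>\<alpha>\<in>{\<alpha>. sum \<alpha> UNIV = n}. c \<alpha> * (\<Prod>j\<in>UNIV. (x $ j) ^ \<alpha> j))"
    using assms unfolding hom_poly_def by blast
  then obtain c where c: "\<And>i x. i \<in> I \<Longrightarrow> p i x =
      (\<Sum>\<alpha>\<in>{\<alpha>. sum \<alpha> UNIV = n}. c i \<alpha> * (\<Prod>j\<in>UNIV. (x $ j) ^ \<alpha> j))"
    by metis
  show ?thesis
    unfolding hom_poly_def
  proof (intro exI[of _ "\<lambda>\<alpha>. \<Sum>i\<in>I. c i \<alpha>"] allI)
    fix x
    have "(\<Sum>i\<in>I. p i x) = (\<Sum>i\<in>I. \<Sum>\<alpha>\<in>{\<alpha>. sum \<alpha> UNIV = n}. c i \<alpha> * (\<Prod>j\<in>UNIV. (x $ j) ^ \<alpha> j))"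
      by (rule sum.cong) (auto simp: c)
    also have "\<dots> = (\<Sum>\<alpha>\<in>{\<alpha>. sum \<alpha> UNIV = n}. (\<Sum>i\<in>I. c i \<alpha>) * (\<Prod>j\<in>UNIV. (x $ j) ^ \<alpha> j))"
      by (subst sum.swap) (simp add: sum_distrib_right)
    finally show "(\<Sum>i\<in>I. p i x) = \<dots>" .
  qed
qed

lemma hom_poly_cmult:
  assumes "hom_poly n p"
  shows "hom_poly n (\<lambda>x. a * p x)"
proof -
  obtain c where "\<And>x. p x = (\<Sum>\<alpha>\<in>{\<alpha>. sum \<alpha> UNIV = n}. c \<alpha> * (\<Prod>j\<in>UNIV. (x $ j) ^ \<alpha> j))"
    using assms unfolding hom_poly_def by blast
  then show ?thesis
    unfolding hom_poly_def
    by (intro exI[of _ "\<lambda>\<alpha>. a * c \<alpha>"]) (simp add: sum_distrib_left mult.assoc)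
qed

lemma hom_poly_add:
  assumes "hom_poly n p" "hom_poly n q"
  shows "hom_poly n (\<lambda>x. p x + q x)"
proof -
  have "hom_poly n (\<lambda>x. \<Sum>b\<in>UNIV. (if b then p else q) x)"
    using assms by (intro hom_poly_sum) auto
  then show ?thesis
    by (simp add: UNIV_bool add.commute)
qed

lemma hom_poly_monomial:
  assumes "sum \<alpha> UNIV = n"
  shows "hom_poly n (\<lambda>x. \<Prod>j\<in>UNIV. (x $ j) ^ \<alpha> j)"
  unfolding hom_poly_def
proof (intro exI[of _ "\<lambda>\<beta>. if \<beta> = \<alpha> then 1 else 0"] allI)
  fix x :: "real^'a"
  have "(\<Sum>\<beta>\<in>{\<beta>. sum \<beta> UNIV = n}. (if \<beta> = \<alpha> then 1 else 0) * (\<Prod>j\<in>UNIV. (x $ j) ^ \<beta> j))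
     = (\<Sum>\<beta>\<in>{\<beta>. sum \<beta> UNIV = n}. if \<beta> = \<alpha> then (\<Prod>j\<in>UNIV. (x $ j) ^ \<beta> j) else 0)"
    by (rule sum.cong) auto
  also have "\<dots> = (\<Prod>j\<in>UNIV. (x $ j) ^ \<alpha> j)"
    using assms by (subst sum.delta) (auto simp: finite_multiindices)
  finally show "(\<Prod>j\<in>UNIV. (x $ j) ^ \<alpha> j) =
      (\<Sum>\<beta>\<in>{\<beta>. sum \<beta> UNIV = n}. (if \<beta> = \<alpha> then 1 else 0) * (\<Prod>j\<in>UNIV. (x $ j) ^ \<beta> j))"
    by simp
qed

lemma hom_poly_mult:
  assumes "hom_poly m p" "hom_poly n q"
  shows "hom_poly (m + n) (\<lambda>x. p x * q x)"
proof -
  obtain c where c: "\<And>x. p x = (\<Sum>\<alpha>\<in>{\<alpha>. sum \<alpha> UNIV = m}. c \<alpha> * (\<Prod>j\<in>UNIV. (x $ j) ^ \<alpha> j))"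
    using assms unfolding hom_poly_def by blast
  obtain d where d: "\<And>x. q x = (\<Sum>\<alpha>\<in>{\<alpha>. sum \<alpha> UNIV = n}. d \<alpha> * (\<Prod>j\<in>UNIV. (x $ j) ^ \<alpha> j))"
    using assms unfolding hom_poly_def by blast
  have eq: "p x * q x = (\<Sum>\<alpha>\<in>{\<alpha>. sum \<alpha> UNIV = m}. \<Sum>\<beta>\<in>{\<beta>. sum \<beta> UNIV = n}.
      (c \<alpha> * d \<beta>) * (\<Prod>j\<in>UNIV. (x $ j) ^ (\<alpha> j + \<beta> j)))" for x
    unfolding c d sum_product
    by (intro sum.cong refl) (simp add: power_add prod.distrib mult_ac)
  show ?thesis
    unfolding eq
    by (intro hom_poly_sum hom_poly_cmult hom_poly_monomial) (auto simp: sum.distrib)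
qed

lemma hom_poly_const: "hom_poly 0 (\<lambda>x. a)"
  using hom_poly_cmult[OF hom_poly_monomial[of "\<lambda>_. 0" 0], of a] by simp

lemma hom_poly_coordinate: "hom_poly 1 (\<lambda>x. x $ i)"
proof -
  have "(\<Prod>j\<in>UNIV. (x $ j) ^ (if j = i then 1 else 0)) = x $ i" for x :: "real^'a"
  proof -
    have "(\<Prod>j\<in>UNIV. (x $ j) ^ (if j = i then 1 else 0)) = (\<Prod>j\<in>UNIV. if j = i then x $ j else 1)"
      by (rule prod.cong) auto
    then show ?thesis
      by simp
  qed
  then show ?thesis
    using hom_poly_monomial[of "\<lambda>j. if j = i then 1 else 0" 1] by simp
qed

lemma hom_poly_linear:
  fixes f :: "real^'d::finite \<Rightarrow> real"
  assumes "linear f"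
  shows "hom_poly 1 f"
proof -
  have "f x = (\<Sum>i\<in>UNIV. f (axis i 1) * x $ i)" for x
  proof -
    have "f x = f (\<Sum>i\<in>UNIV. x $ i *\<^sub>R axis i 1)"
      by (simp add: basis_expansion flip: scalar_mult_eq_scaleR)
    also have "\<dots> = (\<Sum>i\<in>UNIV. f (axis i 1) * x $ i)"
      using assms by (simp add: linear_sum linear_scale mult.commute)
    finally show ?thesis .
  qed
  then have eq: "f = (\<lambda>x. \<Sum>i\<in>UNIV. f (axis i 1) * x $ i)"
    by blast
  show ?thesis
    by (subst eq) (intro hom_poly_sum hom_poly_cmult hom_poly_coordinate)
qed

lemma hom_poly_power:
  assumes "hom_poly n p"
  shows "hom_poly (n * k) (\<lambda>x. p x ^ k)"
proof (induction k)
  case 0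
  show ?case using hom_poly_const[of 1] by simp
next
  case (Suc k)
  from hom_poly_mult[OF assms Suc] show ?case by simp
qed

lemma hom_poly_prod:
  assumes "finite I" "\<And>i. i \<in> I \<Longrightarrow> hom_poly (n i) (p i)"
  shows "hom_poly (sum n I) (\<lambda>x. \<Prod>i\<in>I. p i x)"
  using assms
proof (induction I rule: finite_induct)
  case empty
  show ?case using hom_poly_const[of 1] by simp
next
  case (insert i I)
  then show ?case
    using hom_poly_mult[of "n i" "p i" "sum n I"] by simp
qed

lemma hom_poly_compose_linear:
  fixes L :: "real^'d::finite \<Rightarrow> real^'d"
  assumes "linear L" "hom_poly n p"
  shows "hom_poly n (\<lambda>x. p (L x))"
proof -
  obtain c where c: "\<And>x. p x = (\<Sum>\<alpha>\<in>{\<alpha>. sum \<alpha> UNIV = n}. c \<alpha> * (\<Prod>j\<in>UNIV. (x $ j) ^ \<alpha> j))"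
    using assms unfolding hom_poly_def by blast
  have 1: "hom_poly (\<alpha> j) (\<lambda>x. (L x $ j) ^ \<alpha> j)" for \<alpha> j
  proof -
    have "linear (\<lambda>x. L x $ j)"
      using linear_compose[OF assms(1) bounded_linear.linear[OF bounded_linear_vec_nth[of j]]]
      by (simp add: o_def)
    from hom_poly_power[OF hom_poly_linear[OF this], of "\<alpha> j"] show ?thesis
      by simp
  qed
  have "hom_poly n (\<lambda>x. \<Prod>j\<in>UNIV. (L x $ j) ^ \<alpha> j)" if "sum \<alpha> UNIV = n" for \<alpha>
    using hom_poly_prod[of UNIV \<alpha> "\<lambda>j x. (L x $ j) ^ \<alpha> j"] 1[of \<alpha>] that by simp
  then show ?thesis
    unfolding c by (intro hom_poly_sum hom_poly_cmult) auto
qed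

lemma hom_poly_homogeneous:
  assumes "hom_poly n p"
  shows "p (a *\<^sub>R x) = a ^ n * p x"
proof -
  obtain c where c: "\<And>x. p x = (\<Sum>\<alpha>\<in>{\<alpha>. sum \<alpha> UNIV = n}. c \<alpha> * (\<Prod>j\<in>UNIV. (x $ j) ^ \<alpha> j))"
    using assms unfolding hom_poly_def by blast
  show ?thesis
    unfolding c sum_distrib_left
    by (rule sum.cong) (auto simp: power_mult_distrib prod.distrib power_sum mult_ac)
qed

lemma continuous_on_hom_poly:
  assumes "hom_poly n p"
  shows "continuous_on S p"
proof -
  obtain c where c: "\<And>x. p x = (\<Sum>\<alpha>\<in>{\<alpha>. sum \<alpha> UNIV = n}. c \<alpha> * (\<Prod>j\<in>UNIV. (x $ j) ^ \<alpha> j))"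
    using assms unfolding hom_poly_def by blast
  then have "p = (\<lambda>x. \<Sum>\<alpha>\<in>{\<alpha>. sum \<alpha> UNIV = n}. c \<alpha> * (\<Prod>j\<in>UNIV. (x $ j) ^ \<alpha> j))"
    by blast
  then show ?thesis
    by (simp add: continuous_intros)
qed

section \<open>Second-order expansions along lines and the Laplacian\<close>

definition taylor2 ::
    "(real^'d::finite \<Rightarrow> real) \<Rightarrow> real^'d \<Rightarrow> ('d \<Rightarrow> real) \<Rightarrow> ('d \<Rightarrow> 'd \<Rightarrow> real) \<Rightarrow> real^'d \<Rightarrow> real poly \<Rightarrow> bool"
  where "taylor2 p x b M u P \<longleftrightarrow> (\<forall>t. p (x + t *\<^sub>R u) = poly P t) \<and>
     coeff P 0 = p x \<and> coeff P 1 = (\<Sum>i\<in>UNIV. b i * u $ i) \<and>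
     coeff P 2 = (\<Sum>i\<in>UNIV. \<Sum>j\<in>UNIV. M i j * (u $ i * u $ j))"

text \<open>On every line through \<open>x\<close> the function is a polynomial in the parameter,
  and its linear and quadratic coefficients depend on the direction \<open>u\<close> through one
  linear form \<open>b\<close> and one quadratic form \<open>M\<close>. This stands in for a second
  Frechet derivative: it passes to sums and products, hence to all polynomials, and relates the
  iterated \<open>deriv\<close> in different directions. \<open>M\<close> need not be
  symmetric.\<close>

definition second_order :: "(real^'d::finite \<Rightarrow> real) \<Rightarrow> bool" where
  "second_order p \<longleftrightarrow> (\<forall>x. \<exists>b M. \<forall>u. \<exists>P. taylor2 p x b M u P)"

lemma second_orderE:
  assumes "second_order p"
  obtains b M P where "\<And>u. taylor2 p x b M u (P u)"
  using assms unfolding second_order_def by metis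

lemma second_orderI:
  assumes "\<And>x. \<exists>b M P. \<forall>u. taylor2 p x b M u (P u)"
  shows "second_order p"
  using assms unfolding second_order_def by metis

lemma second_order_const: "second_order (\<lambda>x. a)"
proof (rule second_orderI)
  fix x :: "real^'a"
  show "\<exists>b M P. \<forall>u. taylor2 (\<lambda>x. a) x b M u (P u)"
    by (rule exI[of _ "\<lambda>_. 0"], rule exI[of _ "\<lambda>_ _. 0"], rule exI[of _ "\<lambda>_. [:a:]"])
       (auto simp: taylor2_def numeral_2_eq_2)
qed

lemma second_order_coordinate: "second_order (\<lambda>x. x $ k)"
proof (rule second_orderI)
  fix x :: "real^'a"
  have "(\<Sum>i\<in>UNIV. (if i = k then 1 else 0) * u $ i) = u $ k" for u :: "real^'a"
  proof -
    have "(\<Sum>i\<in>UNIV. (if i = k then 1 else 0) * u $ i) = (\<Sum>i\<in>UNIV. if i = k then u $ i else 0)"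
      by (rule sum.cong) auto
    then show ?thesis by simp
  qed
  then show "\<exists>b M P. \<forall>u. taylor2 (\<lambda>x. x $ k) x b M u (P u)"
    by (intro exI[of _ "\<lambda>i. if i = k then 1 else (0::real)"], intro exI[of _ "\<lambda>_ _. (0::real)"],
        intro exI[of _ "\<lambda>u. [:x $ k, u $ k:]"]) (auto simp: taylor2_def numeral_2_eq_2)
qed

lemma second_order_add:
  assumes "second_order p" "second_order q"
  shows "second_order (\<lambda>x. p x + q x)"
proof (rule second_orderI)
  fix x
  obtain b M P where p: "\<And>u. taylor2 p x b M u (P u)"
    using second_orderE[OF assms(1)] by blast
  obtain b' M' Q where q: "\<And>u. taylor2 q x b' M' u (Q u)"
    using second_orderE[OF assms(2)] by blast
  have T: "taylor2 (\<lambda>x. p x + q x) x (\<lambda>i. b i + b' i) (\<lambda>i j. M i j + M' i j) u (P u + Q u)" for u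
    using p[of u] q[of u] by (simp add: taylor2_def distrib_right sum.distrib)
  show "\<exists>b M P. \<forall>u. taylor2 (\<lambda>x. p x + q x) x b M u (P u)"
    by (intro exI allI) (rule T)
qed

lemma second_order_mult:
  assumes "second_order p" "second_order q"
  shows "second_order (\<lambda>x. p x * q x)"
proof (rule second_orderI)
  fix x
  obtain b M P where p: "\<And>u. taylor2 p x b M u (P u)"
    using second_orderE[OF assms(1)] by blast
  obtain b' M' Q where q: "\<And>u. taylor2 q x b' M' u (Q u)"
    using second_orderE[OF assms(2)] by blast
  have T: "taylor2 (\<lambda>x. p x * q x) x (\<lambda>i. p x * b' i + q x * b i)
      (\<lambda>i j. p x * M' i j + b i * b' j + q x * M i j) u (P u * Q u)" for u
  proof -
    note PQ = p[of u, unfolded taylor2_def] q[of u, unfolded taylor2_def]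
    have P: "coeff (P u) 0 = p x" "coeff (P u) 1 = (\<Sum>i\<in>UNIV. b i * u $ i)"
        "coeff (P u) 2 = (\<Sum>i\<in>UNIV. \<Sum>j\<in>UNIV. M i j * (u $ i * u $ j))"
      and Q: "coeff (Q u) 0 = q x" "coeff (Q u) 1 = (\<Sum>i\<in>UNIV. b' i * u $ i)"
        "coeff (Q u) 2 = (\<Sum>i\<in>UNIV. \<Sum>j\<in>UNIV. M' i j * (u $ i * u $ j))"
      using PQ by blast+
    have "coeff (P u * Q u) 1 = coeff (P u) 0 * coeff (Q u) 1 + coeff (P u) 1 * coeff (Q u) 0"
      by (simp add: coeff_mult)
    then have 1: "coeff (P u * Q u) 1 = (\<Sum>i\<in>UNIV. (p x * b' i + q x * b i) * u $ i)"
      unfolding P Q by (simp add: algebra_simps sum.distrib sum_distrib_left)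
    have "coeff (P u * Q u) 2 =
        coeff (P u) 0 * coeff (Q u) 2 + coeff (P u) 1 * coeff (Q u) 1 + coeff (P u) 2 * coeff (Q u) 0"
      by (simp add: coeff_mult numeral_2_eq_2)
    then have 2: "coeff (P u * Q u) 2 = (\<Sum>i\<in>UNIV. \<Sum>j\<in>UNIV.
        (p x * M' i j + b i * b' j + q x * M i j) * (u $ i * u $ j))"
      unfolding P Q sum_product by (simp add: algebra_simps sum.distrib sum_distrib_left)
    show ?thesis
      unfolding taylor2_def using 1 2 PQ by (simp add: coeff_mult)
  qed
  show "\<exists>b M P. \<forall>u. taylor2 (\<lambda>x. p x * q x) x b M u (P u)"
    by (intro exI allI) (rule T)
qed

lemma second_order_hom_poly:
  assumes "hom_poly n p"
  shows "second_order p"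
proof -
  obtain c where c: "\<And>x. p x = (\<Sum>\<alpha>\<in>{\<alpha>. sum \<alpha> UNIV = n}. c \<alpha> * (\<Prod>j\<in>UNIV. (x $ j) ^ \<alpha> j))"
    using assms unfolding hom_poly_def by blast
  have pow: "second_order (\<lambda>x. (x $ j) ^ k)" for j :: 'a and k
    by (induction k) (auto intro: second_order_const second_order_mult second_order_coordinate)
  have prod: "second_order (\<lambda>x. \<Prod>j\<in>I. (x $ j) ^ \<alpha> j)" if "finite I" for I :: "'a set" and \<alpha>
    using that
    by (induction I rule: finite_induct) (auto intro: second_order_const second_order_mult pow)
  have "second_order (\<lambda>x. \<Sum>\<alpha>\<in>A. c \<alpha> * (\<Prod>j\<in>UNIV. (x $ j) ^ \<alpha> j))" if "finite A" for A
    using that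
    by (induction A rule: finite_induct)
       (auto intro!: second_order_const second_order_add second_order_mult prod)
  then show ?thesis
    unfolding c using finite_multiindices by blast
qed

lemma deriv_deriv_poly: "deriv (deriv (\<lambda>t. poly P t)) (0::real) = 2 * coeff P 2"
proof -
  have 1: "deriv (\<lambda>t. poly Q t) = (\<lambda>t. poly (pderiv Q) t)" for Q :: "real poly"
    by (rule ext) (rule DERIV_imp_deriv, rule poly_DERIV)
  show ?thesis
    unfolding 1 by (simp add: poly_0_coeff_0 coeff_pderiv numeral_2_eq_2)
qed

lemma second_order_polyE:
  assumes "second_order p"
  obtains P :: "real poly" where "\<And>t. p (x + t *\<^sub>R u) = poly P t"
  using second_orderE[OF assms] unfolding taylor2_def by metis

lemma deriv_deriv_line:
  assumes "second_order p"
  obtains M where "\<And>u. deriv (deriv (\<lambda>t. p (x + t *\<^sub>R u))) 0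
     = 2 * (\<Sum>i\<in>UNIV. \<Sum>j\<in>UNIV. M i j * (u $ i * u $ j))"
proof -
  obtain b M P where p: "\<And>u. taylor2 p x b M u (P u)"
    using second_orderE[OF assms] by blast
  have "deriv (deriv (\<lambda>t. p (x + t *\<^sub>R u))) 0
     = 2 * (\<Sum>i\<in>UNIV. \<Sum>j\<in>UNIV. M i j * (u $ i * u $ j))" for u
    using p[of u] by (simp add: taylor2_def deriv_deriv_poly)
  then show ?thesis
    using that by blast
qed

lemma laplacian_add:
  assumes "second_order p" "second_order q"
  shows "laplacian (\<lambda>x. p x + q x) x = laplacian p x + laplacian q x"
proof -
  have "deriv (deriv (\<lambda>t. p (x + t *\<^sub>R u) + q (x + t *\<^sub>R u))) 0 =
     deriv (deriv (\<lambda>t. p (x + t *\<^sub>R u))) 0 + deriv (deriv (\<lambda>t. q (x + t *\<^sub>R u))) 0" for u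
  proof -
    obtain P Q :: "real poly" where "\<And>t. p (x + t *\<^sub>R u) = poly P t" "\<And>t. q (x + t *\<^sub>R u) = poly Q t"
      using second_order_polyE[OF assms(1)] second_order_polyE[OF assms(2)] by metis
    then show ?thesis
      by (simp add: deriv_deriv_poly flip: poly_add)
  qed
  then show ?thesis
    by (simp add: laplacian_def sum.distrib)
qed

lemma laplacian_cmult:
  assumes "second_order p"
  shows "laplacian (\<lambda>x. a * p x) x = a * laplacian p x"
proof -
  have "deriv (deriv (\<lambda>t. a * p (x + t *\<^sub>R u))) 0 = a * deriv (deriv (\<lambda>t. p (x + t *\<^sub>R u))) 0" for u
  proof -
    obtain P :: "real poly" where "\<And>t. p (x + t *\<^sub>R u) = poly P t"
      using second_order_polyE[OF assms] by metis
    then show ?thesis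
      by (simp add: deriv_deriv_poly flip: poly_smult)
  qed
  then show ?thesis
    by (simp add: laplacian_def sum_distrib_left)
qed

text \<open>The Laplacian is twice the trace of the quadratic form \<open>M\<close>. Evaluating the
  form on the images Q e_m instead of the e_m leaves the trace unchanged because Q Q^T = 1.\<close>

lemma laplacian_orthogonal:
  fixes Q :: "real^'d::finite \<Rightarrow> real^'d"
  assumes "second_order p" and Q: "orthogonal_transformation Q"
  shows "laplacian (\<lambda>x. p (Q x)) x = laplacian p (Q x)"
proof -
  obtain M where M: "\<And>u. deriv (deriv (\<lambda>t. p (Q x + t *\<^sub>R u))) 0
     = 2 * (\<Sum>i\<in>UNIV. \<Sum>j\<in>UNIV. M i j * (u $ i * u $ j))"
    using deriv_deriv_line[OF assms(1)] by blast
  have lin: "linear Q"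
    using Q by (simp add: orthogonal_transformation_linear)
  have "matrix Q ** transpose (matrix Q) = mat 1"
    using Q by (simp add: orthogonal_transformation_matrix orthogonal_matrix_def)
  then have "(matrix Q ** transpose (matrix Q)) $ k $ l = (mat 1 :: real^'d^'d) $ k $ l" for k l
    by simp
  then have trace: "(\<Sum>i\<in>UNIV. Q (axis i 1) $ k * Q (axis i 1) $ l) = (if k = l then 1 else 0)" for k l
    by (simp add: matrix_matrix_mult_def matrix_def transpose_def mat_def)
  have "laplacian (\<lambda>x. p (Q x)) x
      = (\<Sum>m\<in>UNIV. 2 * (\<Sum>i\<in>UNIV. \<Sum>j\<in>UNIV. M i j * (Q (axis m 1) $ i * Q (axis m 1) $ j)))"
    using lin by (simp add: laplacian_def linear_add linear_scale M)
  also have "\<dots> = 2 * (\<Sum>i\<in>UNIV. \<Sum>m\<in>UNIV. \<Sum>j\<in>UNIV. M i j * (Q (axis m 1) $ i * Q (axis m 1) $ j))"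
    by (subst sum.swap) (simp add: sum_distrib_left)
  also have "\<dots> = 2 * (\<Sum>i\<in>UNIV. \<Sum>j\<in>UNIV. M i j * (if i = j then 1 else 0))"
    by (subst sum.swap) (simp add: trace flip: sum_distrib_left)
  also have "\<dots> = (\<Sum>m\<in>UNIV. 2 * (\<Sum>i\<in>UNIV. \<Sum>j\<in>UNIV. M i j * (axis m 1 $ i * (axis m 1 :: real^'d) $ j)))"
  proof -
    have "(\<Sum>i\<in>UNIV. \<Sum>j\<in>UNIV. M i j * (axis m 1 $ i * (axis m 1 :: real^'d) $ j)) = M m m" for m
    proof -
      have "(\<Sum>i\<in>UNIV. \<Sum>j\<in>UNIV. M i j * (axis m 1 $ i * (axis m 1 :: real^'d) $ j))
         = (\<Sum>i\<in>UNIV. \<Sum>j\<in>UNIV. if j = m then (if i = m then M i j else 0) else 0)"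
        by (intro sum.cong refl) (auto simp: axis_def)
      then show ?thesis
        by simp
    qed
    moreover have "(\<Sum>j\<in>UNIV. M i j * (if i = j then 1 else 0)) = M i i" for i
    proof -
      have "(\<Sum>j\<in>UNIV. M i j * (if i = j then 1 else 0)) = (\<Sum>j\<in>UNIV. if j = i then M i j else 0)"
        by (intro sum.cong refl) auto
      then show ?thesis by simp
    qed
    ultimately show ?thesis
      by (simp add: sum_distrib_left)
  qed
  also have "\<dots> = laplacian p (Q x)"
    by (simp add: laplacian_def M)
  finally show ?thesis .
qed

section \<open>Spherical harmonics as function spaces\<close>

lemma sph_harmE:
  assumes "Y \<in> sph_harm n"
  obtains p where "hom_poly n p" "\<And>x. laplacian p x = 0" "\<And>x. x \<in> sphere 0 1 \<Longrightarrow> Y x = p x"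
    "\<And>x. x \<notin> sphere 0 1 \<Longrightarrow> Y x = 0"
  using assms unfolding sph_harm_def hom_harm_poly_def by auto

lemma sph_harmI:
  assumes "hom_poly n p" "\<And>x. laplacian p x = 0" "\<And>x. x \<in> sphere 0 1 \<Longrightarrow> Y x = p x"
    "\<And>x. x \<notin> sphere 0 1 \<Longrightarrow> Y x = 0"
  shows "Y \<in> sph_harm n"
  using assms unfolding sph_harm_def hom_harm_poly_def by auto

lemma sph_harm_add:
  assumes "Y \<in> sph_harm n" "Y' \<in> sph_harm n"
  shows "(\<lambda>x. Y x + Y' x) \<in> sph_harm n"
proof -
  from assms(1) obtain p where p: "hom_poly n p" "\<And>x. laplacian p x = 0"
    "\<And>x. x \<in> sphere 0 1 \<Longrightarrow> Y x = p x" "\<And>x. x \<notin> sphere 0 1 \<Longrightarrow> Y x = 0"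
    using sph_harmE by blast
  from assms(2) obtain q where q: "hom_poly n q" "\<And>x. laplacian q x = 0"
    "\<And>x. x \<in> sphere 0 1 \<Longrightarrow> Y' x = q x" "\<And>x. x \<notin> sphere 0 1 \<Longrightarrow> Y' x = 0"
    using sph_harmE by blast
  show ?thesis
    by (rule sph_harmI[of n "\<lambda>x. p x + q x"])
       (use p q in \<open>auto simp: hom_poly_add laplacian_add second_order_hom_poly\<close>)
qed

lemma sph_harm_cmult:
  assumes "Y \<in> sph_harm n"
  shows "(\<lambda>x. a * Y x) \<in> sph_harm n"
proof -
  from assms(1) obtain p where p: "hom_poly n p" "\<And>x. laplacian p x = 0"
    "\<And>x. x \<in> sphere 0 1 \<Longrightarrow> Y x = p x" "\<And>x. x \<notin> sphere 0 1 \<Longrightarrow> Y x = 0"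
    using sph_harmE by blast
  show ?thesis
    by (rule sph_harmI[of n "\<lambda>x. a * p x"])
       (use p in \<open>auto simp: hom_poly_cmult laplacian_cmult second_order_hom_poly\<close>)
qed

lemma sph_harm_zero: "(\<lambda>x. 0) \<in> sph_harm n"
proof (rule sph_harmI[of n "\<lambda>x. 0"])
  show "hom_poly n (\<lambda>x::real^'a. 0)"
    using hom_poly_sum[of "{}" n] by simp
qed (auto simp: laplacian_def)

lemma sph_harm_sum:
  assumes "\<And>i. i \<in> I \<Longrightarrow> Y i \<in> sph_harm n"
  shows "(\<lambda>x. \<Sum>i\<in>I. Y i x) \<in> sph_harm n"
  using assms
  by (induction I rule: infinite_finite_induct) (auto intro: sph_harm_zero sph_harm_add)

lemma sph_harm_orthogonal:
  fixes Q :: "real^'d::finite \<Rightarrow> real^'d"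
  assumes "Y \<in> sph_harm n" and Q: "orthogonal_transformation Q"
  shows "(\<lambda>x. Y (Q x)) \<in> sph_harm n"
proof -
  from assms(1) obtain p where p: "hom_poly n p" "\<And>x. laplacian p x = 0"
    "\<And>x. x \<in> sphere 0 1 \<Longrightarrow> Y x = p x" "\<And>x. x \<notin> sphere 0 1 \<Longrightarrow> Y x = 0"
    using sph_harmE by blast
  show ?thesis
  proof (rule sph_harmI[of n "\<lambda>x. p (Q x)"])
    show "hom_poly n (\<lambda>x. p (Q x))"
      by (rule hom_poly_compose_linear[OF orthogonal_transformation_linear[OF Q] p(1)])
    show "laplacian (\<lambda>x. p (Q x)) x = 0" for x
      by (simp add: laplacian_orthogonal[OF second_order_hom_poly[OF p(1)] Q] p(2))
    show "Y (Q x) = p (Q x)" if "x \<in> sphere 0 1" for x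
      using that by (intro p(3)) (simp add: orthogonal_transformation_norm[OF Q])
    show "Y (Q x) = 0" if "x \<notin> sphere 0 1" for x
      using that by (intro p(4)) (simp add: orthogonal_transformation_norm[OF Q])
  qed
qed

lemma continuous_on_sph_harm:
  assumes "Y \<in> sph_harm n"
  shows "continuous_on (sphere 0 1) Y"
proof -
  obtain p where p: "hom_poly n p" "\<And>x. laplacian p x = 0"
    "\<And>x. x \<in> sphere 0 1 \<Longrightarrow> Y x = p x" "\<And>x. x \<notin> sphere 0 1 \<Longrightarrow> Y x = 0"
    using sph_harmE[OF assms] by blast
  from continuous_on_hom_poly[OF p(1), of "sphere 0 1"] show ?thesis
    by (subst continuous_on_cong[OF refl p(3)])
qed

text \<open>The witness is the real part of (x_a + i x_b)^n. It makes h_n positive, as is required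
  wherever \<open>Z n\<close> is divided by h_n.\<close>

lemma sph_harm_nonzero_exists:
  fixes a b :: "'d::finite"
  assumes "a \<noteq> b"
  shows "\<exists>Y \<in> sph_harm n. Y (axis a 1 :: real^'d) = 1"
proof -
  define z :: "real^'d \<Rightarrow> complex" where "z x = Complex (x $ a) (x $ b)" for x
  have hom: "hom_poly n (\<lambda>x. Re (z x ^ n)) \<and> hom_poly n (\<lambda>x. Im (z x ^ n))" for n
  proof (induction n)
    case 0
    then show ?case by (auto intro: hom_poly_const)
  next
    case (Suc n)
    have z: "hom_poly 1 (\<lambda>x. Re (z x))" "hom_poly 1 (\<lambda>x. Im (z x))"
      unfolding z_def complex.sel by (rule hom_poly_coordinate)+
    have neg: "hom_poly (1 + n) (\<lambda>x. (-1) * (Im (z x) * Im (z x ^ n)))"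
      using Suc z by (intro hom_poly_cmult hom_poly_mult) auto
    have "hom_poly (1 + n) (\<lambda>x. Re (z x) * Re (z x ^ n) + (-1) * (Im (z x) * Im (z x ^ n)))"
      by (rule hom_poly_add[OF hom_poly_mult[OF z(1) conjunct1[OF Suc]] neg])
    moreover have "hom_poly (1 + n) (\<lambda>x. Re (z x) * Im (z x ^ n) + Im (z x) * Re (z x ^ n))"
      using Suc z by (intro hom_poly_add hom_poly_mult) auto
    ultimately show ?case
      by simp
  qed
  have line: "deriv (deriv (\<lambda>t. Re ((w + of_real t * v) ^ n))) 0
      = Re (v\<^sup>2 * (of_nat n * of_nat (n - 1) * w ^ (n - 2)))" for w v :: complex
  proof -
    have D: "((\<lambda>t. Re (c * (w + of_real t * v) ^ k)) has_real_derivative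
        Re (c * v * of_nat k * (w + of_real t * v) ^ (k - 1))) (at t)" for c k and t :: real
    proof -
      have "((\<lambda>x. c * (w + x * v) ^ k) has_field_derivative
          (c * v * of_nat k * (w + of_real t * v) ^ (k - 1))) (at (of_real t))"
        by (auto intro!: derivative_eq_intros)
      then have "((\<lambda>x. c * (w + of_real x * v) ^ k) has_vector_derivative
          (c * v * of_nat k * (w + of_real t * v) ^ (k - 1))) (at t)"
        using has_vector_derivative_real_field by fastforce
      then show ?thesis
        unfolding has_real_derivative_iff_has_vector_derivative
        by (rule bounded_linear.has_vector_derivative[OF bounded_linear_Re])
    qed
    have "deriv (\<lambda>t. Re ((w + of_real t * v) ^ n)) = (\<lambda>t. Re (v * of_nat n * (w + of_real t * v) ^ (n - 1)))"
      using D[of 1 n] by (intro ext DERIV_imp_deriv) simp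
    moreover have "deriv (\<lambda>t. Re (v * of_nat n * (w + of_real t * v) ^ (n - 1))) 0
        = Re (v\<^sup>2 * (of_nat n * of_nat (n - 1) * w ^ (n - 2)))"
      using D[of "v * of_nat n" "n - 1" 0]
      by (intro DERIV_imp_deriv) (simp add: power2_eq_square mult_ac numeral_2_eq_2)
    ultimately show ?thesis
      by simp
  qed
  have lap: "laplacian (\<lambda>x. Re (z x ^ n)) x = 0" for x
  proof -
    \<comment> \<open>Moving along coordinate a, b or any other shifts \<open>z\<close> by a
      multiple of v = 1, i or 0. The second derivative is proportional to v^2, so the contributions
      of a and b cancel.\<close>
    have "z (x + t *\<^sub>R axis i 1) = z x + of_real t * (if i = a then 1 else if i = b then \<i> else 0)" for t i
      using assms by (auto simp: z_def axis_def complex_eq_iff)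
    then have "laplacian (\<lambda>x. Re (z x ^ n)) x
       = (\<Sum>i\<in>UNIV. Re ((if i = a then 1 else if i = b then \<i> else 0)\<^sup>2 * (of_nat n * of_nat (n - 1) * z x ^ (n - 2))))"
      by (simp add: laplacian_def line)
    also have "\<dots> = (\<Sum>i\<in>UNIV. (if i = a then Re (of_nat n * of_nat (n - 1) * z x ^ (n - 2)) else 0)
        - (if i = b then Re (of_nat n * of_nat (n - 1) * z x ^ (n - 2)) else 0))"
      using assms by (intro sum.cong refl) auto
    also have "\<dots> = 0"
      by (simp add: sum_subtractf)
    finally show ?thesis .
  qed
  have "(\<lambda>x. if x \<in> sphere 0 1 then Re (z x ^ n) else 0) \<in> sph_harm n"
    using hom[of n] lap by (intro sph_harmI[of n "\<lambda>x. Re (z x ^ n)"]) auto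
  moreover have "Re (z (axis a 1) ^ n) = 1"
  proof -
    have "z (axis a 1) = 1"
      using assms by (simp add: z_def axis_def complex_eq_iff)
    then show ?thesis by simp
  qed
  ultimately show ?thesis
    by (intro bexI[of _ "\<lambda>x. if x \<in> sphere 0 1 then Re (z x ^ n) else 0"]) auto
qed

subsection \<open>The surface measure\<close>

lemma sphere_nonempty_cart: "(sphere 0 1 :: (real^'d::finite) set) \<noteq> {}"
  by simp

lemma radial_proj_in_sphere: "radial_proj x \<in> sphere 0 1"
proof (cases "x = 0")
  case True
  have "(SOME u. u \<in> sphere 0 1) \<in> (sphere 0 1 :: (real^'d) set)"
    by (rule someI_ex) (use sphere_nonempty_cart in blast)
  with True show ?thesis by (simp add: radial_proj_def)
qed (simp add: radial_proj_def)

lemma measurable_radial_proj [measurable]: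
  "radial_proj \<in> measurable borel (restrict_space borel (sphere 0 1))"
proof (rule measurable_restrict_space2)
  show "radial_proj \<in> borel \<rightarrow>\<^sub>M (borel :: (real^'d) measure)"
    unfolding radial_proj_def[abs_def] by measurable
qed (use radial_proj_in_sphere in auto)

lemma measurable_radial_proj_uniform:
  "radial_proj \<in> measurable (uniform_measure lborel (ball 0 1)) (restrict_space borel (sphere 0 1))"
  using measurable_radial_proj by (simp add: measurable_def)

lemma space_sigma_bar [simp]: "space (sigma_bar :: (real^'d::finite) measure) = sphere 0 1"
  by (simp add: sigma_bar_def space_restrict_space)

lemma sets_sigma_bar: "sets (sigma_bar :: (real^'d::finite) measure) = sets (restrict_space borel (sphere 0 1))"
  by (simp add: sigma_bar_def)

lemma in_sets_sigma_bar:
  "A \<in> sets (sigma_bar :: (real^'d::finite) measure) \<longleftrightarrow> A \<subseteq> sphere 0 1 \<and> A \<in> sets borel"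
  by (subst sets_sigma_bar, subst sets_restrict_space_iff) (auto simp: borel_closed)

lemma sector_borel:
  assumes "A \<in> sets (sigma_bar :: (real^'d::finite) measure)"
  shows "radial_proj -` A \<in> sets (borel :: (real^'d) measure)"
  using measurable_sets[OF measurable_radial_proj assms[unfolded sets_sigma_bar]] by simp

lemma measure_sigma_bar:
  assumes "A \<in> sets (sigma_bar :: (real^'d::finite) measure)"
  shows "measure sigma_bar A = measure lborel (ball 0 1 \<inter> radial_proj -` A) / measure lborel (ball (0 :: real^'d) 1)"
proof -
  have "measure sigma_bar A = measure (uniform_measure lborel (ball 0 1)) (radial_proj -` A \<inter> space borel)"
    unfolding sigma_bar_def
    using assms measurable_radial_proj_uniform by (subst measure_distr) (auto simp: sets_sigma_bar)
  also have "\<dots> = measure lborel (ball 0 1 \<inter> radial_proj -` A) / measure lborel (ball (0 :: real^'d) 1)"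
    using emeasure_lborel_ball_finite[of "0 :: real^'d" 1] content_ball_pos[of 1 "0 :: real^'d"]
      sector_borel[OF assms]
    by (subst measure_uniform_measure) (auto simp: measure_def)
  finally show ?thesis .
qed

lemma emeasure_sigma_bar_space: "emeasure (sigma_bar :: (real^'d::finite) measure) (sphere 0 1) = 1"
proof -
  have e: "emeasure lborel (ball (0 :: real^'d) 1) \<noteq> 0" "emeasure lborel (ball (0 :: real^'d) 1) \<noteq> \<infinity>"
    using emeasure_lborel_ball_finite[of "0 :: real^'d" 1] content_ball_pos[of 1 "0 :: real^'d"]
    by (auto simp: measure_def)
  have "emeasure (sigma_bar :: (real^'d) measure) (sphere 0 1)
      = emeasure (uniform_measure lborel (ball (0 :: real^'d) 1)) (radial_proj -` sphere 0 1 \<inter> space borel)"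
    unfolding sigma_bar_def
    using measurable_radial_proj_uniform
    by (subst emeasure_distr) (auto simp: sets_restrict_space_iff)
  also have "radial_proj -` sphere 0 1 \<inter> space borel = (UNIV :: (real^'d) set)"
    using radial_proj_in_sphere by auto
  also have "emeasure (uniform_measure lborel (ball (0 :: real^'d) 1)) UNIV = 1"
    using e by (subst emeasure_uniform_measure) (auto intro: ennreal_divide_self simp: less_top)
  finally show ?thesis .
qed

lemma finite_measure_sigma_bar: "finite_measure (sigma_bar :: (real^'d::finite) measure)"
  by (rule finite_measureI) (simp add: emeasure_sigma_bar_space)

lemma measure_sigma_bar_space [simp]: "measure (sigma_bar :: (real^'d::finite) measure) (sphere 0 1) = 1"
  by (simp add: measure_def emeasure_sigma_bar_space)

lemma measurable_continuous_sigma_bar: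
  fixes f :: "real^'d::finite \<Rightarrow> real"
  assumes "continuous_on (sphere 0 1) f"
  shows "f \<in> borel_measurable sigma_bar"
  using borel_measurable_continuous_on_restrict[OF assms] measurable_cong_sets[OF sets_sigma_bar refl]
  by blast

lemma bounded_on_sphere:
  fixes f :: "real^'d::finite \<Rightarrow> real"
  assumes "continuous_on (sphere 0 1) f"
  obtains B where "B \<ge> 0" "\<And>x. x \<in> sphere 0 1 \<Longrightarrow> \<bar>f x\<bar> \<le> B"
proof -
  have "bounded (f ` sphere 0 1)"
    by (intro compact_imp_bounded compact_continuous_image assms compact_sphere)
  then obtain B where B: "\<forall>x\<in>sphere 0 1. \<bar>f x\<bar> \<le> B"
    unfolding bounded_iff by auto
  show thesis
    by (rule that[of "max 0 B"]) (use B in \<open>auto simp: le_max_iff_disj\<close>)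
qed

lemma integrable_sigma_bar_bounded:
  fixes f :: "real^'d::finite \<Rightarrow> real"
  assumes "f \<in> borel_measurable sigma_bar" "\<And>x. x \<in> sphere 0 1 \<Longrightarrow> \<bar>f x\<bar> \<le> B"
  shows "integrable sigma_bar f"
  by (rule finite_measure.integrable_const_bound[OF finite_measure_sigma_bar, where B = B]) (use assms in auto)

lemma integrable_continuous_sigma_bar:
  fixes f :: "real^'d::finite \<Rightarrow> real"
  assumes "continuous_on (sphere 0 1) f"
  shows "integrable sigma_bar f"
  using bounded_on_sphere[OF assms] integrable_sigma_bar_bounded[OF measurable_continuous_sigma_bar[OF assms]]
  by metis

text \<open>The cone over \<open>U\<close> inside the unit ball, without its apex, is open and
  contains x/2, hence a ball of positive Lebesgue measure.\<close>

lemma sigma_bar_open_pos: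
  assumes "open U" "x \<in> U" "x \<in> sphere (0 :: real^'d::finite) 1"
  shows "measure sigma_bar (U \<inter> sphere 0 1) > 0"
proof -
  have U: "U \<inter> sphere 0 1 \<in> sets sigma_bar"
    using assms by (auto simp: in_sets_sigma_bar)
  define V where "V = {y :: real^'d. y \<in> ball 0 1 - {0} \<and> y /\<^sub>R norm y \<in> U}"
  have "open V"
  proof -
    have "continuous_on (ball 0 1 - {0}) (\<lambda>y :: real^'d. y /\<^sub>R norm y)"
      by (intro continuous_intros) auto
    then have "open ((\<lambda>y :: real^'d. y /\<^sub>R norm y) -` U \<inter> (ball 0 1 - {0}))"
      using assms(1) by (subst (asm) continuous_on_open_vimage) auto
    moreover have "V = (\<lambda>y :: real^'d. y /\<^sub>R norm y) -` U \<inter> (ball 0 1 - {0})"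
      by (auto simp: V_def)
    ultimately show ?thesis by simp
  qed
  moreover have "(1/2) *\<^sub>R x \<in> V"
    using assms by (auto simp: V_def)
  ultimately obtain e where e: "e > 0" "ball ((1/2) *\<^sub>R x) e \<subseteq> V"
    using open_contains_ball by blast
  have "0 < measure lborel (ball ((1/2) *\<^sub>R x) e)"
    using e by (simp add: content_ball_pos)
  also have "\<dots> \<le> measure lborel (ball 0 1 \<inter> radial_proj -` (U \<inter> sphere 0 1))"
  proof (rule measure_mono_fmeasurable)
    show "ball ((1/2) *\<^sub>R x) e \<subseteq> ball 0 1 \<inter> radial_proj -` (U \<inter> sphere 0 1)"
      using e(2) by (auto simp: V_def radial_proj_def)
    show "ball 0 1 \<inter> radial_proj -` (U \<inter> sphere 0 1) \<in> fmeasurable lborel"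
      by (rule fmeasurableI2[OF fmeasurableI[OF _ emeasure_lborel_ball_finite]])
         (use sector_borel[OF U] in auto)
  qed simp
  finally show ?thesis
    using content_ball_pos[of 1 "0 :: real^'d"] by (simp add: measure_sigma_bar[OF U])
qed

lemma continuous_AE_zero_sphere:
  fixes f :: "real^'d::finite \<Rightarrow> real"
  assumes "continuous_on (sphere 0 1) f" "AE x in sigma_bar. f x = 0" "x \<in> sphere 0 1"
  shows "f x = 0"
proof (rule ccontr)
  assume "f x \<noteq> 0"
  have "openin (top_of_set (sphere 0 1)) (sphere 0 1 \<inter> f -` (- {0}))"
    using assms(1) by (rule continuous_openin_preimage_gen) auto
  then obtain U where U: "open U" "sphere 0 1 \<inter> f -` (- {0}) = sphere 0 1 \<inter> U"
    by (auto simp: openin_open)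
  have pos: "measure sigma_bar (U \<inter> sphere 0 1) > 0"
  proof (rule sigma_bar_open_pos[OF U(1) _ assms(3)])
    have "x \<in> sphere 0 1 \<inter> f -` (- {0})"
      using assms(3) \<open>f x \<noteq> 0\<close> by blast
    then show "x \<in> U"
      unfolding U(2) by blast
  qed
  have ne: "f y \<noteq> 0" if "y \<in> U \<inter> sphere 0 1" for y
    using that U(2) by blast
  have "AE y in sigma_bar. y \<notin> U \<inter> sphere 0 1"
    using assms(2) by (rule AE_mp) (use ne in blast)
  moreover have "U \<inter> sphere 0 1 \<in> sets sigma_bar"
    using U(1) by (auto simp: in_sets_sigma_bar)
  ultimately have "U \<inter> sphere 0 1 \<in> null_sets sigma_bar"
    by (simp add: AE_iff_null_sets)
  with pos show False
    by (simp add: measure_def null_setsD1)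
qed

lemma continuous_nonneg_integral_zero_sphere:
  fixes f :: "real^'d::finite \<Rightarrow> real"
  assumes "continuous_on (sphere 0 1) f" "\<And>x. x \<in> sphere 0 1 \<Longrightarrow> f x \<ge> 0"
    "integral\<^sup>L sigma_bar f = 0" "x \<in> sphere 0 1"
  shows "f x = 0"
proof -
  have "AE x in sigma_bar. f x = 0"
    using assms(2,3) integrable_continuous_sigma_bar[OF assms(1)]
    by (subst (asm) integral_nonneg_eq_0_iff_AE) auto
  then show ?thesis
    using continuous_AE_zero_sphere assms by blast
qed

text \<open>The Householder reflection in the hyperplane orthogonal to \<open>v\<close>. For
  \<open>v = 0\<close> the quotient is 0 and the map is the identity, so
  \<open>hreflect (x - y)\<close> is meaningful even if \<open>x = y\<close>.\<close>

definition hreflect :: "real^'d::finite \<Rightarrow> real^'d \<Rightarrow> real^'d" where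
  "hreflect v x = x - (2 * (v \<bullet> x) / (v \<bullet> v)) *\<^sub>R v"

lemma hreflect_inner: "hreflect v x \<bullet> hreflect v y = x \<bullet> y"
  by (cases "v = 0") (auto simp: hreflect_def inner_diff inner_commute field_simps)

lemma orthogonal_hreflect: "orthogonal_transformation (hreflect v)"
proof -
  have "linear (hreflect v)"
    by (rule linearI) (auto simp: hreflect_def inner_add_right algebra_simps add_divide_distrib)
  then show ?thesis
    by (simp add: orthogonal_transformation_def hreflect_inner)
qed

lemma hreflect_involution [simp]: "hreflect v (hreflect v x) = x"
  by (cases "v = 0") (auto simp: hreflect_def inner_diff_right algebra_simps)

lemma hreflect_fix: "v \<bullet> x = 0 \<Longrightarrow> hreflect v x = x"
  by (simp add: hreflect_def)

text \<open>This is all the transitivity that is used: any two points of the sphere are exchanged by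
  one reflection, and if they have equal height then x - y is orthogonal to the pole, which the
  reflection then fixes.\<close>

lemma hreflect_swap:
  assumes "norm x = norm y"
  shows "hreflect (x - y) x = y"
proof (cases "x = y")
  case False
  have xy: "x \<bullet> x = y \<bullet> y"
    using assms by (simp add: norm_eq)
  have "2 * ((x - y) \<bullet> x) = (x - y) \<bullet> (x - y)"
    using xy by (simp add: inner_diff inner_commute)
  moreover have "(x - y) \<bullet> (x - y) \<noteq> 0"
    using False by simp
  ultimately show ?thesis
    by (simp add: hreflect_def)
qed (simp add: hreflect_def)

text \<open>\<open>sigma_bar\<close> measures the sector over a set, and \<open>Q\<close> carries
  the sector over the preimage of \<open>A\<close> onto the sector over \<open>A\<close>. The claim
  becomes the invariance of Lebesgue measure.\<close>

lemma measure_sigma_bar_orthogonal: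
  fixes Q :: "real^'d::{finite,wellorder} \<Rightarrow> real^'d::_"
  assumes Q: "orthogonal_transformation Q" and A: "A \<in> sets sigma_bar"
  shows "Q -` A \<inter> sphere 0 1 \<in> sets sigma_bar" "measure sigma_bar (Q -` A \<inter> sphere 0 1) = measure sigma_bar A"
proof -
  have lin: "linear Q" and norm: "\<And>x. norm (Q x) = norm x"
    using Q by (auto simp: orthogonal_transformation_linear orthogonal_transformation_norm)
  have Qm: "Q \<in> borel \<rightarrow>\<^sub>M borel"
    by (intro borel_measurable_continuous_onI linear_continuous_on) (use lin in \<open>simp add: linear_linear\<close>)
  have A': "A \<subseteq> sphere 0 1" "A \<in> sets borel"
    using A by (auto simp: in_sets_sigma_bar)
  show B: "Q -` A \<inter> sphere 0 1 \<in> sets sigma_bar"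
    using measurable_sets[OF Qm A'(2)] by (auto simp: in_sets_sigma_bar)
  \<comment> \<open>The origin is removed because \<open>radial_proj\<close> has an arbitrary value
    there, which need not commute with \<open>Q\<close>.\<close>
  define T where "T C = (ball 0 1 - {0}) \<inter> radial_proj -` C" for C :: "(real^'d::_) set"
  have Tborel: "T C \<in> sets borel" if "C \<in> sets sigma_bar" for C
    using sector_borel[OF that] by (auto simp: T_def)
  have Tlm: "T C \<in> lmeasurable" if "C \<in> sets sigma_bar" for C
    by (rule bounded_set_imp_lmeasurable)
       (use Tborel[OF that] in \<open>auto simp: T_def intro: bounded_subset[of "ball 0 1"]\<close>)
  have T: "measure lborel (ball 0 1 \<inter> radial_proj -` C) = measure lebesgue (T C)"
    if "C \<in> sets sigma_bar" for C
  proof -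
    have "T C = ball 0 1 \<inter> radial_proj -` C - {0}"
      by (auto simp: T_def)
    moreover have "measure lborel (ball 0 1 \<inter> radial_proj -` C - {0}) = measure lborel (ball 0 1 \<inter> radial_proj -` C)"
      using sector_borel[OF that] by (intro measure_Diff_null_set) (auto simp: null_sets_def)
    moreover have "measure lebesgue (T C) = measure lborel (T C)"
      using Tborel[OF that] by simp
    ultimately show ?thesis
      by metis
  qed
  have rp: "radial_proj (Q x) = Q (radial_proj x)" if "x \<noteq> 0" for x
  proof -
    have "Q x \<noteq> 0"
      using that norm[of x] by auto
    with that show ?thesis
      using lin by (simp add: radial_proj_def norm linear_scale)
  qed
  have "Q ` T (Q -` A \<inter> sphere 0 1) = T A"
  proof (intro set_eqI iffI)
    fix y assume "y \<in> Q ` T (Q -` A \<inter> sphere 0 1)"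
    then obtain x where "y = Q x" "x \<in> T (Q -` A \<inter> sphere 0 1)"
      by blast
    then show "y \<in> T A"
      using norm[of x] by (auto simp: T_def rp)
  next
    fix y assume y: "y \<in> T A"
    obtain x where x: "y = Q x"
      using orthogonal_transformation_surj[OF Q] by blast
    moreover have "x \<noteq> 0"
      using y x linear_0[OF lin] by (auto simp: T_def)
    ultimately have "x \<in> T (Q -` A \<inter> sphere 0 1)"
      using y norm[of x] radial_proj_in_sphere[of x] rp[of x] by (auto simp: T_def)
    then show "y \<in> Q ` T (Q -` A \<inter> sphere 0 1)"
      using x by blast
  qed
  then have "measure lebesgue (T A) = measure lebesgue (T (Q -` A \<inter> sphere 0 1))"
    using measure_orthogonal_image[OF Q Tlm[OF B]] by simp
  then show "measure sigma_bar (Q -` A \<inter> sphere 0 1) = measure sigma_bar A"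
    unfolding measure_sigma_bar[OF A] measure_sigma_bar[OF B] T[OF A] T[OF B] by simp
qed

lemma integral_sigma_bar_orthogonal:
  fixes Q :: "real^'d::{finite,wellorder} \<Rightarrow> real^'d::_" and f :: "real^'d::_ \<Rightarrow> real"
  assumes Q: "orthogonal_transformation Q" and f: "f \<in> borel_measurable sigma_bar"
  shows "(\<integral>x. f (Q x) \<partial>sigma_bar) = (\<integral>x. f x \<partial>sigma_bar)"
proof -
  have Qm: "Q \<in> sigma_bar \<rightarrow>\<^sub>M sigma_bar"
    by (rule measurableI)
       (use Q measure_sigma_bar_orthogonal(1)[OF Q] in \<open>auto simp: orthogonal_transformation_norm\<close>)
  have "distr sigma_bar sigma_bar Q = sigma_bar"
  proof (rule measure_eqI)
    fix A assume "A \<in> sets (distr sigma_bar sigma_bar Q)"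
    then have A: "A \<in> sets sigma_bar" by simp
    then show "emeasure (distr sigma_bar sigma_bar Q) A = emeasure sigma_bar A"
      using measure_sigma_bar_orthogonal(2)[OF Q A] Qm
      by (subst emeasure_distr) (auto simp: finite_measure.emeasure_eq_measure[OF finite_measure_sigma_bar])
  qed simp
  then have "(\<integral>x. f x \<partial>sigma_bar) = (\<integral>x. f x \<partial>distr sigma_bar sigma_bar Q)"
    by simp
  also have "\<dots> = (\<integral>x. f (Q x) \<partial>sigma_bar)"
    by (rule integral_distr[OF Qm f])
  finally show ?thesis by simp
qed

section \<open>The measure of caps around the pole\<close>

lemma norm_north_pole [simp]: "norm (north_pole :: real^'d::{finite,wellorder}) = 1"
  by (simp add: north_pole_def)

lemma inner_north_pole: "x \<bullet> north_pole = x $ Max UNIV"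
  by (simp add: north_pole_def inner_axis)

lemma cap_in_sets: "{x \<in> sphere (0 :: real^'d::{finite,wellorder}) 1. x \<bullet> north_pole \<ge> c} \<in> sets sigma_bar"
proof -
  have "closed (sphere 0 1 \<inter> {x :: real^'d::_. x \<bullet> north_pole \<ge> c})"
    by (intro closed_Int closed_sphere closed_Collect_le continuous_intros)
  moreover have "{x \<in> sphere 0 1. x \<bullet> north_pole \<ge> c} = sphere 0 1 \<inter> {x :: real^'d::_. x \<bullet> north_pole \<ge> c}"
    by auto
  ultimately show ?thesis
    by (auto simp: in_sets_sigma_bar)
qed

text \<open>A point y of the cone over the cap satisfies |y|^2 - y_e^2 \<le> \<sigma>^2 |y|^2 with
  \<sigma>^2 = 1 - c^2. Stretching by 1/\<sigma> orthogonally to the axis therefore gives a point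
  above the equator of squared norm at most y_e^2 + |y|^2 < 2. So the cone lies in the image of a
  half ball of radius sqrt 2 under a map with Jacobian \<sigma>^(d-1).\<close>

lemma cap_measure:
  fixes c :: real
  assumes "0 < c" "c < 1"
  shows "measure sigma_bar {x \<in> sphere (0 :: real^'d::{finite,wellorder}) 1. x \<bullet> north_pole \<ge> c}
    \<le> sqrt (1 - c\<^sup>2) ^ (CARD('d) - 1) * sqrt 2 ^ CARD('d) / 2"
proof -
  define e :: 'd where "e = Max UNIV"
  define \<sigma> where "\<sigma> = sqrt (1 - c\<^sup>2)"
  have \<sigma>: "\<sigma> > 0" "\<sigma>\<^sup>2 = 1 - c\<^sup>2"
  proof -
    have "c\<^sup>2 < 1"
      using assms by (simp add: abs_square_less_1)
    then show "\<sigma> > 0" "\<sigma>\<^sup>2 = 1 - c\<^sup>2"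
      by (auto simp: \<sigma>_def)
  qed
  define m where "m k = (if k = e then 1 else \<sigma>)" for k
  define st where "st = (\<lambda>x :: real^'d::_. \<chi> k. m k * x $ k)"
  define C where "C = {x \<in> sphere (0 :: real^'d::_) 1. x \<bullet> north_pole \<ge> c}"
  define T where "T = {z :: real^'d::_. z $ e > 0} \<inter> ball 0 (sqrt 2)"
  have C: "C \<in> sets sigma_bar"
    unfolding C_def by (rule cap_in_sets)
  have Topen: "open T"
    unfolding T_def by (intro open_Int open_ball open_Collect_less continuous_intros)
  have Tm: "T \<in> lmeasurable"
    by (rule bounded_set_imp_lmeasurable) (use Topen in \<open>auto simp: T_def intro: bounded_subset[of "ball 0 (sqrt 2)"]\<close>)
  have half: "2 * measure lebesgue T \<le> measure lebesgue (ball (0 :: real^'d::_) (sqrt 2))"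
  proof -
    have neg: "orthogonal_transformation (uminus :: real^'d::_ \<Rightarrow> real^'d::_)"
      by (simp add: orthogonal_transformation_neg orthogonal_transformation_id)
    have "T \<inter> uminus ` T = {}"
      by (auto simp: T_def)
    then have "measure lebesgue T + measure lebesgue (uminus ` T) = measure lebesgue (T \<union> uminus ` T)"
      using measure_Un3[OF Tm measurable_orthogonal_image[OF neg Tm]] by simp
    also have "\<dots> \<le> measure lebesgue (ball (0 :: real^'d::_) (sqrt 2))"
      by (rule measure_mono_fmeasurable)
         (use Tm measurable_orthogonal_image[OF neg Tm] in \<open>auto simp: T_def dest: fmeasurableD\<close>)
    finally show ?thesis
      using measure_orthogonal_image[OF neg Tm] by simp
  qed
  have sub: "ball 0 1 \<inter> radial_proj -` C - {0} \<subseteq> st ` T"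
  proof
    fix y assume y: "y \<in> ball 0 1 \<inter> radial_proj -` C - {0}"
    then have n: "norm y < 1" "norm y > 0" and ye: "y $ e \<ge> c * norm y"
      by (auto simp: C_def radial_proj_def inner_north_pole e_def field_simps)
    define z where "z = (\<chi> k. y $ k / m k)"
    have "st z = y"
      using \<sigma> by (auto simp: st_def z_def vec_eq_iff m_def)
    moreover have "z \<in> T"
    proof -
      have "(norm z)\<^sup>2 = (\<Sum>k\<in>UNIV. (z $ k)\<^sup>2)"
        by (simp add: norm_vec_def L2_set_def sum_nonneg)
      also have "\<dots> = (z $ e)\<^sup>2 + (\<Sum>k\<in>UNIV - {e}. (z $ k)\<^sup>2)"
        by (simp add: sum.remove[of _ e])
      also have "(\<Sum>k\<in>UNIV - {e}. (z $ k)\<^sup>2) = (\<Sum>k\<in>UNIV - {e}. (y $ k)\<^sup>2) / \<sigma>\<^sup>2"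
        unfolding sum_divide_distrib by (intro sum.cong) (auto simp: z_def m_def power_divide)
      also have "(\<Sum>k\<in>UNIV - {e}. (y $ k)\<^sup>2) = (norm y)\<^sup>2 - (y $ e)\<^sup>2"
        by (simp add: norm_vec_def L2_set_def sum_nonneg sum.remove[of _ e])
      finally have nz: "(norm z)\<^sup>2 = (z $ e)\<^sup>2 + ((norm y)\<^sup>2 - (y $ e)\<^sup>2) / \<sigma>\<^sup>2" .
      have "(c * norm y)\<^sup>2 \<le> (y $ e)\<^sup>2"
        using ye n assms by (intro power_mono) auto
      then have "((norm y)\<^sup>2 - (y $ e)\<^sup>2) / \<sigma>\<^sup>2 \<le> (norm y)\<^sup>2"
        using \<sigma>(1) unfolding \<sigma>(2)[symmetric]
        by (simp add: divide_le_eq power_mult_distrib) (simp add: \<sigma>(2) algebra_simps)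
      moreover have "(norm y)\<^sup>2 < 1"
        using n by (simp add: power_less_one_iff abs_square_less_1)
      moreover have "(y $ e)\<^sup>2 \<le> (norm y)\<^sup>2"
        using component_le_norm_cart[of y e] by (simp flip: abs_le_square_iff)
      ultimately have "(norm z)\<^sup>2 < 2"
        using nz by (simp add: z_def m_def)
      then have "norm z < sqrt 2"
        by (simp add: real_less_rsqrt)
      moreover have "z $ e > 0"
        using less_le_trans[OF mult_pos_pos[OF assms(1) n(2)] ye] by (simp add: z_def m_def)
      ultimately show ?thesis
        by (simp add: T_def)
    qed
    ultimately show "y \<in> st ` T" by blast
  qed
  have prodm: "prod m UNIV = \<sigma> ^ (CARD('d) - 1)"
    by (subst prod.remove[of _ e]) (auto simp: m_def card_Diff_singleton)
  have B: "ball 0 1 \<inter> radial_proj -` C \<in> sets borel"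
    using sector_borel[OF C] by auto
  have "measure lborel (ball 0 1 \<inter> radial_proj -` C) = measure lborel (ball 0 1 \<inter> radial_proj -` C - {0})"
    using B by (intro measure_Diff_null_set[symmetric]) (auto simp: null_sets_def)
  also have "\<dots> = measure lebesgue (ball 0 1 \<inter> radial_proj -` C - {0})"
    using B by simp
  also have "\<dots> \<le> measure lebesgue (st ` T)"
    by (rule measure_mono_fmeasurable[OF sub]) (use B measurable_stretch[OF Tm, of m] in \<open>auto simp: st_def\<close>)
  also have "\<dots> = \<sigma> ^ (CARD('d) - 1) * measure lebesgue T"
    using measure_stretch[OF Tm, of m] \<sigma> by (simp add: st_def prodm)
  also have "\<dots> \<le> \<sigma> ^ (CARD('d) - 1) * (measure lebesgue (ball (0 :: real^'d::_) (sqrt 2)) / 2)"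
    using half \<sigma> by (intro mult_left_mono) auto
  also have "measure lebesgue (ball (0 :: real^'d::_) (sqrt 2)) = sqrt 2 ^ CARD('d) * measure lborel (ball (0 :: real^'d::_) 1)"
    using content_ball_conv_unit_ball[of "sqrt 2" "0 :: real^'d::_"] by simp
  finally have "measure lborel (ball 0 1 \<inter> radial_proj -` C)
     \<le> (\<sigma> ^ (CARD('d) - 1) * sqrt 2 ^ CARD('d) / 2) * measure lborel (ball (0 :: real^'d::_) 1)"
    by simp
  then show ?thesis
    using content_ball_pos[of 1 "0 :: real^'d::_"]
    unfolding C_def[symmetric] \<sigma>_def[symmetric] measure_sigma_bar[OF C]
    by (simp add: divide_le_eq)
qed

subsection \<open>Orthogonality and dimension\<close>

text \<open>The scalar multiplication is the one in \<open>fun_dim\<close>, so \<open>fs.dim\<close>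
  is the dimension that defines \<open>hdim\<close>.\<close>

interpretation fs: vector_space "\<lambda>(c::real) (f :: 'a \<Rightarrow> real) x. c * f x"
  by unfold_locales (auto simp: algebra_simps fun_eq_iff)

lemma sum_fun_apply: "(\<Sum>i\<in>I. (g i :: 'a \<Rightarrow> real)) x = (\<Sum>i\<in>I. g i x)"
  by (induction I rule: infinite_finite_induct) auto

definition ip :: "(real^'d::finite \<Rightarrow> real) \<Rightarrow> (real^'d \<Rightarrow> real) \<Rightarrow> real" where
  "ip f g = (\<integral>x. f x * g x \<partial>sigma_bar)"

lemma ip_commute: "ip f g = ip g f"
  by (simp add: ip_def mult.commute)

lemma ip_sum_left:
  assumes "\<And>i. i \<in> I \<Longrightarrow> continuous_on (sphere 0 1) (f i)" "continuous_on (sphere 0 1) g"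
  shows "ip (\<lambda>x. \<Sum>i\<in>I. c i * f i x) g = (\<Sum>i\<in>I. c i * ip (f i) g)"
proof -
  have "ip (\<lambda>x. \<Sum>i\<in>I. c i * f i x) g = (\<integral>x. (\<Sum>i\<in>I. c i * (f i x * g x)) \<partial>sigma_bar)"
    unfolding ip_def by (simp add: sum_distrib_right mult.assoc)
  also have "\<dots> = (\<Sum>i\<in>I. \<integral>x. c i * (f i x * g x) \<partial>sigma_bar)"
    by (rule Bochner_Integration.integral_sum)
       (intro integrable_continuous_sigma_bar continuous_intros assms)
  finally show ?thesis
    by (simp add: ip_def)
qed

lemma ip_sum_right:
  assumes "\<And>i. i \<in> I \<Longrightarrow> continuous_on (sphere 0 1) (f i)" "continuous_on (sphere 0 1) g"
  shows "ip g (\<lambda>x. \<Sum>i\<in>I. c i * f i x) = (\<Sum>i\<in>I. c i * ip g (f i))"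
  using ip_sum_left[of I f g c] assms by (simp add: ip_commute)

lemma ip_self_zero:
  assumes "continuous_on (sphere 0 1) f" "ip f f = 0" "x \<in> sphere 0 1"
  shows "f x = 0"
proof -
  have "f x * f x = 0"
    by (rule continuous_nonneg_integral_zero_sphere[where f = "\<lambda>x. f x * f x"])
       (use assms in \<open>auto simp: ip_def intro!: continuous_intros\<close>)
  then show ?thesis by simp
qed

lemma ip_orthogonal:
  fixes Q :: "real^'d::{finite,wellorder} \<Rightarrow> real^'d::_"
  assumes "orthogonal_transformation Q" "continuous_on (sphere 0 1) f" "continuous_on (sphere 0 1) g"
  shows "ip (\<lambda>x. f (Q x)) (\<lambda>x. g (Q x)) = ip f g"
  unfolding ip_def
  by (rule integral_sigma_bar_orthogonal[OF assms(1)
        measurable_continuous_sigma_bar[OF continuous_on_mult[OF assms(2,3)]]])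

lemma independent_orthogonal:
  assumes "finite I" "\<And>i. i \<in> I \<Longrightarrow> continuous_on (sphere 0 1) (F i)"
    and orth: "\<And>i j. i \<in> I \<Longrightarrow> j \<in> I \<Longrightarrow> i \<noteq> j \<Longrightarrow> ip (F i) (F j) = 0"
    and nz: "\<And>i. i \<in> I \<Longrightarrow> ip (F i) (F i) \<noteq> 0"
  shows "inj_on F I" "fs.independent (F ` I)"
proof -
  show inj: "inj_on F I"
    by (rule inj_onI) (metis nz orth)
  show "fs.independent (F ` I)"
  proof (rule fs.independent_if_scalars_zero)
    fix u f
    assume sum: "(\<Sum>v\<in>F ` I. (\<lambda>x. u v * v x)) = 0" and "f \<in> F ` I"
    then obtain i where i: "i \<in> I" "f = F i" by blast
    have "(\<lambda>x. \<Sum>j\<in>I. u (F j) * F j x) = (\<lambda>x. 0)"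
    proof
      fix x
      have "(\<Sum>v\<in>F ` I. (\<lambda>x. u v * v x)) x = 0"
        using sum by simp
      then show "(\<Sum>j\<in>I. u (F j) * F j x) = 0"
        by (simp add: sum_fun_apply sum.reindex[OF inj])
    qed
    then have "0 = ip (\<lambda>x. \<Sum>j\<in>I. u (F j) * F j x) (F i)"
      by (simp add: ip_def)
    also have "\<dots> = (\<Sum>j\<in>I. u (F j) * ip (F j) (F i))"
      by (rule ip_sum_left) (use assms i in auto)
    also have "\<dots> = (\<Sum>j\<in>I. if j = i then u (F i) * ip (F i) (F i) else 0)"
      by (rule sum.cong) (use orth i in auto)
    also have "\<dots> = u (F i) * ip (F i) (F i)"
      using i assms(1) by simp
    finally show "u f = 0"
      using nz i by simp
  qed (use assms in simp)
qed

text \<open>The one dimension count of the proof, used twice: to bound the sum of the h_n with n <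
  k, and to exclude a second zonal harmonic of the same degree.\<close>

lemma orthogonal_card_le:
  assumes "finite I" "\<And>i. i \<in> I \<Longrightarrow> continuous_on (sphere 0 1) (F i)"
    and "\<And>i j. i \<in> I \<Longrightarrow> j \<in> I \<Longrightarrow> i \<noteq> j \<Longrightarrow> ip (F i) (F j) = 0"
    and "\<And>i. i \<in> I \<Longrightarrow> ip (F i) (F i) \<noteq> 0"
    and "finite B" "\<And>i. i \<in> I \<Longrightarrow> F i \<in> fs.span B"
  shows "card I \<le> card B"
proof -
  note ind = independent_orthogonal[OF assms(1-4)]
  have "F ` I \<subseteq> fs.span B"
    using assms(6) by blast
  then have "card (F ` I) \<le> card B"
    using fs.independent_span_bound[OF assms(5) ind(2)] by simp
  then show ?thesis
    by (simp add: card_image ind(1))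
qed

section \<open>Monomials on the sphere\<close>

lemma index_ne_exists:
  assumes "CARD('d::finite) \<ge> 2"
  shows "\<exists>a :: 'd. a \<noteq> e"
proof (rule ccontr)
  assume "\<nexists>a :: 'd. a \<noteq> e"
  then have "UNIV = {e}" by auto
  then have "CARD('d) = card {e}" by (rule arg_cong)
  with assms show False by simp
qed

text \<open>Extended by 0 off the sphere, as in \<open>sph_harm\<close>, so that identities valid on
  the sphere become equalities of functions and can be used in spans.\<close>

definition smono :: "('d::finite \<Rightarrow> nat) \<Rightarrow> real^'d \<Rightarrow> real" where
  "smono \<alpha> x = (if x \<in> sphere 0 1 then \<Prod>i\<in>UNIV. (x $ i) ^ \<alpha> i else 0)"

lemma sph_harm_in_span_smono:
  assumes "F \<in> sph_harm n"
  shows "F \<in> fs.span (smono ` {\<alpha>. sum \<alpha> UNIV = n})"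
proof -
  obtain p where p: "hom_poly n p" "\<And>x. laplacian p x = 0"
    "\<And>x. x \<in> sphere 0 1 \<Longrightarrow> F x = p x" "\<And>x. x \<notin> sphere 0 1 \<Longrightarrow> F x = 0"
    using sph_harmE[OF assms] by blast
  obtain c where c: "\<And>x. p x = (\<Sum>\<alpha>\<in>{\<alpha>. sum \<alpha> UNIV = n}. c \<alpha> * (\<Prod>j\<in>UNIV. (x $ j) ^ \<alpha> j))"
    using p(1) unfolding hom_poly_def by blast
  have "F = (\<Sum>\<alpha>\<in>{\<alpha>. sum \<alpha> UNIV = n}. (\<lambda>x. c \<alpha> * smono \<alpha> x))"
  proof
    fix x
    show "F x = (\<Sum>\<alpha>\<in>{\<alpha>. sum \<alpha> UNIV = n}. (\<lambda>x. c \<alpha> * smono \<alpha> x)) x"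
      using p(3)[of x] p(4)[of x] by (cases "x \<in> sphere 0 1") (simp_all add: sum_fun_apply smono_def c)
  qed
  also have "\<dots> \<in> fs.span (smono ` {\<alpha>. sum \<alpha> UNIV = n})"
    by (intro fs.span_sum fs.span_scale fs.span_base) auto
  finally show ?thesis .
qed

lemma smono_upd:
  "x \<in> sphere 0 1 \<Longrightarrow> smono (\<alpha>(i := \<alpha> i + 2)) x = smono \<alpha> x * (x $ i)\<^sup>2"
proof -
  assume "x \<in> sphere 0 1"
  moreover have "(\<Prod>j\<in>UNIV. (x $ j) ^ (\<alpha>(i := \<alpha> i + 2)) j) = (\<Prod>j\<in>UNIV. (x $ j) ^ \<alpha> j) * (x $ i)\<^sup>2"
    by (simp add: prod.remove[of UNIV i] power_add power2_eq_square)
  ultimately show ?thesis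
    by (simp add: smono_def)
qed

text \<open>On the sphere x_e^2 is 1 minus the other squares, so the exponent of x_e drops by two
  without raising the total degree. What remains is an exponent 0 or 1 at \<open>e\<close> and
  exponents below \<open>k\<close> elsewhere, one spanning set of size 2 k^(d-1) for all degrees
  below \<open>k\<close> together.\<close>

lemma smono_in_span:
  fixes e :: "'d::finite"
  assumes "sum \<alpha> UNIV < k"
  shows "smono \<alpha> \<in> fs.span (smono ` {\<alpha>. \<alpha> e < 2 \<and> (\<forall>i. i \<noteq> e \<longrightarrow> \<alpha> i < k)})"
  using assms
proof (induction "\<alpha> e" arbitrary: \<alpha> rule: less_induct)
  case less
  let ?B = "smono ` {\<alpha>. \<alpha> e < 2 \<and> (\<forall>i. i \<noteq> e \<longrightarrow> \<alpha> i < k)}"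
  show ?case
  proof (cases "\<alpha> e < 2")
    case True
    have "\<alpha> i \<le> sum \<alpha> UNIV" for i
      by (rule member_le_sum) auto
    then have "\<alpha> i < k" for i
      using less.prems le_less_trans by blast
    with True show ?thesis
      by (intro fs.span_base) auto
  next
    case False
    define \<beta> where "\<beta> = \<alpha>(e := \<alpha> e - 2)"
    have \<alpha>: "\<alpha> = \<beta>(e := \<beta> e + 2)"
      using False by (auto simp: \<beta>_def fun_eq_iff)
    have sum_upd: "sum (\<gamma>(i := \<gamma> i + 2)) UNIV = sum \<gamma> UNIV + 2" for \<gamma> :: "'d \<Rightarrow> nat" and i
      by (simp add: sum.remove[of UNIV i])
    have sum\<alpha>: "sum \<alpha> UNIV = sum \<beta> UNIV + 2"
      by (subst \<alpha>) (rule sum_upd)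
    have 1: "smono \<beta> \<in> fs.span ?B"
      by (rule less.hyps) (use False less.prems sum\<alpha> in \<open>auto simp: \<beta>_def\<close>)
    have 2: "smono (\<beta>(i := \<beta> i + 2)) \<in> fs.span ?B" if "i \<noteq> e" for i
    proof (rule less.hyps)
      show "(\<beta>(i := \<beta> i + 2)) e < \<alpha> e"
        using that False by (simp add: \<beta>_def)
      show "sum (\<beta>(i := \<beta> i + 2)) UNIV < k"
        unfolding sum_upd using less.prems sum\<alpha> by simp
    qed
    have "smono \<alpha> = smono \<beta> - (\<Sum>i\<in>UNIV - {e}. smono (\<beta>(i := \<beta> i + 2)))"
    proof
      fix x :: "real^'d"
      show "smono \<alpha> x = (smono \<beta> - (\<Sum>i\<in>UNIV - {e}. smono (\<beta>(i := \<beta> i + 2)))) x"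
      proof (cases "x \<in> sphere 0 1")
        case True
        have "(norm x)\<^sup>2 = (\<Sum>i\<in>UNIV. (x $ i)\<^sup>2)"
          by (simp add: norm_vec_def L2_set_def sum_nonneg)
        then have "1 = (x $ e)\<^sup>2 + (\<Sum>i\<in>UNIV - {e}. (x $ i)\<^sup>2)"
          using True by (simp add: sum.remove[of UNIV e])
        then have xe: "(x $ e)\<^sup>2 = 1 - (\<Sum>i\<in>UNIV - {e}. (x $ i)\<^sup>2)"
          by simp
        have "smono \<alpha> x = smono \<beta> x * (x $ e)\<^sup>2"
          by (subst \<alpha>) (rule smono_upd[OF True])
        also have "\<dots> = smono \<beta> x - (\<Sum>i\<in>UNIV - {e}. smono \<beta> x * (x $ i)\<^sup>2)"
          unfolding xe by (simp add: right_diff_distrib sum_distrib_left)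
        also have "\<dots> = smono \<beta> x - (\<Sum>i\<in>UNIV - {e}. smono (\<beta>(i := \<beta> i + 2)) x)"
          by (simp only: smono_upd[OF True])
        finally show ?thesis
          by (simp add: sum_fun_apply)
      next
        case False
        then show ?thesis
          by (simp add: smono_def sum_fun_apply)
      qed
    qed
    also have "\<dots> \<in> fs.span ?B"
      using 1 2 by (intro fs.span_diff fs.span_sum) auto
    finally show ?thesis .
  qed
qed

lemma card_smono_basis:
  fixes e :: "'d::finite"
  shows "finite {\<alpha> :: 'd \<Rightarrow> nat. \<alpha> e < 2 \<and> (\<forall>i. i \<noteq> e \<longrightarrow> \<alpha> i < k)}"
    "card {\<alpha> :: 'd \<Rightarrow> nat. \<alpha> e < 2 \<and> (\<forall>i. i \<noteq> e \<longrightarrow> \<alpha> i < k)} = 2 * k ^ (CARD('d) - 1)"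
proof -
  have eq: "{\<alpha> :: 'd \<Rightarrow> nat. \<alpha> e < 2 \<and> (\<forall>i. i \<noteq> e \<longrightarrow> \<alpha> i < k)} = PiE UNIV (\<lambda>i. if i = e then {..<2} else {..<k})"
    by (auto simp: PiE_iff split: if_splits)
  show "finite {\<alpha> :: 'd \<Rightarrow> nat. \<alpha> e < 2 \<and> (\<forall>i. i \<noteq> e \<longrightarrow> \<alpha> i < k)}"
    unfolding eq by (intro finite_PiE) auto
  show "card {\<alpha> :: 'd \<Rightarrow> nat. \<alpha> e < 2 \<and> (\<forall>i. i \<noteq> e \<longrightarrow> \<alpha> i < k)} = 2 * k ^ (CARD('d) - 1)"
    unfolding eq by (subst card_PiE) (auto simp: prod.remove[of UNIV e] card_Diff_singleton)
qed

section \<open>Zonal functions and polynomials in the height\<close>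

definition zonal :: "(real^'d::{finite,wellorder} \<Rightarrow> real) \<Rightarrow> bool" where
  "zonal q \<longleftrightarrow> (\<forall>x\<in>sphere 0 1. \<forall>y\<in>sphere 0 1. x \<bullet> north_pole = y \<bullet> north_pole \<longrightarrow> q x = q y)"

lemma zonalI:
  fixes q :: "real^'d::{finite,wellorder} \<Rightarrow> real"
  assumes "\<And>v x. v \<bullet> north_pole = 0 \<Longrightarrow> x \<in> sphere 0 1 \<Longrightarrow> q (hreflect v x) = q x"
  shows "zonal q"
  unfolding zonal_def
proof (intro ballI impI)
  fix x y :: "real^'d::_"
  assume "x \<in> sphere 0 1" "y \<in> sphere 0 1" "x \<bullet> north_pole = y \<bullet> north_pole"
  then show "q x = q y"
    using assms[of "x - y" x] hreflect_swap[of x y] by (simp add: inner_diff_left)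
qed

definition pole_power :: "nat \<Rightarrow> real^'d::{finite,wellorder} \<Rightarrow> real" where
  "pole_power i x = (if x \<in> sphere 0 1 then (x \<bullet> north_pole) ^ i else 0)"

text \<open>On a great circle through the pole, a zonal \<open>q\<close> has the same value at the
  two points (t, r) and (t, -r) with r^2 = 1 - t^2. Averaging them cancels odd powers of r, and even
  ones are powers of 1 - t^2, which leaves a polynomial of degree at most \<open>n\<close> in the
  height t.\<close>

lemma zonal_in_span_pole_power:
  fixes q :: "real^'d::{finite,wellorder} \<Rightarrow> real"
  assumes "CARD('d) \<ge> 2" "q \<in> sph_harm n" "zonal q"
  shows "q \<in> fs.span (pole_power ` {..n})"
proof -
  obtain p where p: "hom_poly n p" "\<And>x. laplacian p x = 0"
    "\<And>x. x \<in> sphere 0 1 \<Longrightarrow> q x = p x" "\<And>x. x \<notin> sphere 0 1 \<Longrightarrow> q x = 0"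
    using sph_harmE[OF assms(2)] by blast
  obtain c where c: "\<And>x. p x = (\<Sum>\<alpha>\<in>{\<alpha>. sum \<alpha> UNIV = n}. c \<alpha> * (\<Prod>j\<in>UNIV. (x $ j) ^ \<alpha> j))"
    using p(1) unfolding hom_poly_def by blast
  define e :: 'd where "e = Max UNIV"
  obtain a where a: "a \<noteq> e"
    using index_ne_exists[OF assms(1)] by blast
  define pt where "pt t r = t *\<^sub>R (north_pole :: real^'d::_) + r *\<^sub>R axis a 1" for t r :: real
  have pt_pole: "pt t r \<bullet> north_pole = t" for t r
    using a by (simp add: pt_def inner_north_pole) (simp add: north_pole_def axis_def e_def)
  have pt_norm: "(norm (pt t r))\<^sup>2 = t\<^sup>2 + r\<^sup>2" for t r
  proof -
    have "(north_pole :: real^'d::_) \<bullet> north_pole = 1"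
      by (simp add: dot_square_norm)
    moreover have "(north_pole :: real^'d::_) \<bullet> axis a 1 = 0"
      using a by (simp add: inner_axis) (simp add: north_pole_def axis_def e_def)
    moreover have "(axis a 1 :: real^'d::_) \<bullet> axis a 1 = 1"
      by (simp add: inner_axis)
    ultimately show ?thesis
      unfolding power2_norm_eq_inner pt_def
      by (simp add: inner_add_left inner_add_right inner_commute[of "axis a 1" north_pole] power2_eq_square)
  qed
  have monom: "\<exists>P :: real poly. degree P \<le> n \<and> (\<forall>t. \<bar>t\<bar> \<le> 1 \<longrightarrow>
      ((\<Prod>i\<in>UNIV. (pt t (sqrt (1 - t\<^sup>2)) $ i) ^ \<alpha> i) + (\<Prod>i\<in>UNIV. (pt t (- sqrt (1 - t\<^sup>2)) $ i) ^ \<alpha> i)) / 2 = poly P t)"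
    if \<alpha>: "sum \<alpha> UNIV = n" for \<alpha>
  proof -
    \<comment> \<open>All other coordinates of \<open>pt t r\<close> are 0, so by 0^0 = 1 this
      factor is 1 if \<alpha> is supported on \<open>e\<close> and \<open>a\<close>, and 0
      otherwise.\<close>
    define z where "z = (\<Prod>i\<in>UNIV - {e} - {a}. (0::real) ^ \<alpha> i)"
    have prod: "(\<Prod>i\<in>UNIV. (pt t r $ i) ^ \<alpha> i) = z * (t ^ \<alpha> e * r ^ \<alpha> a)" for t r
    proof -
      have "(\<Prod>i\<in>UNIV. (pt t r $ i) ^ \<alpha> i)
          = (pt t r $ e) ^ \<alpha> e * ((pt t r $ a) ^ \<alpha> a * (\<Prod>i\<in>UNIV - {e} - {a}. (pt t r $ i) ^ \<alpha> i))"
        using a by (simp add: prod.remove[of _ e] prod.remove[of _ a])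
      also have "(\<Prod>i\<in>UNIV - {e} - {a}. (pt t r $ i) ^ \<alpha> i) = z"
        unfolding z_def by (rule prod.cong) (auto simp: pt_def north_pole_def axis_def e_def)
      also have "pt t r $ e = t"
        using a by (auto simp: pt_def north_pole_def axis_def e_def)
      also have "pt t r $ a = r"
        using a by (auto simp: pt_def north_pole_def axis_def e_def)
      finally show ?thesis by simp
    qed
    show ?thesis
    proof (cases "even (\<alpha> a)")
      case False
      then show ?thesis
        by (intro exI[of _ 0]) (auto simp: prod)
    next
      case True
      then obtain l where l: "\<alpha> a = 2 * l" by blast
      let ?P = "smult z (monom 1 (\<alpha> e) * [:1, 0, -1:] ^ l)"
      have "\<alpha> e + \<alpha> a = sum \<alpha> {e, a}"
        using a by simp
      also have "\<dots> \<le> sum \<alpha> UNIV"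
        by (rule sum_mono2) auto
      finally have "\<alpha> e + 2 * l \<le> n"
        using l \<alpha> by simp
      moreover have "degree ?P \<le> \<alpha> e + 2 * l"
      proof -
        have "degree ?P \<le> degree (monom (1::real) (\<alpha> e)) + degree ([:1, 0, -1:] ^ l :: real poly)"
          using degree_smult_le degree_mult_le order_trans by blast
        also have "degree ([:1, 0, -1:] ^ l :: real poly) \<le> degree [:1, 0, -1::real:] * l"
          by (rule degree_power_le)
        finally show ?thesis
          using degree_monom_le[of "1::real" "\<alpha> e"] by simp
      qed
      moreover have "sqrt (1 - t\<^sup>2) ^ (2 * l) = (1 - t\<^sup>2) ^ l" if "\<bar>t\<bar> \<le> 1" for t :: real
        using that by (simp add: power_mult abs_square_le_1)
      ultimately show ?thesis
        by (intro exI[of _ ?P]) (auto simp: prod l poly_monom poly_power power2_eq_square algebra_simps)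
    qed
  qed
  then have "\<forall>\<alpha>\<in>{\<alpha>. sum \<alpha> UNIV = n}. \<exists>P :: real poly. degree P \<le> n \<and> (\<forall>t. \<bar>t\<bar> \<le> 1 \<longrightarrow>
      ((\<Prod>i\<in>UNIV. (pt t (sqrt (1 - t\<^sup>2)) $ i) ^ \<alpha> i) + (\<Prod>i\<in>UNIV. (pt t (- sqrt (1 - t\<^sup>2)) $ i) ^ \<alpha> i)) / 2 = poly P t)"
    by simp
  from bchoice[OF this] obtain P where "\<forall>\<alpha>\<in>{\<alpha>. sum \<alpha> UNIV = n}. degree (P \<alpha>) \<le> n \<and> (\<forall>t. \<bar>t\<bar> \<le> 1 \<longrightarrow>
      ((\<Prod>i\<in>UNIV. (pt t (sqrt (1 - t\<^sup>2)) $ i) ^ \<alpha> i)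
      + (\<Prod>i\<in>UNIV. (pt t (- sqrt (1 - t\<^sup>2)) $ i) ^ \<alpha> i)) / 2 = poly (P \<alpha> :: real poly) t)"
    by (rule exE)
  then have P: "degree (P \<alpha>) \<le> n" "\<bar>t\<bar> \<le> 1 \<Longrightarrow> ((\<Prod>i\<in>UNIV. (pt t (sqrt (1 - t\<^sup>2)) $ i) ^ \<alpha> i)
      + (\<Prod>i\<in>UNIV. (pt t (- sqrt (1 - t\<^sup>2)) $ i) ^ \<alpha> i)) / 2 = poly (P \<alpha> :: real poly) t"
    if "sum \<alpha> UNIV = n" for \<alpha> t
    using that by simp_all
  define R where "R = (\<Sum>\<alpha>\<in>{\<alpha>. sum \<alpha> UNIV = n}. smult (c \<alpha>) (P \<alpha>))"
  have degR: "degree R \<le> n"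
    unfolding R_def
    by (rule degree_sum_le) (use P(1) finite_multiindices in \<open>auto intro: order_trans[OF degree_smult_le]\<close>)
  have qR: "q x = poly R (x \<bullet> north_pole)" if x: "x \<in> sphere 0 1" for x
  proof -
    define t where "t = x \<bullet> north_pole"
    have t: "\<bar>t\<bar> \<le> 1"
      using Cauchy_Schwarz_ineq2[of x north_pole] x by (simp add: t_def)
    then have t2: "t\<^sup>2 \<le> 1"
      by (simp add: abs_square_le_1)
    have q: "q x = p (pt t r)" if "r\<^sup>2 = 1 - t\<^sup>2" for r
    proof -
      have "norm (pt t r) = 1"
        using pt_norm[of t r] that norm_ge_zero[of "pt t r"] by (simp add: power2_eq_1_iff)
      then have s: "pt t r \<in> sphere 0 1"
        by simp
      then have "q x = q (pt t r)"
        using assms(3)[unfolded zonal_def, rule_format, OF x s] by (simp add: pt_pole t_def)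
      then show ?thesis
        using p(3)[OF s] by simp
    qed
    have "q x = (p (pt t (sqrt (1 - t\<^sup>2))) + p (pt t (- sqrt (1 - t\<^sup>2)))) / 2"
      using q[of "sqrt (1 - t\<^sup>2)"] q[of "- sqrt (1 - t\<^sup>2)"] t2 by simp
    also have "\<dots> = (\<Sum>\<alpha>\<in>{\<alpha>. sum \<alpha> UNIV = n}. c \<alpha> * (((\<Prod>i\<in>UNIV. (pt t (sqrt (1 - t\<^sup>2)) $ i) ^ \<alpha> i)
      + (\<Prod>i\<in>UNIV. (pt t (- sqrt (1 - t\<^sup>2)) $ i) ^ \<alpha> i)) / 2))"
      unfolding c sum.distrib[symmetric] sum_divide_distrib by (intro sum.cong refl) (simp add: distrib_left)
    also have "\<dots> = (\<Sum>\<alpha>\<in>{\<alpha>. sum \<alpha> UNIV = n}. c \<alpha> * poly (P \<alpha>) t)"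
      by (intro sum.cong refl) (use P(2) t in auto)
    also have "\<dots> = poly R t"
      by (simp add: R_def poly_sum)
    finally show ?thesis
      by (simp add: t_def)
  qed
  have polyR: "poly R t = (\<Sum>i\<le>n. coeff R i * t ^ i)" for t
    using arg_cong[OF poly_as_sum_of_monoms'[OF degR], of "\<lambda>p. poly p t"]
    by (simp add: poly_sum poly_monom)
  have "q = (\<Sum>i\<le>n. (\<lambda>x. coeff R i * pole_power i x))"
  proof
    fix x
    show "q x = (\<Sum>i\<le>n. (\<lambda>x. coeff R i * pole_power i x)) x"
      using qR[of x] p(4)[of x] polyR[of "x \<bullet> north_pole"]
      by (cases "x \<in> sphere 0 1") (simp_all add: sum_fun_apply pole_power_def)
  qed
  also have "\<dots> \<in> fs.span (pole_power ` {..n})"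
    by (intro fs.span_sum fs.span_scale fs.span_base) auto
  finally show ?thesis .
qed

subsection \<open>Zonal harmonics\<close>

lemma abs_integral_sigma_bar_le:
  fixes f :: "real^'d::finite \<Rightarrow> real"
  assumes "f \<in> borel_measurable sigma_bar" "\<And>x. x \<in> sphere 0 1 \<Longrightarrow> \<bar>f x\<bar> \<le> C"
  shows "\<bar>\<integral>x. f x \<partial>sigma_bar\<bar> \<le> C"
proof -
  have int: "integrable sigma_bar f"
    by (rule integrable_sigma_bar_bounded[OF assms])
  have "\<bar>\<integral>x. f x \<partial>sigma_bar\<bar> \<le> (\<integral>x. \<bar>f x\<bar> \<partial>sigma_bar)"
    by (rule integral_abs_bound)
  also have "\<dots> \<le> (\<integral>x. C \<partial>(sigma_bar :: (real^'d) measure))"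
    by (rule integral_mono) (use int assms integrable_continuous_sigma_bar[of "\<lambda>x. C"] in auto)
  also have "\<dots> = C"
    by simp
  finally show ?thesis .
qed

lemma ip_abs_le:
  assumes "continuous_on (sphere 0 1) f" "continuous_on (sphere 0 1) g"
    "\<And>x. x \<in> sphere 0 1 \<Longrightarrow> \<bar>f x\<bar> \<le> A" "\<And>x. x \<in> sphere 0 1 \<Longrightarrow> \<bar>g x\<bar> \<le> B" "A \<ge> 0"
  shows "\<bar>ip f g\<bar> \<le> A * B"
  unfolding ip_def
proof (rule abs_integral_sigma_bar_le)
  show "(\<lambda>x. f x * g x) \<in> borel_measurable sigma_bar"
    by (intro measurable_continuous_sigma_bar continuous_intros assms)
  show "\<bar>f x * g x\<bar> \<le> A * B" if "x \<in> sphere 0 1" for x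
    unfolding abs_mult using assms(3,4)[OF that] assms(5) by (intro mult_mono) auto
qed

lemma ip_diff_left:
  assumes "continuous_on (sphere 0 1) f" "continuous_on (sphere 0 1) g" "continuous_on (sphere 0 1) h"
  shows "ip (\<lambda>x. f x - g x) h = ip f h - ip g h"
  unfolding ip_def left_diff_distrib
  by (rule Bochner_Integration.integral_diff)
     (intro integrable_continuous_sigma_bar continuous_intros assms)+

lemma ip_diff_right:
  assumes "continuous_on (sphere 0 1) f" "continuous_on (sphere 0 1) g" "continuous_on (sphere 0 1) h"
  shows "ip h (\<lambda>x. f x - g x) = ip h f - ip h g"
  using ip_diff_left[OF assms] by (simp add: ip_commute)

lemma ip_cmult_left: "ip (\<lambda>x. c * f x) g = c * ip f g"
  by (simp add: ip_def mult.assoc)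

lemma ip_cong:
  assumes "\<And>x. x \<in> sphere 0 1 \<Longrightarrow> f x = f' x" "\<And>x. x \<in> sphere 0 1 \<Longrightarrow> g x = g' x"
  shows "ip f g = ip f' g'"
  unfolding ip_def by (rule Bochner_Integration.integral_cong) (use assms in auto)

lemma sphere_inner_le:
  assumes "x \<in> sphere 0 1" "y \<in> sphere (0 :: 'a :: real_inner) 1"
  shows "\<bar>x \<bullet> y\<bar> \<le> 1"
  using Cauchy_Schwarz_ineq2[of x y] assms by simp

lemma north_pole_in_sphere [simp]: "north_pole \<in> sphere 0 1"
  by simp

lemma continuous_on_zonal_function:
  fixes \<phi> :: "real \<Rightarrow> real"
  assumes "continuous_on {-1..1} \<phi>"
  shows "continuous_on (sphere 0 1) (\<lambda>x :: real^'d::{finite,wellorder}. \<phi> (x \<bullet> north_pole))"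
proof (rule continuous_on_compose2[OF assms])
  show "(\<lambda>x. x \<bullet> north_pole) ` sphere 0 1 \<subseteq> {-1..1}"
    using sphere_inner_le[OF _ north_pole_in_sphere] by (force simp: abs_le_iff)
qed (intro continuous_intros)

section \<open>Expansions in the given signed basis\<close>

locale signed_basis =
  fixes Y :: "nat \<Rightarrow> nat \<Rightarrow> real^'d::{finite,wellorder} \<Rightarrow> real"
  assumes card_ge_2: "CARD('d) \<ge> 2"
    and onb: "signed_onb Y"
begin

lemma Y_in: "j \<in> {1..hdim TYPE('d) n} \<Longrightarrow> Y n j \<in> sph_harm n"
  using onb unfolding signed_onb_def by blast

lemma Y_cont: "j \<in> {1..hdim TYPE('d) n} \<Longrightarrow> continuous_on (sphere 0 1) (Y n j)"
  using continuous_on_sph_harm Y_in by blast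

lemma Y_orth:
  "j \<in> {1..hdim TYPE('d) n} \<Longrightarrow> j' \<in> {1..hdim TYPE('d) n'} \<Longrightarrow> ip (Y n j) (Y n' j') = (if n = n' \<and> j = j' then 1 else 0)"
  using onb unfolding signed_onb_def ip_def by blast

lemma Y_pole_nonneg: "j \<in> {1..hdim TYPE('d) n} \<Longrightarrow> Y n j north_pole \<ge> 0"
  using onb unfolding signed_onb_def by blast

lemma Y_pole_pos: "\<exists>N. \<forall>n\<ge>N. \<forall>j\<in>{1..hdim TYPE('d) n}. Y n j north_pole > 0"
  using onb unfolding signed_onb_def by blast

lemma Y_complete:
  assumes "continuous_on (sphere 0 1) f" "\<And>n j. j \<in> {1..hdim TYPE('d) n} \<Longrightarrow> ip f (Y n j) = 0" "x \<in> sphere 0 1"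
  shows "f x = 0"
proof (rule continuous_AE_zero_sphere[OF assms(1) _ assms(3)])
  have "f \<in> borel_measurable sigma_bar"
    by (rule measurable_continuous_sigma_bar[OF assms(1)])
  moreover have "integrable sigma_bar (\<lambda>x. (f x)\<^sup>2)"
    by (intro integrable_continuous_sigma_bar continuous_intros assms)
  ultimately show "AE x in sigma_bar. f x = 0"
    using onb assms(2) unfolding signed_onb_def ip_def by blast
qed

lemma Y_independent: "inj_on (Y n) {1..hdim TYPE('d) n}" "fs.independent (Y n ` {1..hdim TYPE('d) n})"
proof -
  have 1: "finite {1..hdim TYPE('d) n}" by simp
  have 2: "continuous_on (sphere 0 1) (Y n j)" if "j \<in> {1..hdim TYPE('d) n}" for j
    using Y_cont[OF that] .
  have 3: "ip (Y n i) (Y n j) = 0" if "i \<in> {1..hdim TYPE('d) n}" "j \<in> {1..hdim TYPE('d) n}" "i \<noteq> j" for i j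
    using Y_orth[OF that(1,2)] that(3) by simp
  have 4: "ip (Y n j) (Y n j) \<noteq> 0" if "j \<in> {1..hdim TYPE('d) n}" for j
    using Y_orth[OF that that] by simp
  show "inj_on (Y n) {1..hdim TYPE('d) n}"
    by (rule independent_orthogonal(1)[OF 1 2 3 4])
  show "fs.independent (Y n ` {1..hdim TYPE('d) n})"
    by (rule independent_orthogonal(2)[OF 1 2 3 4])
qed

text \<open>By the definition of \<open>hdim\<close> the basis has as many functions of degree
  \<open>n\<close> as the dimension of \<open>sph_harm n\<close>, so being independent they span
  it.\<close>

lemma sph_harm_subset_span: "sph_harm n \<subseteq> fs.span (Y n ` {1..hdim TYPE('d) n})"
proof
  fix F :: "real^'d::_ \<Rightarrow> real"
  assume F: "F \<in> sph_harm n"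
  let ?V = "sph_harm n :: (real^'d::_ \<Rightarrow> real) set"
  let ?B = "Y n ` {1..hdim TYPE('d) n}"
  show "F \<in> fs.span ?B"
  proof (rule ccontr)
    assume nin: "F \<notin> fs.span ?B"
    obtain B' where B': "B' \<subseteq> ?V" "fs.independent B'" "?V \<subseteq> fs.span B'" "card B' = fs.dim ?V"
      using fs.basis_exists by blast
    \<comment> \<open>Finiteness must come from the monomials: for an infinite \<open>B'\<close> the
      value of \<open>card\<close> is 0 and comparing cardinalities would prove nothing.\<close>
    have "B' \<subseteq> fs.span (smono ` {\<alpha>. sum \<alpha> UNIV = n})"
      using B'(1) sph_harm_in_span_smono by blast
    then have "finite B'"
      using fs.independent_span_bound[OF finite_imageI[OF finite_multiindices] B'(2)] by blast
    moreover have "fs.independent (insert F ?B)"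
      using Y_independent(2) nin by (simp add: fs.independent_insert)
    moreover have "insert F ?B \<subseteq> fs.span B'"
      using F B'(3) Y_in by blast
    ultimately have "card (insert F ?B) \<le> card B'"
      using fs.independent_span_bound by blast
    moreover have "card (insert F ?B) = Suc (hdim TYPE('d) n)"
    proof -
      have "F \<notin> ?B"
        using nin fs.span_base by blast
      then have "card (insert F ?B) = Suc (card ?B)"
        by simp
      then show ?thesis
        unfolding card_image[OF Y_independent(1)] by simp
    qed
    moreover have "card B' = hdim TYPE('d) n"
      using B'(4) by (simp add: hdim_def fun_dim_def)
    ultimately show False by simp
  qed
qed

lemma sph_harm_expansion:
  assumes "F \<in> sph_harm n"
  shows "F x = (\<Sum>j=1..hdim TYPE('d) n. ip F (Y n j) * Y n j x)"
proof -
  have "F \<in> fs.span (Y n ` {1..hdim TYPE('d) n})"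
    using sph_harm_subset_span assms by blast
  then obtain u where "F = (\<Sum>v\<in>Y n ` {1..hdim TYPE('d) n}. (\<lambda>x. u v * v x))"
    using fs.span_finite[of "Y n ` {1..hdim TYPE('d) n}"] by auto
  then have F: "F x = (\<Sum>j=1..hdim TYPE('d) n. u (Y n j) * Y n j x)" for x
    unfolding sum_fun_apply sum.reindex[OF Y_independent(1)] o_def by simp
  have "ip F (Y n j) = u (Y n j)" if j: "j \<in> {1..hdim TYPE('d) n}" for j
  proof -
    have "ip F (Y n j) = ip (\<lambda>x. \<Sum>i=1..hdim TYPE('d) n. u (Y n i) * Y n i x) (Y n j)"
      by (simp add: ip_def F)
    also have "\<dots> = (\<Sum>i=1..hdim TYPE('d) n. u (Y n i) * ip (Y n i) (Y n j))"
      by (rule ip_sum_left) (use j Y_cont in blast)+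
    also have "\<dots> = (\<Sum>i=1..hdim TYPE('d) n. if i = j then u (Y n j) else 0)"
      by (intro sum.cong refl) (use j Y_orth in auto)
    finally show ?thesis
      using j by simp
  qed
  then show ?thesis
    unfolding F by (intro sum.cong) auto
qed

text \<open>Each \<open>sph_harm n\<close> is spanned by its own basis functions, so orthogonality
  between degrees is inherited from \<open>Y\<close>.\<close>

lemma sph_harm_orthogonal_degrees:
  fixes F G :: "real^'d::_ \<Rightarrow> real"
  assumes "F \<in> sph_harm m" "G \<in> sph_harm n" "m \<noteq> n"
  shows "ip F G = 0"
proof -
  have G: "ip (Y m i) G = 0" if i: "i \<in> {1..hdim TYPE('d) m}" for i
  proof -
    have "ip (Y m i) G = ip (Y m i) (\<lambda>x. \<Sum>j=1..hdim TYPE('d) n. ip G (Y n j) * Y n j x)"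
      by (rule ip_cong[OF refl sph_harm_expansion[OF assms(2)]])
    also have "\<dots> = (\<Sum>j=1..hdim TYPE('d) n. ip G (Y n j) * ip (Y m i) (Y n j))"
      by (rule ip_sum_right) (use i Y_cont in blast)+
    also have "\<dots> = 0"
      by (rule sum.neutral) (use i Y_orth assms(3) in auto)
    finally show ?thesis .
  qed
  have "ip F G = ip (\<lambda>x. \<Sum>j=1..hdim TYPE('d) m. ip F (Y m j) * Y m j x) G"
    by (rule ip_cong[OF sph_harm_expansion[OF assms(1)] refl])
  also have "\<dots> = (\<Sum>j=1..hdim TYPE('d) m. ip F (Y m j) * ip (Y m j) G)"
    by (rule ip_sum_left) (use Y_cont continuous_on_sph_harm assms in blast)+
  also have "\<dots> = 0"
    by (rule sum.neutral) (use G in auto)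
  finally show ?thesis .
qed

lemma h_pos: "hdim TYPE('d) n \<ge> 1"
proof -
  obtain a b :: 'd where "a \<noteq> b"
    using index_ne_exists[OF card_ge_2] by blast
  then obtain F :: "real^'d::_ \<Rightarrow> real" where F: "F \<in> sph_harm n" "F (axis a 1) = 1"
    using sph_harm_nonzero_exists[of a b n] by blast
  show ?thesis
  proof (rule ccontr)
    assume "\<not> hdim TYPE('d) n \<ge> 1"
    then show False
      using sph_harm_expansion[OF F(1), of "axis a 1"] F(2) by simp
  qed
qed

text \<open>All \<open>Y n j\<close> with \<open>n < k\<close> are orthonormal and lie in the span
  of the reduced monomials. Counting all degrees at once avoids a formula for the individual
  h_n.\<close>

lemma sum_h_le: "(\<Sum>n<k. hdim TYPE('d) n) \<le> 2 * k ^ (CARD('d) - 1)"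
proof -
  define e :: 'd where "e = undefined"
  let ?I = "SIGMA n:{..<k}. {1..hdim TYPE('d) n}"
  let ?A = "{\<alpha> :: 'd \<Rightarrow> nat. \<alpha> e < 2 \<and> (\<forall>i. i \<noteq> e \<longrightarrow> \<alpha> i < k)}"
  have span: "F \<in> fs.span (smono ` ?A)" if "F \<in> sph_harm n" "n < k" for F n
  proof -
    have "smono ` {\<alpha> :: 'd \<Rightarrow> nat. sum \<alpha> UNIV = n} \<subseteq> fs.span (smono ` ?A)"
      using smono_in_span[of _ k e] that(2) by auto
    then have "fs.span (smono ` {\<alpha> :: 'd \<Rightarrow> nat. sum \<alpha> UNIV = n}) \<subseteq> fs.span (smono ` ?A)"
      by (rule fs.span_minimal) (rule fs.subspace_span)
    then show ?thesis
      using sph_harm_in_span_smono[OF that(1)] by blast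
  qed
  have "card ?I \<le> card (smono ` ?A)"
  proof (rule orthogonal_card_le[where F = "\<lambda>(n, j). Y n j"])
    show "finite (SIGMA n:{..<k}. {1..hdim TYPE('d) n})"
      by blast
    show "finite (smono ` ?A)"
      by (rule finite_imageI) (rule card_smono_basis)
    fix i assume i: "i \<in> ?I"
    then obtain n j where nj: "i = (n, j)" "n < k" "j \<in> {1..hdim TYPE('d) n}" by blast
    show "continuous_on (sphere 0 1) (case i of (n, j) \<Rightarrow> Y n j)"
      using Y_cont[OF nj(3)] nj(1) by simp
    show "ip (case i of (n, j) \<Rightarrow> Y n j) (case i of (n, j) \<Rightarrow> Y n j) \<noteq> 0"
      using Y_orth[OF nj(3,3)] nj(1) by simp
    show "(case i of (n, j) \<Rightarrow> Y n j) \<in> fs.span (smono ` ?A)"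
      using span[OF Y_in[OF nj(3)] nj(2)] nj(1) by simp
    fix i' assume "i' \<in> ?I" "i \<noteq> i'"
    then obtain n' j' where nj': "i' = (n', j')" "j' \<in> {1..hdim TYPE('d) n'}" "\<not> (n = n' \<and> j = j')"
      using nj(1) by blast
    show "ip (case i of (n, j) \<Rightarrow> Y n j) (case i' of (n, j) \<Rightarrow> Y n j) = 0"
      using Y_orth[OF nj(3) nj'(2)] nj(1) nj'(1,3) by auto
  qed
  also have "\<dots> \<le> card ?A"
    by (rule card_image_le) (rule card_smono_basis)
  finally show ?thesis
    by (simp add: card_smono_basis)
qed

section \<open>Reproducing kernels and zonal harmonics\<close>

definition K :: "nat \<Rightarrow> real^'d::_ \<Rightarrow> real^'d::_ \<Rightarrow> real" where
  "K n x y = (\<Sum>j=1..hdim TYPE('d) n. Y n j x * Y n j y)"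

lemma K_in: "(\<lambda>x. K n x y) \<in> sph_harm n"
  unfolding K_def mult.commute[of "Y n _ _" "Y n _ y"]
  by (intro sph_harm_sum sph_harm_cmult Y_in)

lemma K_reproducing:
  assumes "F \<in> sph_harm n"
  shows "ip F (\<lambda>x. K n x y) = F y"
proof -
  have "ip F (\<lambda>x. K n x y) = ip F (\<lambda>x. \<Sum>j=1..hdim TYPE('d) n. Y n j y * Y n j x)"
    by (simp add: K_def mult.commute)
  also have "\<dots> = (\<Sum>j=1..hdim TYPE('d) n. Y n j y * ip F (Y n j))"
    by (rule ip_sum_right) (use Y_cont continuous_on_sph_harm assms in blast)+
  also have "\<dots> = F y"
    using sph_harm_expansion[OF assms, of y] by (simp add: mult.commute)
  finally show ?thesis .
qed

text \<open>As a function of \<open>x\<close>, the reflected kernel has the coefficients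
  \<open>Y n j y\<close> by the reproducing property, since the reflection is applied to
  \<open>y\<close> twice. These are the coefficients of \<open>K n\<close> itself.\<close>

lemma K_hreflect: "K n (hreflect v x) (hreflect v y) = K n x y"
proof -
  let ?R = "hreflect v"
  define k where "k = (\<lambda>x. K n (?R x) (?R y))"
  have k: "k \<in> sph_harm n"
    unfolding k_def by (rule sph_harm_orthogonal[OF K_in orthogonal_hreflect])
  have "ip k (Y n j) = Y n j y" if j: "j \<in> {1..hdim TYPE('d) n}" for j
  proof -
    have Yr: "(\<lambda>x. Y n j (?R x)) \<in> sph_harm n"
      by (rule sph_harm_orthogonal[OF Y_in[OF j] orthogonal_hreflect])
    have "ip k (Y n j) = ip (\<lambda>x. K n (?R x) (?R y)) (\<lambda>x. Y n j (?R (?R x)))"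
      by (simp add: k_def)
    also have "\<dots> = ip (\<lambda>x. K n x (?R y)) (\<lambda>x. Y n j (?R x))"
      by (rule ip_orthogonal[OF orthogonal_hreflect])
         (use Yr K_in continuous_on_sph_harm in blast)+
    also have "\<dots> = Y n j y"
      using K_reproducing[OF Yr, of "?R y"] by (simp add: ip_commute)
    finally show ?thesis .
  qed
  then have "k x = (\<Sum>j=1..hdim TYPE('d) n. Y n j y * Y n j x)"
    unfolding sph_harm_expansion[OF k, of x] by (intro sum.cong) auto
  then show ?thesis
    by (simp add: k_def K_def mult.commute)
qed

text \<open>Reflections act transitively, so the diagonal is constant. Its integral is a sum of h_n
  squared norms equal to 1, and the sphere has total mass 1.\<close>

lemma K_diag:
  assumes "x \<in> sphere 0 1"
  shows "K n x x = hdim TYPE('d) n"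
proof -
  have eq: "K n y y = K n x x" if "y \<in> sphere 0 1" for y
    using K_hreflect[of n "x - y" x x] hreflect_swap[of x y] assms that by simp
  have "(\<integral>y. K n y y \<partial>sigma_bar) = (\<integral>y. K n x x \<partial>(sigma_bar :: (real^'d::_) measure))"
    by (rule Bochner_Integration.integral_cong) (use eq in auto)
  also have "\<dots> = K n x x"
    by simp
  finally have "K n x x = (\<integral>y. (\<Sum>j=1..hdim TYPE('d) n. Y n j y * Y n j y) \<partial>sigma_bar)"
    by (simp add: K_def)
  also have "\<dots> = (\<Sum>j=1..hdim TYPE('d) n. \<integral>y. Y n j y * Y n j y \<partial>sigma_bar)"
    by (rule Bochner_Integration.integral_sum)
       (intro integrable_continuous_sigma_bar continuous_intros Y_cont)
  also have "\<dots> = (\<Sum>j=1..hdim TYPE('d) n. 1)"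
    by (rule sum.cong) (use Y_orth in \<open>auto simp: ip_def\<close>)
  finally show ?thesis
    by simp
qed

lemma K_abs_le:
  assumes "x \<in> sphere 0 1" "y \<in> sphere 0 1"
  shows "\<bar>K n x y\<bar> \<le> hdim TYPE('d) n"
proof -
  have "(K n x y)\<^sup>2 \<le> (\<Sum>j=1..hdim TYPE('d) n. (Y n j x)\<^sup>2) * (\<Sum>j=1..hdim TYPE('d) n. (Y n j y)\<^sup>2)"
    unfolding K_def by (rule Cauchy_Schwarz_ineq_sum)
  also have "\<dots> = (real (hdim TYPE('d) n))\<^sup>2"
    using K_diag[OF assms(1), of n] K_diag[OF assms(2), of n] by (simp add: K_def power2_eq_square)
  finally show ?thesis
    by (simp add: abs_le_square_iff[symmetric])
qed

text \<open>The zonal harmonic of degree \<open>n\<close>, a Gegenbauer polynomial in the height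
  (Chebyshev for d = 2), normalised so as to represent evaluation at the pole. Its value there and
  its squared norm are both h_n.\<close>

definition Z :: "nat \<Rightarrow> real^'d::_ \<Rightarrow> real" where
  "Z n x = K n x north_pole"

lemma Z_in: "Z n \<in> sph_harm n"
  using K_in[of n north_pole] by (simp add: Z_def[abs_def])

lemma Z_cont: "continuous_on (sphere 0 1) (Z n)"
  using continuous_on_sph_harm Z_in by blast

lemma Z_reproducing: "F \<in> sph_harm n \<Longrightarrow> ip F (Z n) = F north_pole"
  using K_reproducing[of F n north_pole] by (simp add: Z_def[abs_def])

lemma Z_pole: "Z n north_pole = hdim TYPE('d) n"
  by (simp add: Z_def K_diag)

lemma Z_abs_le: "x \<in> sphere 0 1 \<Longrightarrow> \<bar>Z n x\<bar> \<le> hdim TYPE('d) n"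
  by (simp add: Z_def K_abs_le)

lemma Z_zonal: "zonal (Z n)"
proof (rule zonalI)
  fix v x :: "real^'d::_"
  assume "v \<bullet> north_pole = 0"
  then show "Z n (hreflect v x) = Z n x"
    using K_hreflect[of n v x north_pole] by (simp add: Z_def hreflect_fix)
qed

lemma Z_orth: "ip (Z m) (Z n) = (if m = n then real (hdim TYPE('d) n) else 0)"
  using Z_reproducing[OF Z_in, of n] sph_harm_orthogonal_degrees[OF Z_in Z_in, of m n]
  by (auto simp: Z_pole)

text \<open>Otherwise \<open>Z 0, \<dots>, Z n, q\<close> would be \<open>n + 2\<close> orthogonal elements of the
  \<open>n + 1\<close>-dimensional space of polynomials of degree at most \<open>n\<close> in the last coordinate.\<close>

lemma zonal_harmonic_zero:
  fixes q :: "real^'d::_ \<Rightarrow> real"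
  assumes q: "q \<in> sph_harm n" "zonal q" "q north_pole = 0"
  shows "q x = 0"
proof (rule ccontr)
  assume nz: "q x \<noteq> 0"
  have qc: "continuous_on (sphere 0 1) q"
    using continuous_on_sph_harm q(1) by blast
  have x: "x \<in> sphere 0 1"
    using sph_harmE[OF q(1)] nz by metis
  have qq: "ip q q \<noteq> 0"
    using ip_self_zero[OF qc _ x] nz by blast
  have qZ: "ip q (Z i) = 0" for i
    using Z_reproducing[OF q(1)] sph_harm_orthogonal_degrees[OF q(1) Z_in, of i] q(3) by (cases "i = n") auto
  define F where "F i = (if i \<le> n then Z i else q)" for i
  have span: "Z i \<in> fs.span (pole_power ` {..n})" if "i \<le> n" for i
    using zonal_in_span_pole_power[OF card_ge_2 Z_in Z_zonal, of i]
      fs.span_mono[of "pole_power ` {..i}" "pole_power ` {..n}"] that by fastforce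
  have "card {..Suc n} \<le> card (pole_power ` {..n} :: (real^'d::_ \<Rightarrow> real) set)"
  proof (rule orthogonal_card_le[where F = F])
    show "continuous_on (sphere 0 1) (F i)" for i
      using qc Z_cont by (simp add: F_def)
    show "ip (F i) (F j) = 0" if "i \<in> {..Suc n}" "j \<in> {..Suc n}" "i \<noteq> j" for i j
      using qZ[of i] qZ[of j] that by (auto simp: F_def Z_orth ip_commute[of "Z _" q])
    show "ip (F i) (F i) \<noteq> 0" for i
      using qq h_pos[of i] by (auto simp: F_def Z_orth)
    show "F i \<in> fs.span (pole_power ` {..n})" for i
      using span[of i] zonal_in_span_pole_power[OF card_ge_2 q(1,2)] by (simp add: F_def)
  qed auto
  also have "\<dots> \<le> card {..n}"
    by (rule card_image_le) simp
  finally show False by simp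
qed

text \<open>The Funk--Hecke multiplier: formally, the kernel \<phi>(x \<bullet> y) is the sum of
  \<open>lam \<phi> n * K n x y\<close>.\<close>

definition lam :: "(real \<Rightarrow> real) \<Rightarrow> nat \<Rightarrow> real" where
  "lam \<phi> n = ip (\<lambda>x. \<phi> (x \<bullet> north_pole)) (Z n) / hdim TYPE('d) n"

text \<open>The degree-n projection \<open>q\<close> of the zonal function is invariant under
  reflections fixing the pole, hence zonal, hence a multiple of \<open>Z n\<close> by
  \<open>zonal_harmonic_zero\<close>. The value at the pole determines the multiple.\<close>

lemma funk_hecke:
  assumes \<phi>: "continuous_on {-1..1} \<phi>" and j: "j \<in> {1..hdim TYPE('d) n}"
  shows "ip (\<lambda>x. \<phi> (x \<bullet> north_pole)) (Y n j) = lam \<phi> n * Y n j north_pole"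
proof -
  let ?f = "\<lambda>x. \<phi> (x \<bullet> north_pole)"
  have fc: "continuous_on (sphere 0 1) ?f"
    by (rule continuous_on_zonal_function[OF \<phi>])
  define q where "q x = (\<Sum>i=1..hdim TYPE('d) n. ip ?f (Y n i) * Y n i x)" for x
  have q: "q \<in> sph_harm n"
    unfolding q_def[abs_def] by (intro sph_harm_sum sph_harm_cmult Y_in)
  have qc: "continuous_on (sphere 0 1) q"
    using continuous_on_sph_harm q by blast
  have qY: "ip q (Y n i) = ip ?f (Y n i)" if i: "i \<in> {1..hdim TYPE('d) n}" for i
  proof -
    have "ip q (Y n i) = (\<Sum>l=1..hdim TYPE('d) n. ip ?f (Y n l) * ip (Y n l) (Y n i))"
      unfolding q_def[abs_def] by (rule ip_sum_left) (use i Y_cont in blast)+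
    also have "\<dots> = (\<Sum>l=1..hdim TYPE('d) n. if l = i then ip ?f (Y n i) else 0)"
      by (intro sum.cong refl) (use i Y_orth in auto)
    finally show ?thesis
      using i by simp
  qed
  \<comment> \<open>Extending from basis functions to all of \<open>sph_harm n\<close> allows
    pairing with reflected basis functions and with \<open>Z n\<close>.\<close>
  have qG: "ip q G = ip ?f G" if G: "G \<in> sph_harm n" for G
  proof -
    have e: "ip w G = (\<Sum>i=1..hdim TYPE('d) n. ip G (Y n i) * ip w (Y n i))"
      if "continuous_on (sphere 0 1) w" for w
    proof -
      have "ip w G = ip w (\<lambda>x. \<Sum>i=1..hdim TYPE('d) n. ip G (Y n i) * Y n i x)"
        by (rule ip_cong[OF refl sph_harm_expansion[OF G]])
      also have "\<dots> = (\<Sum>i=1..hdim TYPE('d) n. ip G (Y n i) * ip w (Y n i))"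
        by (rule ip_sum_right) (use Y_cont that in blast)+
      finally show ?thesis .
    qed
    show ?thesis
      unfolding e[OF qc] e[OF fc] by (intro sum.cong refl) (use qY in auto)
  qed
  have zq: "zonal q"
  proof (rule zonalI)
    fix v x :: "real^'d::_"
    assume v: "v \<bullet> north_pole = 0"
    let ?R = "hreflect v"
    have fR: "?f (?R y) = ?f y" for y
      using hreflect_inner[of v y north_pole] hreflect_fix[OF v] by simp
    have qR: "(\<lambda>y. q (?R y)) \<in> sph_harm n"
      by (rule sph_harm_orthogonal[OF q orthogonal_hreflect])
    have "ip (\<lambda>y. q (?R y)) (Y n i) = ip ?f (Y n i)" if i: "i \<in> {1..hdim TYPE('d) n}" for i
    proof -
      have YR: "(\<lambda>x. Y n i (?R x)) \<in> sph_harm n"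
        by (rule sph_harm_orthogonal[OF Y_in[OF i] orthogonal_hreflect])
      have YRc: "continuous_on (sphere 0 1) (\<lambda>x. Y n i (?R x))"
        using continuous_on_sph_harm YR by blast
      have "ip (\<lambda>y. q (?R y)) (Y n i) = ip (\<lambda>y. q (?R y)) (\<lambda>y. Y n i (?R (?R y)))"
        by simp
      also have "\<dots> = ip q (\<lambda>y. Y n i (?R y))"
        by (rule ip_orthogonal[OF orthogonal_hreflect qc YRc])
      also have "\<dots> = ip ?f (\<lambda>y. Y n i (?R y))"
        by (rule qG[OF YR])
      also have "\<dots> = ip (\<lambda>y. ?f (?R y)) (\<lambda>y. Y n i (?R (?R y)))"
        by (rule ip_orthogonal[OF orthogonal_hreflect fc YRc, symmetric])
      also have "\<dots> = ip ?f (Y n i)"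
        by (simp add: fR)
      finally show ?thesis .
    qed
    then have "q (?R x) = (\<Sum>i=1..hdim TYPE('d) n. ip ?f (Y n i) * Y n i x)"
      unfolding sph_harm_expansion[OF qR, of x] by (intro sum.cong refl) auto
    then show "q (?R x) = q x"
      by (simp add: q_def)
  qed
  have qpole: "q north_pole = ip ?f (Z n)"
    using Z_reproducing[OF q] qG[OF Z_in] by simp
  define r where "r x = q x + (- lam \<phi> n) * Z n x" for x
  have "r \<in> sph_harm n"
    unfolding r_def[abs_def] by (intro sph_harm_add sph_harm_cmult q Z_in)
  moreover have "zonal r"
    using zq Z_zonal[of n] unfolding zonal_def r_def by metis
  moreover have "r north_pole = 0"
    using h_pos[of n] by (simp add: r_def Z_pole lam_def qpole)
  ultimately have "r x = 0" for x
    using zonal_harmonic_zero by blast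
  then have "q = (\<lambda>x. lam \<phi> n * Z n x)"
    by (auto simp: r_def fun_eq_iff)
  then have "ip ?f (Y n j) = lam \<phi> n * ip (Z n) (Y n j)"
    using qY[OF j] by (simp add: ip_cmult_left)
  then show ?thesis
    using Z_reproducing[OF Y_in[OF j]] by (simp add: ip_commute)
qed

end

subsection \<open>Expansion of positive definite zonal kernels\<close>

text \<open>a + b x \<bullet> y is the inner product of (sqrt a, sqrt b x) and (sqrt a, sqrt b y),
  with \<open>None\<close> indexing the extra coordinate. Its m-th power is the inner product of
  m-fold tensor powers, whose coordinates are indexed by words \<open>w\<close> of length m.\<close>

lemma power_kernel_decomposition:
  fixes a b :: real
  assumes "a \<ge> 0" "b \<ge> 0"
  obtains I :: "(nat \<Rightarrow> 'd::finite option) set" and u :: "(nat \<Rightarrow> 'd option) \<Rightarrow> real^'d \<Rightarrow> real"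
  where "finite I" "\<And>w. continuous_on (sphere 0 1) (u w)"
    "\<And>x y. (a + b * (x \<bullet> y)) ^ m = (\<Sum>w\<in>I. u w x * u w y)"
proof -
  define v :: "'d option \<Rightarrow> real^'d \<Rightarrow> real" where
    "v i x = (case i of None \<Rightarrow> sqrt a | Some i \<Rightarrow> sqrt b * x $ i)" for i x
  have v: "a + b * (x \<bullet> y) = (\<Sum>i\<in>UNIV. v i x * v i y)" for x y :: "real^'d"
  proof -
    have "(\<Sum>i\<in>UNIV. v i x * v i y) = v None x * v None y + (\<Sum>i\<in>UNIV. v (Some i) x * v (Some i) y)"
      unfolding UNIV_option_conv by (subst sum.insert) (auto simp: sum.reindex)
    also have "\<dots> = a + (\<Sum>i\<in>UNIV. b * (x $ i * y $ i))"
    proof -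
      have "sqrt b * x $ i * (sqrt b * y $ i) = (sqrt b * sqrt b) * (x $ i * y $ i)" for i
        by (simp only: mult_ac)
      then have sq: "sqrt b * x $ i * (sqrt b * y $ i) = b * (x $ i * y $ i)" for i
        using assms(2) by simp
      show ?thesis
        using assms(1) unfolding v_def option.case sq by simp
    qed
    also have "\<dots> = a + b * (x \<bullet> y)"
      by (simp add: inner_vec_def sum_distrib_left)
    finally show ?thesis by simp
  qed
  have vc: "continuous_on S (v i)" for i and S :: "(real^'d) set"
    unfolding v_def[abs_def] by (cases i) (auto intro!: continuous_intros)
  show thesis
  proof (rule that[of "PiE {..<m} (\<lambda>_. UNIV)" "\<lambda>w x. \<Prod>k<m. v (w k) x"])
    show "finite (PiE {..<m} (\<lambda>_. UNIV :: 'd option set))"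
      by (intro finite_PiE) auto
    show "continuous_on (sphere 0 1) (\<lambda>x. \<Prod>k<m. v (w k) x)" for w
      by (intro continuous_on_prod vc)
    show "(a + b * (x \<bullet> y)) ^ m = (\<Sum>w\<in>PiE {..<m} (\<lambda>_. UNIV). (\<Prod>k<m. v (w k) x) * (\<Prod>k<m. v (w k) y))"
      for x y :: "real^'d"
    proof -
      have "(a + b * (x \<bullet> y)) ^ m = (\<Prod>k<m. \<Sum>i\<in>UNIV. v i x * v i y)"
        by (simp add: v)
      also have "\<dots> = (\<Sum>w\<in>PiE {..<m} (\<lambda>_. UNIV). \<Prod>k<m. v (w k) x * v (w k) y)"
        by (rule prod_sum_PiE) auto
      finally show ?thesis
        by (simp add: prod.distrib)
    qed
  qed
qed

context signed_basis
begin

lemma bessel: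
  assumes f: "continuous_on (sphere 0 1) f"
  shows "(\<Sum>n<N. \<Sum>j=1..hdim TYPE('d) n. (ip f (Y n j))\<^sup>2) \<le> ip f f"
proof -
  let ?I = "SIGMA n:{..<N}. {1..hdim TYPE('d) n}"
  define F where "F = (\<lambda>(n, j). Y n j)"
  define c where "c i = ip f (F i)" for i
  have Fc: "continuous_on (sphere 0 1) (F i)" if "i \<in> ?I" for i
    using that Y_cont by (auto simp: F_def)
  have Fo: "ip (F i) (F j) = (if i = j then 1 else 0)" if "i \<in> ?I" "j \<in> ?I" for i j
    using that Y_orth by (cases i; cases j) (auto simp: F_def)
  define g where "g x = (\<Sum>i\<in>?I. c i * F i x)" for x
  have gc: "continuous_on (sphere 0 1) g"
    unfolding g_def[abs_def] by (intro continuous_intros Fc)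
  have fg: "ip f g = (\<Sum>i\<in>?I. (c i)\<^sup>2)"
    unfolding g_def[abs_def] by (subst ip_sum_right[OF Fc f]) (auto simp: c_def power2_eq_square)
  have Fg: "ip (F i) g = c i" if i: "i \<in> ?I" for i
  proof -
    have "ip (F i) g = (\<Sum>j\<in>?I. c j * ip (F i) (F j))"
      unfolding g_def[abs_def] by (rule ip_sum_right[OF Fc Fc[OF i]])
    also have "\<dots> = (\<Sum>j\<in>?I. if j = i then c i else 0)"
      by (intro sum.cong refl) (use Fo[OF i] in auto)
    finally show ?thesis
      using i by (simp add: sum.delta)
  qed
  have gg: "ip g g = (\<Sum>i\<in>?I. (c i)\<^sup>2)"
  proof -
    have "ip g g = (\<Sum>i\<in>?I. c i * ip (F i) g)"
      by (subst g_def[abs_def], rule ip_sum_left[OF Fc gc])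
    then show ?thesis
      using Fg by (simp add: power2_eq_square)
  qed
  have "0 \<le> ip (\<lambda>x. f x - g x) (\<lambda>x. f x - g x)"
    by (simp add: ip_def)
  also have "\<dots> = ip f f - ip f g - (ip g f - ip g g)"
    using f gc by (simp add: ip_diff_left ip_diff_right continuous_intros)
  finally have "(\<Sum>i\<in>?I. (c i)\<^sup>2) \<le> ip f f"
    by (simp add: fg gg ip_commute[of g f])
  then show ?thesis
    by (simp add: c_def F_def sum.Sigma split_def)
qed

text \<open>The reflection exchanging \<open>y\<close> with the pole shows that the average is the
  same at every point of the sphere. At the pole it is the definition of \<open>lam\<close>.\<close>

lemma kernel_average:
  assumes \<phi>: "continuous_on {-1..1} \<phi>" and y: "y \<in> sphere 0 1"
  shows "ip (\<lambda>x. \<phi> (x \<bullet> y)) (\<lambda>x. K n x y) = lam \<phi> n * hdim TYPE('d) n"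
proof -
  let ?R = "hreflect (north_pole - y)"
  have R: "?R north_pole = y"
    using hreflect_swap[of north_pole y] y by simp
  have "ip (\<lambda>x. \<phi> (x \<bullet> north_pole)) (Z n) = ip (\<lambda>x. \<phi> (?R x \<bullet> y)) (\<lambda>x. K n (?R x) y)"
  proof -
    have "?R x \<bullet> y = x \<bullet> north_pole" for x
      using hreflect_inner[of _ x north_pole] R by metis
    moreover have "K n (?R x) y = Z n x" for x
      using K_hreflect[of n _ x north_pole] R unfolding Z_def by metis
    ultimately show ?thesis
      by simp
  qed
  also have "\<dots> = ip (\<lambda>x. \<phi> (x \<bullet> y)) (\<lambda>x. K n x y)"
  proof (rule ip_orthogonal[OF orthogonal_hreflect])
    show "continuous_on (sphere 0 1) (\<lambda>x. K n x y)"
      using continuous_on_sph_harm K_in by blast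
    show "continuous_on (sphere 0 1) (\<lambda>x. \<phi> (x \<bullet> y))"
    proof (rule continuous_on_compose2[OF \<phi>])
      show "(\<lambda>x. x \<bullet> y) ` sphere 0 1 \<subseteq> {-1..1}"
        using sphere_inner_le[OF _ y] by (force simp: abs_le_iff)
    qed (intro continuous_intros)
  qed
  finally show ?thesis
    using h_pos[of n] by (simp add: lam_def)
qed

text \<open>A trace formula: integrating \<open>kernel_average\<close> over \<open>y\<close> pairs
  each factor \<open>u w\<close> with itself, so the decomposition becomes a sum of squares.\<close>

lemma lam_decomposition:
  assumes \<phi>: "continuous_on {-1..1} \<phi>" and "finite I"
    and u: "\<And>w. continuous_on (sphere 0 1) (u w)"
    and dec: "\<And>x y. x \<in> sphere 0 1 \<Longrightarrow> y \<in> sphere 0 1 \<Longrightarrow> \<phi> (x \<bullet> y) = (\<Sum>w\<in>I. u w x * u w y)"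
  shows "lam \<phi> n * hdim TYPE('d) n = (\<Sum>w\<in>I. \<Sum>j=1..hdim TYPE('d) n. (ip (u w) (Y n j))\<^sup>2)"
proof -
  let ?J = "{1..hdim TYPE('d) n}"
  have A: "ip (\<lambda>x. \<phi> (x \<bullet> y)) (\<lambda>x. K n x y) = (\<Sum>w\<in>I. \<Sum>j\<in>?J. (u w y * Y n j y) * ip (u w) (Y n j))"
    if y: "y \<in> sphere 0 1" for y
  proof -
    have "ip (\<lambda>x. \<phi> (x \<bullet> y)) (\<lambda>x. K n x y) = ip (\<lambda>x. \<Sum>w\<in>I. u w y * u w x) (\<lambda>x. K n x y)"
      by (rule ip_cong) (use dec[OF _ y] in \<open>auto simp: mult.commute\<close>)
    also have "\<dots> = (\<Sum>w\<in>I. u w y * ip (u w) (\<lambda>x. K n x y))"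
      by (rule ip_sum_left) (use u continuous_on_sph_harm K_in in blast)+
    also have "\<dots> = (\<Sum>w\<in>I. u w y * (\<Sum>j\<in>?J. Y n j y * ip (u w) (Y n j)))"
    proof (intro sum.cong refl)
      fix w
      have "ip (u w) (\<lambda>x. K n x y) = ip (u w) (\<lambda>x. \<Sum>j\<in>?J. Y n j y * Y n j x)"
        by (simp add: K_def mult.commute)
      also have "\<dots> = (\<Sum>j\<in>?J. Y n j y * ip (u w) (Y n j))"
        by (rule ip_sum_right) (use Y_cont u in blast)+
      finally show "u w y * ip (u w) (\<lambda>x. K n x y) = u w y * (\<Sum>j\<in>?J. Y n j y * ip (u w) (Y n j))"
        by simp
    qed
    finally show ?thesis
      by (simp add: sum_distrib_left mult.assoc)
  qed
  have int: "integrable sigma_bar (\<lambda>y. u w y * Y n j y * ip (u w) (Y n j))" if "j \<in> ?J" for w j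
    by (intro integrable_continuous_sigma_bar continuous_intros u Y_cont that)
  have "lam \<phi> n * hdim TYPE('d) n = (\<integral>y. lam \<phi> n * hdim TYPE('d) n \<partial>(sigma_bar :: (real^'d::_) measure))"
    by simp
  also have "\<dots> = (\<integral>y. (\<Sum>w\<in>I. \<Sum>j\<in>?J. (u w y * Y n j y) * ip (u w) (Y n j)) \<partial>sigma_bar)"
    by (rule Bochner_Integration.integral_cong[OF refl])
       (simp only: space_sigma_bar A[symmetric] kernel_average[OF \<phi>])
  also have "\<dots> = (\<Sum>w\<in>I. \<Sum>j\<in>?J. \<integral>y. (u w y * Y n j y) * ip (u w) (Y n j) \<partial>sigma_bar)"
    using int by (subst Bochner_Integration.integral_sum, force)
      (intro sum.cong refl Bochner_Integration.integral_sum, blast)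
  also have "\<dots> = (\<Sum>w\<in>I. \<Sum>j\<in>?J. (ip (u w) (Y n j))\<^sup>2)"
    by (simp add: ip_def power2_eq_square)
  finally show ?thesis .
qed

text \<open>The factor h_n belongs in the sum because the n-th term
  \<open>lam \<phi> n * Z n x\<close> of the zonal expansion is bounded by exactly this
  product.\<close>

lemma power_kernel_lam:
  fixes a b :: real and m :: nat
  assumes "a \<ge> 0" "b \<ge> 0"
  defines "\<phi> \<equiv> \<lambda>t. (a + b * t) ^ m"
  shows "lam \<phi> n \<ge> 0" "summable (\<lambda>n. lam \<phi> n * hdim TYPE('d) n)"
proof -
  obtain I :: "(nat \<Rightarrow> 'd option) set" and u :: "(nat \<Rightarrow> 'd option) \<Rightarrow> real^'d::_ \<Rightarrow> real"
    where u: "finite I" "\<And>w. continuous_on (sphere 0 1) (u w)"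
      "\<And>x y. (a + b * (x \<bullet> y)) ^ m = (\<Sum>w\<in>I. u w x * u w y)"
    using power_kernel_decomposition[OF assms(1,2), of m, where 'd = 'd] by blast
  have \<phi>c: "continuous_on {-1..1} \<phi>"
    unfolding \<phi>_def by (intro continuous_intros)
  have dec: "lam \<phi> n * hdim TYPE('d) n = (\<Sum>w\<in>I. \<Sum>j=1..hdim TYPE('d) n. (ip (u w) (Y n j))\<^sup>2)" for n
    by (rule lam_decomposition[OF \<phi>c u(1,2)]) (simp add: \<phi>_def u(3))
  have nonneg: "lam \<phi> n * hdim TYPE('d) n \<ge> 0" for n
    unfolding dec by (intro sum_nonneg) auto
  then show "lam \<phi> n \<ge> 0"
    using h_pos[of n] nonneg[of n] by (auto simp: zero_le_mult_iff)
  show "summable (\<lambda>n. lam \<phi> n * hdim TYPE('d) n)"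
  proof (rule summableI_nonneg_bounded)
    fix N
    have "(\<Sum>n<N. lam \<phi> n * hdim TYPE('d) n) = (\<Sum>w\<in>I. \<Sum>n<N. \<Sum>j=1..hdim TYPE('d) n. (ip (u w) (Y n j))\<^sup>2)"
      unfolding dec by (rule sum.swap)
    also have "\<dots> \<le> (\<Sum>w\<in>I. ip (u w) (u w))"
      by (intro sum_mono bessel u(2))
    finally show "(\<Sum>n<N. lam \<phi> n * hdim TYPE('d) n) \<le> (\<Sum>w\<in>I. ip (u w) (u w))" .
  qed (rule nonneg)
qed

section \<open>Absolutely convergent zonal series\<close>

definition zseries :: "(nat \<Rightarrow> real) \<Rightarrow> real^'d::_ \<Rightarrow> real" where
  "zseries a x = (\<Sum>n. a n * (Z n x / hdim TYPE('d) n))"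

lemma h_nonzero: "hdim TYPE('d) n \<noteq> 0"
  using h_pos[of n] by simp

lemma Z_normalized_le: "x \<in> sphere 0 1 \<Longrightarrow> \<bar>Z n x / hdim TYPE('d) n\<bar> \<le> 1"
  using Z_abs_le[of x n] h_pos[of n] by (simp add: abs_divide divide_le_eq)

lemma zseries_term_le: "x \<in> sphere 0 1 \<Longrightarrow> \<bar>a n * (Z n x / hdim TYPE('d) n)\<bar> \<le> \<bar>a n\<bar>"
  unfolding abs_mult by (intro mult_left_le Z_normalized_le) auto

lemma zseries_cont:
  assumes "summable (\<lambda>n. \<bar>a n\<bar>)"
  shows "continuous_on (sphere 0 1) (zseries a)"
proof -
  have "uniform_limit (sphere 0 1) (\<lambda>n x. \<Sum>i<n. a i * (Z i x / hdim TYPE('d) i)) (zseries a) sequentially"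
    unfolding zseries_def[abs_def]
    by (rule Weierstrass_m_test[OF _ assms]) (use zseries_term_le in auto)
  then show ?thesis
    by (rule uniform_limit_theorem[rotated])
       (auto intro!: always_eventually continuous_intros Z_cont simp: h_nonzero)
qed

lemma zseries_abs_le:
  assumes "summable (\<lambda>n. \<bar>a n\<bar>)" "x \<in> sphere 0 1"
  shows "\<bar>zseries a x\<bar> \<le> (\<Sum>n. \<bar>a n\<bar>)"
proof -
  have s: "summable (\<lambda>n. \<bar>a n * (Z n x / hdim TYPE('d) n)\<bar>)"
    by (rule summable_comparison_test'[OF assms(1), of 0]) (use zseries_term_le[OF assms(2)] in auto)
  have "\<bar>zseries a x\<bar> \<le> (\<Sum>n. \<bar>a n * (Z n x / hdim TYPE('d) n)\<bar>)"
    unfolding zseries_def by (rule summable_rabs[OF s])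
  also have "\<dots> \<le> (\<Sum>n. \<bar>a n\<bar>)"
    by (rule suminf_le[OF _ s assms(1)]) (rule zseries_term_le[OF assms(2)])
  finally show ?thesis .
qed

lemma zseries_ip:
  assumes a: "summable (\<lambda>n. \<bar>a n\<bar>)" and f: "continuous_on (sphere 0 1) f"
  shows "(\<lambda>n. a n / hdim TYPE('d) n * ip (Z n) f) sums ip (zseries a) f"
proof -
  obtain B where B: "B \<ge> 0" "\<And>x. x \<in> sphere 0 1 \<Longrightarrow> \<bar>f x\<bar> \<le> B"
    using bounded_on_sphere[OF f] by blast
  let ?g = "\<lambda>n x. a n * (Z n x / hdim TYPE('d) n) * f x"
  have gc: "continuous_on (sphere 0 1) (?g n)" for n
    using h_pos[of n] by (intro continuous_intros Z_cont f) auto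
  have le: "\<bar>?g n x\<bar> \<le> \<bar>a n\<bar> * B" if "x \<in> sphere 0 1" for n x
    unfolding abs_mult[of "a n * (Z n x / hdim TYPE('d) n)"]
    by (intro mult_mono zseries_term_le B that) auto
  have sB: "summable (\<lambda>n. \<bar>a n\<bar> * B)"
    by (rule summable_mult2[OF a])
  have "(\<lambda>n. \<integral>x. ?g n x \<partial>sigma_bar) sums (\<integral>x. (\<Sum>n. ?g n x) \<partial>sigma_bar)"
  proof (rule sums_integral)
    show "integrable sigma_bar (?g n)" for n
      by (rule integrable_continuous_sigma_bar[OF gc])
    show "AE x in sigma_bar. summable (\<lambda>n. norm (?g n x))"
      by (rule AE_I2, rule summable_comparison_test'[OF sB, of 0]) (use le in auto)
    show "summable (\<lambda>n. \<integral>x. norm (?g n x) \<partial>sigma_bar)"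
    proof (rule summable_comparison_test'[OF sB, of 0])
      fix n
      show "norm (\<integral>x. norm (?g n x) \<partial>sigma_bar) \<le> \<bar>a n\<bar> * B"
        unfolding real_norm_def
      proof (rule abs_integral_sigma_bar_le)
        show "(\<lambda>x. \<bar>?g n x\<bar>) \<in> borel_measurable sigma_bar"
          by (intro measurable_continuous_sigma_bar continuous_on_rabs gc)
        show "\<bar>\<bar>?g n x\<bar>\<bar> \<le> \<bar>a n\<bar> * B" if "x \<in> sphere 0 1" for x
          using le[OF that, of n] by (simp only: abs_idempotent)
      qed
    qed
  qed
  moreover have "(\<integral>x. ?g n x \<partial>sigma_bar) = a n / hdim TYPE('d) n * ip (Z n) f" for n
  proof -
    have "(\<integral>x. ?g n x \<partial>sigma_bar) = ip (\<lambda>x. a n / hdim TYPE('d) n * Z n x) f"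
      by (simp add: ip_def)
    then show ?thesis
      by (simp only: ip_cmult_left)
  qed
  moreover have "(\<integral>x. (\<Sum>n. ?g n x) \<partial>sigma_bar) = ip (zseries a) f"
    unfolding ip_def
  proof (rule Bochner_Integration.integral_cong[OF refl])
    fix x :: "real^'d::_"
    assume "x \<in> space sigma_bar"
    then have x: "x \<in> sphere 0 1" by simp
    have "summable (\<lambda>n. a n * (Z n x / hdim TYPE('d) n))"
      by (rule summable_comparison_test'[OF a, of 0]) (use zseries_term_le[OF x] in auto)
    then show "(\<Sum>n. ?g n x) = zseries a x * f x"
      unfolding zseries_def by (rule suminf_mult2[symmetric])
  qed
  ultimately show ?thesis
    by (simp only:)
qed

text \<open>The kernel and the candidate series are continuous with equal coefficients, by
  \<open>funk_hecke\<close> on one side and termwise integration on the other. Completeness makes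
  them equal at every point of the sphere, so pairing with \<open>f\<close> may be done term by
  term.\<close>

lemma power_kernel_parseval:
  fixes a b :: real and m :: nat
  assumes "a \<ge> 0" "b \<ge> 0" and f: "continuous_on (sphere 0 1) f"
  defines "\<phi> \<equiv> \<lambda>t. (a + b * t) ^ m"
  shows "(\<lambda>n. lam \<phi> n * ip (Z n) f) sums ip (\<lambda>x. \<phi> (x \<bullet> north_pole)) f"
proof -
  have \<phi>c: "continuous_on {-1..1} \<phi>"
    unfolding \<phi>_def by (intro continuous_intros)
  let ?F = "\<lambda>x. \<phi> (x \<bullet> north_pole)"
  have Fc: "continuous_on (sphere 0 1) ?F"
    by (rule continuous_on_zonal_function[OF \<phi>c])
  define c where "c n = lam \<phi> n * hdim TYPE('d) n" for n
  have cs: "summable (\<lambda>n. \<bar>c n\<bar>)"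
    using power_kernel_lam[OF assms(1,2), of m] unfolding c_def \<phi>_def by simp
  have chd: "c n / hdim TYPE('d) n = lam \<phi> n" for n
    using h_pos[of n] by (simp add: c_def)
  have eq: "?F x = zseries c x" if x: "x \<in> sphere 0 1" for x
  proof -
    have "?F x - zseries c x = 0"
    \<comment> \<open>Completeness yields vanishing almost everywhere; continuity of both sides
      makes it pointwise.\<close>
    proof (rule Y_complete[where f = "\<lambda>x. ?F x - zseries c x", OF _ _ x])
      show "continuous_on (sphere 0 1) (\<lambda>x. ?F x - zseries c x)"
        by (intro continuous_intros Fc zseries_cont cs)
      fix n j assume j: "j \<in> {1..hdim TYPE('d) n}"
      have "(\<lambda>m. lam \<phi> m * ip (Z m) (Y n j)) sums ip (zseries c) (Y n j)"
        using zseries_ip[OF cs Y_cont[OF j]] by (simp add: chd)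
      moreover have "(\<lambda>m. lam \<phi> m * ip (Z m) (Y n j)) = (\<lambda>m. if m = n then lam \<phi> n * Y n j north_pole else 0)"
        using Z_reproducing[OF Y_in[OF j]] sph_harm_orthogonal_degrees[OF Z_in Y_in[OF j]]
        by (auto simp: fun_eq_iff ip_commute)
      moreover have "(\<lambda>m. if m = n then lam \<phi> n * Y n j north_pole else 0) sums (lam \<phi> n * Y n j north_pole)"
        using sums_single[of n "\<lambda>_. lam \<phi> n * Y n j north_pole"] by simp
      ultimately have "ip (zseries c) (Y n j) = lam \<phi> n * Y n j north_pole"
        using sums_unique2 by auto
      then show "ip (\<lambda>x. ?F x - zseries c x) (Y n j) = 0"
        unfolding ip_diff_left[OF Fc zseries_cont[OF cs] Y_cont[OF j]] using funk_hecke[OF \<phi>c j] by simp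
    qed
    then show ?thesis by simp
  qed
  have "ip ?F f = ip (zseries c) f"
    by (rule ip_cong) (use eq in auto)
  then show ?thesis
    using zseries_ip[OF cs f] by (simp add: chd)
qed

text \<open>The case a = 0, b = 1 of \<open>power_kernel_parseval\<close> settles powers of the
  height, and polynomials are uniformly dense in the continuous functions on [-1, 1].\<close>

lemma zonal_pairing_eq:
  assumes f: "continuous_on (sphere 0 1) f" and g: "continuous_on (sphere 0 1) g"
    and fg: "\<And>n. ip (Z n) f = ip (Z n) g" and \<phi>: "continuous_on {-1..1} \<phi>"
  shows "ip (\<lambda>x. \<phi> (x \<bullet> north_pole)) f = ip (\<lambda>x. \<phi> (x \<bullet> north_pole)) g"
proof -
  define D where "D x = f x - g x" for x
  have Dc: "continuous_on (sphere 0 1) D"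
    unfolding D_def[abs_def] by (intro continuous_intros f g)
  obtain B where B: "B \<ge> 0" "\<And>x. x \<in> sphere 0 1 \<Longrightarrow> \<bar>D x\<bar> \<le> B"
    using bounded_on_sphere[OF Dc] by blast
  let ?F = "\<lambda>\<phi> x. \<phi> (x \<bullet> north_pole)"
  have Fc: "continuous_on (sphere 0 1) (?F \<psi>)" if "continuous_on {-1..1} \<psi>" for \<psi> :: "real \<Rightarrow> real"
    by (rule continuous_on_zonal_function[OF that])
  have pow: "ip (\<lambda>x :: real^'d::_. (x \<bullet> north_pole) ^ m) D = 0" for m
  proof -
    have "ip (\<lambda>x :: real^'d::_. (x \<bullet> north_pole) ^ m) f = ip (\<lambda>x. (x \<bullet> north_pole) ^ m) g"
      using power_kernel_parseval[of 0 1 f m] power_kernel_parseval[of 0 1 g m] f g fg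
      by (auto intro: sums_unique2)
    then show ?thesis
      unfolding D_def[abs_def] using f g by (simp add: ip_diff_right continuous_intros)
  qed
  have "\<bar>ip (?F \<phi>) D\<bar> \<le> e" if "e > 0" for e
  proof -
    \<comment> \<open>Adding 1 keeps the quotient meaningful when \<open>B\<close> is 0.\<close>
    define e' where "e' = e / (B + 1)"
    have e': "e' > 0" "e' * B \<le> e"
      using B(1) that by (auto simp: e'_def field_simps)
    obtain p where p: "real_polynomial_function p" "\<And>t. t \<in> {-1..1} \<Longrightarrow> \<bar>\<phi> t - p t\<bar> < e'"
      using Stone_Weierstrass_real_polynomial_function[OF compact_Icc \<phi> e'(1)] by blast
    obtain a n where pa: "p = (\<lambda>x. \<Sum>i\<le>n. a i * x ^ i)"
      using p(1) unfolding real_polynomial_function_iff_sum by blast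
    have pc: "continuous_on {-1..1} p"
      unfolding pa by (intro continuous_intros)
    have "ip (?F p) D = (\<Sum>i\<le>n. a i * ip (\<lambda>x. (x \<bullet> north_pole) ^ i) D)"
      unfolding pa by (rule ip_sum_left) (intro continuous_intros Dc)+
    then have "ip (?F \<phi>) D = ip (\<lambda>x. \<phi> (x \<bullet> north_pole) - p (x \<bullet> north_pole)) D"
      by (subst ip_diff_left[OF Fc[OF \<phi>] Fc[OF pc] Dc]) (simp add: pow)
    also have "\<bar>\<dots>\<bar> \<le> e' * B"
    proof (rule ip_abs_le)
      show "\<bar>\<phi> (x \<bullet> north_pole) - p (x \<bullet> north_pole)\<bar> \<le> e'" if "x \<in> sphere 0 1" for x :: "real^'d::_"
        using p(2)[of "x \<bullet> north_pole"] sphere_inner_le[OF that north_pole_in_sphere]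
        by (auto simp: abs_le_iff)
    qed (use B e' Dc Fc[OF \<phi>] Fc[OF pc] in \<open>auto intro!: continuous_intros\<close>)
    finally show ?thesis
      using e'(2) by simp
  qed
  then have "ip (?F \<phi>) D = 0"
    using field_le_epsilon[of "\<bar>ip (?F \<phi>) D\<bar>" 0] by simp
  then show ?thesis
    unfolding D_def[abs_def] ip_diff_right[OF f g Fc[OF \<phi>]] by simp
qed

end

subsection \<open>The uncertainty inequality for caps\<close>

text \<open>Where the height exceeds 1 - \<delta>/2 the base of the power exceeds 1 - \<delta>/4;
  where it is at most 1 - \<delta> the base is at most 1 - \<delta>/2. After division by the total
  mass, the part away from the pole decays like q^m with q < 1.\<close>

lemma pole_kernel_approximate_identity:
  fixes F :: "real^'d::{finite,wellorder} \<Rightarrow> real"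
  assumes F: "continuous_on (sphere 0 1) F"
  defines "\<phi> \<equiv> \<lambda>m (x :: real^'d::_). (1/2 + 1/2 * (x \<bullet> north_pole)) ^ m"
  shows "ip (\<phi> m) (\<lambda>x. 1) > 0"
    and "(\<lambda>m. ip (\<phi> m) F / ip (\<phi> m) (\<lambda>x. 1)) \<longlonglongrightarrow> F north_pole"
proof -
  have \<phi>c: "continuous_on (sphere 0 1) (\<phi> m)" for m
    unfolding \<phi>_def by (intro continuous_intros)
  have base: "0 \<le> 1/2 + 1/2 * (x \<bullet> north_pole)" if "x \<in> sphere 0 1" for x :: "real^'d::_"
    using sphere_inner_le[OF that north_pole_in_sphere] by (auto simp: abs_le_iff)
  have \<phi>0: "\<phi> m x \<ge> 0" if "x \<in> sphere 0 1" for m x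
    unfolding \<phi>_def using base[OF that] by simp
  have lower: "ip (\<phi> m) (\<lambda>x. 1) \<ge> (1 - \<delta>/4) ^ m * measure sigma_bar ({x. x \<bullet> north_pole > 1 - \<delta>/2} \<inter> sphere (0 :: real^'d::_) 1)"
    if \<delta>: "0 < \<delta>" "\<delta> \<le> 1" for m \<delta>
  proof -
    let ?A = "{x. x \<bullet> north_pole > 1 - \<delta>/2} \<inter> sphere (0 :: real^'d::_) 1"
    have A: "?A \<in> sets sigma_bar"
      unfolding in_sets_sigma_bar
      by (auto intro!: borel_open open_Collect_less sets.Int continuous_intros)
    have "(1 - \<delta>/4) ^ m * measure sigma_bar ?A = (\<integral>x. (1 - \<delta>/4) ^ m * indicator ?A x \<partial>sigma_bar)"
      using A by simp
    also have "\<dots> \<le> (\<integral>x. \<phi> m x \<partial>sigma_bar)"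
    proof (rule integral_mono)
      show "integrable sigma_bar (\<lambda>x. (1 - \<delta>/4) ^ m * indicator ?A x :: real)"
      proof (rule integrable_sigma_bar_bounded)
        show "(\<lambda>x. (1 - \<delta>/4) ^ m * indicator ?A x :: real) \<in> borel_measurable sigma_bar"
          by (intro borel_measurable_times borel_measurable_const borel_measurable_indicator A)
        show "\<bar>(1 - \<delta>/4) ^ m * indicator ?A x :: real\<bar> \<le> \<bar>(1 - \<delta>/4) ^ m\<bar>" for x
          by (auto simp: indicator_def)
      qed
      show "integrable sigma_bar (\<phi> m)"
        by (rule integrable_continuous_sigma_bar[OF \<phi>c])
      fix x :: "real^'d::_" assume "x \<in> space sigma_bar"
      then have x: "x \<in> sphere 0 1" by simp
      show "(1 - \<delta>/4) ^ m * indicator ?A x \<le> \<phi> m x"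
      proof (cases "x \<in> ?A")
        case True
        then have "(1 - \<delta>/4) ^ m \<le> \<phi> m x"
          unfolding \<phi>_def using \<delta> by (intro power_mono) auto
        with True show ?thesis by simp
      next
        case False
        then show ?thesis using \<phi>0[OF x] by simp
      qed
    qed
    finally show ?thesis
      by (simp add: ip_def)
  qed
  have \<mu>pos: "measure sigma_bar ({x. x \<bullet> north_pole > 1 - \<delta>/2} \<inter> sphere (0 :: real^'d::_) 1) > 0"
    if "0 < \<delta>" for \<delta>
    by (rule sigma_bar_open_pos[where x = north_pole])
       (use that in \<open>auto intro!: open_Collect_less continuous_intros simp: dot_square_norm\<close>)
  show Ipos: "ip (\<phi> m) (\<lambda>x. 1) > 0" for m
  proof -
    have "0 < (1 - 1/4) ^ m * measure sigma_bar ({x. x \<bullet> north_pole > 1 - 1/2} \<inter> sphere (0 :: real^'d::_) 1)"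
      using \<mu>pos[of 1] by simp
    also have "\<dots> \<le> ip (\<phi> m) (\<lambda>x. 1)"
      using lower[of 1 m] by simp
    finally show ?thesis .
  qed
  show "(\<lambda>m. ip (\<phi> m) F / ip (\<phi> m) (\<lambda>x. 1)) \<longlonglongrightarrow> F north_pole"
  proof (rule tendstoI)
    fix e :: real assume e: "e > 0"
    obtain d where d: "d > 0" "\<And>x. x \<in> sphere 0 1 \<Longrightarrow> dist x north_pole < d \<Longrightarrow> dist (F x) (F north_pole) < e/2"
      using F e unfolding continuous_on_iff by (metis half_gt_zero north_pole_in_sphere)
    \<comment> \<open>On the sphere the squared distance to the pole is 2 minus twice the height,
      hence below 2 \<delta> \<le> d^2 at heights above 1 - \<delta>.\<close>
    define \<delta> where "\<delta> = min 1 (d\<^sup>2/2)"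
    have \<delta>: "0 < \<delta>" "\<delta> \<le> 1" "2 * \<delta> \<le> d\<^sup>2"
      using d(1) by (auto simp: \<delta>_def)
    have Dc: "continuous_on (sphere 0 1) (\<lambda>x. F x - F north_pole)"
      by (intro continuous_intros F)
    obtain B where B: "B \<ge> 0" "\<And>x. x \<in> sphere 0 1 \<Longrightarrow> \<bar>F x - F north_pole\<bar> \<le> B"
      using bounded_on_sphere[OF Dc] by blast
    define \<mu> where "\<mu> = measure sigma_bar ({x. x \<bullet> north_pole > 1 - \<delta>/2} \<inter> sphere (0 :: real^'d::_) 1)"
    have \<mu>: "\<mu> > 0"
      unfolding \<mu>_def by (rule \<mu>pos[OF \<delta>(1)])
    define q where "q = (1 - \<delta>/2) / (1 - \<delta>/4)"
    have q: "0 \<le> q" "q < 1"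
      using \<delta> by (auto simp: q_def field_simps)
    have near: "\<bar>F x - F north_pole\<bar> \<le> e/2" if x: "x \<in> sphere 0 1" "x \<bullet> north_pole > 1 - \<delta>" for x
    proof -
      have "x \<bullet> x = 1" "(north_pole :: real^'d::_) \<bullet> north_pole = 1"
        using x(1) by (simp_all add: dot_square_norm)
      then have "(dist x north_pole)\<^sup>2 = 2 - 2 * (x \<bullet> north_pole)"
        unfolding dist_norm power2_norm_eq_inner
        by (simp add: inner_diff_left inner_diff_right inner_commute[of north_pole x])
      also have "\<dots> < d\<^sup>2"
        using x(2) \<delta>(3) by simp
      finally have "dist x north_pole < d"
        using d(1) by (simp add: power_less_imp_less_base)
      then show ?thesis
        using d(2)[OF x(1)] by (simp add: dist_real_def)
    qed
    have bound: "\<bar>ip (\<phi> m) F / ip (\<phi> m) (\<lambda>x. 1) - F north_pole\<bar> \<le> e/2 + B / \<mu> * q ^ m" for m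
    proof -
      let ?I = "ip (\<phi> m) (\<lambda>x. 1)"
      have pw: "\<bar>\<phi> m x * (F x - F north_pole)\<bar> \<le> e/2 * \<phi> m x + B * (1 - \<delta>/2) ^ m"
        if x: "x \<in> sphere 0 1" for x
      proof (cases "x \<bullet> north_pole > 1 - \<delta>")
        case True
        have "\<bar>\<phi> m x * (F x - F north_pole)\<bar> \<le> \<phi> m x * (e/2)"
          using mult_left_mono[OF near[OF x True] \<phi>0[OF x, of m]] \<phi>0[OF x, of m]
          by (simp only: abs_mult abs_of_nonneg)
        moreover have "B * (1 - \<delta>/2) ^ m \<ge> 0"
          using B(1) \<delta> by simp
        ultimately show ?thesis
          by (simp add: mult.commute)
      next
        case False
        then have "\<phi> m x \<le> (1 - \<delta>/2) ^ m"
          unfolding \<phi>_def using base[OF x] by (intro power_mono) auto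
        then have "\<bar>\<phi> m x * (F x - F north_pole)\<bar> \<le> (1 - \<delta>/2) ^ m * B"
          unfolding abs_mult using B(2)[OF x] \<phi>0[OF x] \<delta> by (intro mult_mono) auto
        moreover have "e/2 * \<phi> m x \<ge> 0"
          using e \<phi>0[OF x] by simp
        ultimately show ?thesis
          by (simp add: mult.commute)
      qed
      have "ip (\<phi> m) (\<lambda>x. F x - F north_pole) = ip (\<phi> m) F - F north_pole * ?I"
        by (subst ip_diff_right) (auto intro!: F \<phi>c continuous_intros simp: ip_def)
      moreover have "\<bar>ip (\<phi> m) (\<lambda>x. F x - F north_pole)\<bar> \<le> e/2 * ?I + B * (1 - \<delta>/2) ^ m"
      proof -
        have "\<bar>ip (\<phi> m) (\<lambda>x. F x - F north_pole)\<bar> \<le> (\<integral>x. \<bar>\<phi> m x * (F x - F north_pole)\<bar> \<partial>sigma_bar)"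
          unfolding ip_def by (rule integral_abs_bound)
        also have "\<dots> \<le> (\<integral>x. e/2 * \<phi> m x + B * (1 - \<delta>/2) ^ m \<partial>sigma_bar)"
          by (rule integral_mono)
             (use pw in \<open>auto intro!: integrable_continuous_sigma_bar continuous_on_rabs continuous_intros \<phi>c F
                simp del: Bochner_Integration.integrable_mult_right_iff\<close>)
        also have "\<dots> = e/2 * ?I + B * (1 - \<delta>/2) ^ m"
        proof -
          have "(\<integral>x. e/2 * \<phi> m x + B * (1 - \<delta>/2) ^ m \<partial>sigma_bar)
              = (\<integral>x. e/2 * \<phi> m x \<partial>sigma_bar) + (\<integral>x. B * (1 - \<delta>/2) ^ m \<partial>(sigma_bar :: (real^'d::_) measure))"
            by (rule Bochner_Integration.integral_add)
               (intro integrable_continuous_sigma_bar continuous_intros \<phi>c)+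
          then show ?thesis
            by (simp add: ip_def)
        qed
        finally show ?thesis .
      qed
      ultimately have 1: "\<bar>ip (\<phi> m) F - F north_pole * ?I\<bar> \<le> e/2 * ?I + B * (1 - \<delta>/2) ^ m"
        by simp
      have "B * (1 - \<delta>/2) ^ m = B / \<mu> * q ^ m * ((1 - \<delta>/4) ^ m * \<mu>)"
        using \<mu> \<delta> by (simp add: q_def power_divide)
      also have "\<dots> \<le> B / \<mu> * q ^ m * ?I"
        using lower[OF \<delta>(1,2), of m] B(1) \<mu> q(1) by (intro mult_left_mono) (auto simp: \<mu>_def)
      finally have 2: "\<bar>ip (\<phi> m) F - F north_pole * ?I\<bar> \<le> (e/2 + B / \<mu> * q ^ m) * ?I"
        using 1 by (simp add: distrib_right)
      have "\<bar>ip (\<phi> m) F / ?I - F north_pole\<bar> = \<bar>ip (\<phi> m) F - F north_pole * ?I\<bar> / ?I"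
        using Ipos[of m] by (simp add: field_simps abs_divide[symmetric] flip: abs_of_pos)
      also have "\<dots> \<le> e/2 + B / \<mu> * q ^ m"
        using 2 Ipos[of m] by (simp add: divide_le_eq)
      finally show ?thesis .
    qed
    have "(\<lambda>m. B / \<mu> * q ^ m) \<longlonglongrightarrow> B / \<mu> * 0"
      using q by (intro tendsto_intros LIMSEQ_power_zero) auto
    then have "\<forall>\<^sub>F m in sequentially. B / \<mu> * q ^ m < e/2"
      using e by (intro order_tendstoD) auto
    then show "\<forall>\<^sub>F m in sequentially. dist (ip (\<phi> m) F / ip (\<phi> m) (\<lambda>x. 1)) (F north_pole) < e"
    proof eventually_elim
      case (elim m)
      then show ?case
        using bound[of m] unfolding dist_real_def by linarith
    qed
  qed
qed

section \<open>Analytic continuation along great circles\<close>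

lemma hom_poly_circle_holomorphic:
  fixes u v :: "real^'d::finite"
  assumes "hom_poly n p"
  shows "\<exists>H :: complex \<Rightarrow> complex. H holomorphic_on UNIV \<and>
    (\<forall>t. H (of_real t) = of_real (p (cos t *\<^sub>R u + sin t *\<^sub>R v)))"
proof -
  obtain c where c: "\<And>x. p x = (\<Sum>\<alpha>\<in>{\<alpha>. sum \<alpha> UNIV = n}. c \<alpha> * (\<Prod>j\<in>UNIV. (x $ j) ^ \<alpha> j))"
    using assms unfolding hom_poly_def by blast
  show ?thesis
  proof (intro exI[of _ "\<lambda>z. \<Sum>\<alpha>\<in>{\<alpha>. sum \<alpha> UNIV = n}. of_real (c \<alpha>) *
      (\<Prod>j\<in>UNIV. (cos z * of_real (u $ j) + sin z * of_real (v $ j)) ^ \<alpha> j)"] conjI)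
    show "(\<lambda>z. \<Sum>\<alpha>\<in>{\<alpha>. sum \<alpha> UNIV = n}. of_real (c \<alpha>) *
      (\<Prod>j\<in>UNIV. (cos z * of_real (u $ j) + sin z * of_real (v $ j)) ^ \<alpha> j)) holomorphic_on UNIV"
      by (intro holomorphic_intros)
  qed (simp add: c cos_of_real sin_of_real)
qed

text \<open>Join \<open>x\<close> to the south pole by a great circle. Along it a polynomial is the
  restriction of an entire function of the angle, and \<open>c > -1\<close> makes this function
  vanish on an interval next to the south pole, hence everywhere by the identity theorem.\<close>

lemma sphere_polynomial_vanishes:
  fixes p :: "nat \<Rightarrow> real^'d::{finite,wellorder} \<Rightarrow> real"
  assumes card: "CARD('d) \<ge> 2" and p: "\<And>n. hom_poly n (p n)" and c: "c > -1"
    and zero: "\<And>x. x \<in> sphere 0 1 \<Longrightarrow> x \<bullet> north_pole < c \<Longrightarrow> (\<Sum>n<N. p n x) = 0"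
    and x: "x \<in> sphere 0 1"
  shows "(\<Sum>n<N. p n x) = 0"
proof -
  define y where "y = x - (x \<bullet> north_pole) *\<^sub>R north_pole"
  have pole: "(north_pole :: real^'d::_) \<bullet> north_pole = 1"
    by (simp add: dot_square_norm)
  have xx: "x \<bullet> x = 1"
    using x by (simp add: dot_square_norm)
  have y: "y \<bullet> north_pole = 0" "(norm y)\<^sup>2 = 1 - (x \<bullet> north_pole)\<^sup>2"
    unfolding power2_norm_eq_inner
    by (simp_all add: y_def inner_diff pole xx inner_commute power2_eq_square)
  obtain v where v: "norm v = 1" "v \<bullet> north_pole = 0" "y = norm y *\<^sub>R v"
  proof (cases "y = 0")
    case True
    obtain a :: 'd where "a \<noteq> Max UNIV"
      using index_ne_exists[OF card] by blast
    then have "(axis a 1 :: real^'d::_) $ Max UNIV = 0"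
      by (simp add: axis_def)
    then show thesis
      using True by (intro that[of "axis a 1"]) (auto simp: inner_north_pole norm_axis_1)
  next
    case False
    then show thesis
      using y(1) by (intro that[of "y /\<^sub>R norm y"]) auto
  qed
  define P where "P z = (\<Sum>n<N. p n z)" for z
  define \<gamma> where "\<gamma> t = cos t *\<^sub>R (- north_pole) + sin t *\<^sub>R v" for t :: real
  have \<gamma>s: "\<gamma> t \<in> sphere 0 1" for t
  proof -
    have "v \<bullet> v = 1" "north_pole \<bullet> v = 0"
      using v(1,2) by (simp_all add: dot_square_norm inner_commute[of north_pole v])
    then have "(norm (\<gamma> t))\<^sup>2 = (cos t)\<^sup>2 + (sin t)\<^sup>2"
      unfolding power2_norm_eq_inner \<gamma>_def
      using v(2) by (simp add: inner_add_left inner_add_right inner_diff_left inner_diff_right pole flip: power2_eq_square)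
    then have "norm (\<gamma> t) = 1"
      using norm_ge_zero[of "\<gamma> t"] by (simp add: power2_eq_1_iff)
    then show ?thesis by simp
  qed
  have \<gamma>p: "\<gamma> t \<bullet> north_pole = - cos t" for t
    using v(2) by (simp add: \<gamma>_def inner_add_left inner_diff_left pole)
  have "\<forall>n. \<exists>H :: complex \<Rightarrow> complex. H holomorphic_on UNIV \<and> (\<forall>t. H (of_real t) = of_real (p n (\<gamma> t)))"
    unfolding \<gamma>_def by (intro allI hom_poly_circle_holomorphic) (rule p)
  then obtain H :: "nat \<Rightarrow> complex \<Rightarrow> complex" where
    "\<forall>n. H n holomorphic_on UNIV \<and> (\<forall>t. H n (of_real t) = of_real (p n (\<gamma> t)))"
    by (rule exE[OF choice])
  then have H: "H n holomorphic_on UNIV" "H n (of_real t) = of_real (p n (\<gamma> t))" for n t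
    by simp_all
  define G where "G z = (\<Sum>n<N. H n z)" for z
  have Gh: "G holomorphic_on UNIV"
    unfolding G_def[abs_def] by (intro holomorphic_intros H)
  have G: "G (of_real t) = of_real (P (\<gamma> t))" for t
    by (simp add: G_def P_def H)
  have "isCont cos (0::real)"
    by simp
  then have "\<forall>\<^sub>F t in at 0. cos t > - c"
    using c by (intro order_tendstoD(1)[of cos 1]) (auto simp: isCont_def)
  then obtain d where d: "d > 0" "\<And>t :: real. t \<noteq> 0 \<Longrightarrow> \<bar>t\<bar> < d \<Longrightarrow> cos t > - c"
    unfolding eventually_at by (auto simp: dist_real_def)
  define U where "U = (of_real :: real \<Rightarrow> complex) ` {0<..<d}"
  have lim: "0 islimpt U"
    unfolding islimpt_approachable
  proof (intro allI impI)
    fix e :: real assume "e > 0"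
    define r where "r = min d e / 2"
    have r: "0 < r" "r < d" "r < e"
      using d(1) \<open>e > 0\<close> by (auto simp: r_def)
    then have "of_real r \<in> U"
      by (auto simp: U_def)
    with r show "\<exists>x'\<in>U. x' \<noteq> 0 \<and> dist x' 0 < e"
      by (intro bexI[of _ "of_real r"]) auto
  qed
  have G0: "G z = 0" for z
  proof (rule analytic_continuation[OF Gh open_UNIV _ _ _ lim])
    fix z assume "z \<in> U"
    then obtain t where "z = of_real t" "0 < t" "t < d"
      by (auto simp: U_def)
    then show "G z = 0"
      using d(2)[of t] zero[OF \<gamma>s, of t] by (simp add: G \<gamma>p P_def)
  qed auto
  \<comment> \<open>Taking the angle in [0, pi] makes its sine nonnegative, so it equals
    \<open>norm y\<close> and the curve passes through \<open>x\<close> rather than its mirror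
    image.\<close>
  define t where "t = arccos (- (x \<bullet> north_pole))"
  have le: "\<bar>x \<bullet> north_pole\<bar> \<le> 1"
    by (rule sphere_inner_le[OF x north_pole_in_sphere])
  have "cos t = - (x \<bullet> north_pole)"
    unfolding t_def using le by (intro cos_arccos) auto
  moreover have "sin t = norm y"
  proof -
    have "sin t = sqrt (1 - (x \<bullet> north_pole)\<^sup>2)"
      unfolding t_def using le by (subst sin_arccos) auto
    then show ?thesis
      using y(2) by (metis norm_ge_zero real_sqrt_abs abs_of_nonneg)
  qed
  ultimately have "\<gamma> t = x"
    using v(3) by (simp add: \<gamma>_def y_def)
  then have "of_real (P x) = (0 :: complex)"
    using G[of t] G0[of "of_real t"] by (simp only:)
  then show ?thesis
    unfolding P_def by (simp only: of_real_eq_0_iff)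
qed

context signed_basis
begin

lemma ip_Z:
  assumes f: "continuous_on (sphere 0 1) f"
  shows "ip (Z n) f = (\<Sum>j=1..hdim TYPE('d) n. Y n j north_pole * ip f (Y n j))"
proof -
  have "ip (Z n) f = ip f (\<lambda>x. \<Sum>j=1..hdim TYPE('d) n. Y n j north_pole * Y n j x)"
    by (simp add: ip_commute Z_def[abs_def] K_def mult.commute)
  also have "\<dots> = (\<Sum>j=1..hdim TYPE('d) n. Y n j north_pole * ip f (Y n j))"
    by (rule ip_sum_right) (use Y_cont f in blast)+
  finally show ?thesis .
qed

text \<open>The number \<open>ip (Z n) f\<close> combines the degree-n coefficients with the weights
  \<open>Y n j north_pole\<close>, which a signed basis makes nonnegative. Thus the sign condition
  on single coefficients survives the averaging.\<close>

lemma signed_ip_Z_nonneg: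
  assumes f: "continuous_on (sphere 0 1) f"
    and "\<And>j. j \<in> {1..hdim TYPE('d) n} \<Longrightarrow> s * ip f (Y n j) \<ge> 0"
  shows "s * ip (Z n) f \<ge> 0"
proof -
  have "s * ip (Z n) f = (\<Sum>j=1..hdim TYPE('d) n. Y n j north_pole * (s * ip f (Y n j)))"
    unfolding ip_Z[OF f] sum_distrib_left by (intro sum.cong refl) (simp add: mult_ac)
  also have "\<dots> \<ge> 0"
    by (intro sum_nonneg mult_nonneg_nonneg Y_pole_nonneg assms)
  finally show ?thesis .
qed

text \<open>A Fatou argument: testing against the positive definite approximate identity, every
  partial sum is dominated by the value at the pole.\<close>

lemma signed_partial_sum_nonpos:
  assumes f: "continuous_on (sphere 0 1) f"
    and pos: "\<And>n. n \<ge> k \<Longrightarrow> s * ip (Z n) f \<ge> 0"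
    and pole: "s * f north_pole \<le> 0" and N: "N \<ge> k"
  shows "(\<Sum>n<N. s * ip (Z n) f) \<le> 0"
proof -
  define \<phi> where "\<phi> m t = (1/2 + 1/2 * t) ^ m" for m :: nat and t :: real
  define F where "F m x = \<phi> m (x \<bullet> north_pole)" for m and x :: "real^'d::_"
  define J where "J m = ip (F m) (\<lambda>x. 1)" for m
  have Fdef: "F = (\<lambda>m x. (1/2 + 1/2 * (x \<bullet> north_pole)) ^ m)"
    by (simp add: F_def[abs_def] \<phi>_def)
  have J: "J m > 0" for m
    unfolding J_def Fdef by (rule pole_kernel_approximate_identity(1)[OF f])
  have lim: "(\<lambda>m. ip (F m) g / J m) \<longlonglongrightarrow> g north_pole" if "continuous_on (sphere 0 1) g" for g
    unfolding J_def Fdef by (rule pole_kernel_approximate_identity(2)[OF that])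
  have \<phi>eq: "\<phi> m = (\<lambda>t. (1/2 + 1/2 * t) ^ m)" for m
    by (simp add: \<phi>_def[abs_def])
  have lam0: "lam (\<phi> m) n \<ge> 0" for m n
    unfolding \<phi>eq by (rule power_kernel_lam) auto
  have pars: "(\<lambda>n. lam (\<phi> m) n * ip (Z n) f) sums ip (F m) f" for m
    unfolding Fdef \<phi>eq using power_kernel_parseval[OF _ _ f, of "1/2" "1/2" m] by simp
  \<comment> \<open>The omitted terms have index at least \<open>N \<ge> k\<close>, where the
    multiplier and the signed coefficient are both nonnegative.\<close>
  have le: "(\<Sum>n<N. s * (lam (\<phi> m) n / J m * ip (Z n) f)) \<le> s * (ip (F m) f / J m)" for m
  proof -
    have eq: "s / J m * (lam (\<phi> m) n * ip (Z n) f) = s * (lam (\<phi> m) n / J m * ip (Z n) f)" for n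
      by simp
    have sm: "(\<lambda>n. s * (lam (\<phi> m) n / J m * ip (Z n) f)) sums (s / J m * ip (F m) f)"
      unfolding eq[symmetric] by (rule sums_mult[OF pars])
    have "(\<Sum>n<N. s * (lam (\<phi> m) n / J m * ip (Z n) f)) \<le> s / J m * ip (F m) f"
      unfolding sums_unique[OF sm]
    proof (rule sum_le_suminf[OF sums_summable[OF sm]])
      fix n assume "n \<in> - {..<N}"
      then have "0 \<le> s * ip (Z n) f"
        using pos[of n] N by simp
      moreover have "0 \<le> lam (\<phi> m) n / J m"
        using lam0[of m n] J[of m] by simp
      ultimately have "0 \<le> lam (\<phi> m) n / J m * (s * ip (Z n) f)"
        by (rule mult_nonneg_nonneg[rotated])
      then show "0 \<le> s * (lam (\<phi> m) n / J m * ip (Z n) f)"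
        by (simp only: mult.left_commute)
    qed simp
    then show ?thesis by simp
  qed
  \<comment> \<open>The normalised multiplier is the average of \<open>Z n\<close> / h_n against the
    approximate identity, and that function has value 1 at the pole.\<close>
  have w: "(\<lambda>m. lam (\<phi> m) n / J m) \<longlonglongrightarrow> 1" for n
  proof -
    have "(\<lambda>m. ip (F m) (Z n) / J m / hdim TYPE('d) n) \<longlonglongrightarrow> Z n north_pole / hdim TYPE('d) n"
      by (intro tendsto_intros lim Z_cont) (use h_pos[of n] in auto)
    then show ?thesis
      using h_pos[of n] by (simp add: lam_def Z_pole F_def[abs_def] divide_divide_eq_left mult.commute)
  qed
  have "(\<lambda>m. \<Sum>n<N. s * (lam (\<phi> m) n / J m * ip (Z n) f)) \<longlonglongrightarrow> (\<Sum>n<N. s * (1 * ip (Z n) f))"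
    by (intro tendsto_intros w)
  moreover have "(\<lambda>m. s * (ip (F m) f / J m)) \<longlonglongrightarrow> s * f north_pole"
    by (intro tendsto_intros lim f)
  ultimately have "(\<Sum>n<N. s * (1 * ip (Z n) f)) \<le> s * f north_pole"
    by (rule LIMSEQ_le) (use le in auto)
  then show ?thesis
    using pole by simp
qed

text \<open>The profile is read off along a half circle joining the two poles. It puts the product
  of a cutoff with \<open>Z n\<close> in the form of a continuous function of the height, as
  \<open>zonal_pairing_eq\<close> requires.\<close>

lemma Z_zonal_profile:
  obtains \<psi> where "continuous_on {-1..1} \<psi>" "\<And>x. x \<in> sphere 0 1 \<Longrightarrow> Z n x = \<psi> (x \<bullet> north_pole)"
proof -
  obtain a :: 'd where a: "a \<noteq> Max UNIV"
    using index_ne_exists[OF card_ge_2] by blast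
  define w where "w = (axis a 1 :: real^'d::_)"
  have pole: "(north_pole :: real^'d::_) \<bullet> north_pole = 1"
    by (simp add: dot_square_norm)
  have wp: "w \<bullet> north_pole = 0" "north_pole \<bullet> w = 0"
    using a by (simp_all add: w_def inner_north_pole inner_commute[of north_pole "axis a 1"]) (simp_all add: axis_def)
  have ww: "w \<bullet> w = 1"
    by (simp add: w_def dot_square_norm norm_axis_1)
  define c where "c t = t *\<^sub>R north_pole + sqrt (1 - t\<^sup>2) *\<^sub>R w" for t
  have cp: "c t \<bullet> north_pole = t" for t
    by (simp add: c_def inner_add_left pole wp)
  have cs: "c t \<in> sphere 0 1" if "\<bar>t\<bar> \<le> 1" for t
  proof -
    have "t\<^sup>2 \<le> 1"
      using that by (simp add: abs_square_le_1)
    have "c t \<bullet> c t = t * t + sqrt (1 - t\<^sup>2) * sqrt (1 - t\<^sup>2)"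
      by (simp add: c_def inner_add_left inner_add_right pole wp ww)
    also have "\<dots> = 1"
      using \<open>t\<^sup>2 \<le> 1\<close> by (simp add: power2_eq_square)
    finally show ?thesis
      by (simp add: norm_eq_sqrt_inner)
  qed
  show thesis
  proof (rule that[of "\<lambda>t. Z n (c t)"])
    show "continuous_on {-1..1} (\<lambda>t. Z n (c t))"
    proof (rule continuous_on_compose2[OF Z_cont])
      show "continuous_on {-1..1} c"
        unfolding c_def[abs_def] by (intro continuous_intros)
      show "c ` {-1..1} \<subseteq> sphere 0 1"
        using cs by (force simp: abs_le_iff)
    qed
    show "Z n x = Z n (c (x \<bullet> north_pole))" if x: "x \<in> sphere 0 1" for x
      using Z_zonal[of n, unfolded zonal_def, rule_format, OF x cs] sphere_inner_le[OF x north_pole_in_sphere] cp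
      by simp
  qed
qed

text \<open>With a cutoff X of the cap, split b n into the pairings of f with X Z n and with (1 - X)
  Z n. In the first, f may be replaced by g. In the second, (1 - X) f \<ge> 0, so it is bounded by
  h_n times the integral of (1 - X) f, which is at most minus the pairing of X with f, hence with g.
  Both are at most h_n M \<mu>; this doubling and the one in M \<le> 2 \<Sum>n<k. \<bar>b n\<bar>
  make the factor 4.\<close>

lemma cap_uncertainty:
  assumes f: "continuous_on (sphere 0 1) f" and s: "s = 1 \<or> s = -1"
    and coeff: "\<And>n j. n \<ge> k \<Longrightarrow> j \<in> {1..hdim TYPE('d) n} \<Longrightarrow> s * ip f (Y n j) \<ge> 0"
    and pole: "s * f north_pole \<le> 0" and mean: "(\<integral>x. f x \<partial>sigma_bar) \<le> 0"
    and nonneg: "\<And>x. x \<in> sphere 0 1 \<Longrightarrow> x \<bullet> north_pole \<le> c \<Longrightarrow> f x \<ge> 0"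
    and c: "-1 < c" "c' < c" and x0: "x0 \<in> sphere 0 1" "f x0 \<noteq> 0"
  shows "1 \<le> 4 * (\<Sum>n<k. hdim TYPE('d) n) * measure sigma_bar {x \<in> sphere (0 :: real^'d::_) 1. x \<bullet> north_pole \<ge> c'}"
proof -
  define b where "b n = ip (Z n) f" for n
  have sb: "s * b n = \<bar>b n\<bar>" if "n \<ge> k" for n
    using signed_ip_Z_nonneg[OF f, of n s] coeff[OF that] s by (auto simp: b_def)
  have spos: "s * ip (Z n) f \<ge> 0" if "n \<ge> k" for n
    using sb[OF that] by (simp add: b_def)
  \<comment> \<open>From index \<open>k\<close> on \<open>\<bar>b n\<bar>\<close> is
    \<open>s * b n\<close>, and the sums of all \<open>s * b n\<close> up to any bound beyond
    \<open>k\<close> are nonpositive, so the tail is at most minus the head.\<close>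
  have part: "(\<Sum>n<N. \<bar>b n\<bar>) \<le> 2 * (\<Sum>n<k. \<bar>b n\<bar>)" for N
  proof -
    define N' where "N' = max k N"
    have "(\<Sum>n<N. \<bar>b n\<bar>) \<le> (\<Sum>n<N'. \<bar>b n\<bar>)"
      by (rule sum_mono2) (auto simp: N'_def)
    also have "\<dots> = (\<Sum>n<k. \<bar>b n\<bar>) + (\<Sum>n=k..<N'. \<bar>b n\<bar>)"
      using sum.atLeastLessThan_concat[of 0 k N' "\<lambda>n. \<bar>b n\<bar>"] by (simp add: N'_def lessThan_atLeast0)
    also have "(\<Sum>n=k..<N'. \<bar>b n\<bar>) = (\<Sum>n=k..<N'. s * b n)"
      by (rule sum.cong) (use sb in auto)
    also have "\<dots> = (\<Sum>n<N'. s * b n) - (\<Sum>n<k. s * b n)"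
      using sum.atLeastLessThan_concat[of 0 k N' "\<lambda>n. s * b n"] by (simp add: N'_def lessThan_atLeast0)
    also have "\<dots> \<le> 0 - (\<Sum>n<k. s * b n)"
      using signed_partial_sum_nonpos[OF f spos pole, of N'] by (simp add: b_def N'_def)
    also have "\<dots> \<le> (\<Sum>n<k. \<bar>b n\<bar>)"
      using s by (auto simp: sum_negf[symmetric] intro!: sum_mono)
    finally show ?thesis by simp
  qed
  have summ: "summable (\<lambda>n. \<bar>b n\<bar>)"
    by (rule summableI_nonneg_bounded[OF _ part]) simp
  define M where "M = (\<Sum>n. \<bar>b n\<bar>)"
  have M: "M \<le> 2 * (\<Sum>n<k. \<bar>b n\<bar>)"
    unfolding M_def by (rule suminf_le_const[OF summ part])
  have M0: "M \<ge> 0"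
    unfolding M_def by (rule suminf_nonneg[OF summ]) simp
  define g where "g = zseries b"
  have gc: "continuous_on (sphere 0 1) g"
    unfolding g_def by (rule zseries_cont[OF summ])
  have gM: "\<bar>g x\<bar> \<le> M" if "x \<in> sphere 0 1" for x
    unfolding g_def M_def by (rule zseries_abs_le[OF summ that])
  have bg: "ip (Z n) f = ip (Z n) g" for n
  proof -
    have "(\<lambda>m. b m / hdim TYPE('d) m * ip (Z m) (Z n)) sums ip g (Z n)"
      unfolding g_def by (rule zseries_ip[OF summ Z_cont])
    moreover have "(\<lambda>m. b m / hdim TYPE('d) m * ip (Z m) (Z n)) = (\<lambda>m. if m = n then b n else 0)"
      using h_pos[of n] by (auto simp: Z_orth fun_eq_iff)
    moreover have "(\<lambda>m. if m = n then b n else 0) sums b n"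
      using sums_single[of n "\<lambda>_. b n"] by simp
    ultimately have "ip g (Z n) = b n"
      using sums_unique2 by auto
    then show ?thesis
      by (simp add: b_def ip_commute)
  qed
  \<comment> \<open>Equal to 1 from height \<open>c\<close> on and 0 up to \<open>c'\<close>. Being
    strictly below 1 under \<open>c\<close> matters when \<open>M = 0\<close>, where
    \<open>1 - X\<close> is divided out.\<close>
  define \<kappa> where "\<kappa> t = max 0 (min 1 ((t - c') / (c - c')))" for t
  have \<kappa>c: "continuous_on A \<kappa>" for A
    unfolding \<kappa>_def[abs_def] using c by (intro continuous_intros) auto
  have \<kappa>01: "0 \<le> \<kappa> t" "\<kappa> t \<le> 1" for t
    by (auto simp: \<kappa>_def)
  have \<kappa>1: "\<kappa> t = 1" if "t \<ge> c" for t
    using that c by (auto simp: \<kappa>_def min_def max_def)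
  have \<kappa>lt: "\<kappa> t < 1" if "t < c" for t
    using that c by (auto simp: \<kappa>_def)
  have \<kappa>0: "\<kappa> t = 0" if "t \<le> c'" for t
  proof -
    have "(t - c') / (c - c') \<le> 0"
      using that c by (simp add: divide_nonpos_pos)
    then show ?thesis
      by (simp add: \<kappa>_def)
  qed
  define X where "X x = \<kappa> (x \<bullet> north_pole)" for x :: "real^'d::_"
  have Xc: "continuous_on (sphere 0 1) X"
    unfolding X_def[abs_def] by (rule continuous_on_zonal_function[OF \<kappa>c])
  have Xf: "ip X f = ip X g"
    unfolding X_def[abs_def] by (rule zonal_pairing_eq[OF f gc bg \<kappa>c])
  define \<mu> where "\<mu> = measure sigma_bar {x \<in> sphere (0 :: real^'d::_) 1. x \<bullet> north_pole \<ge> c'}"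
  have rest: "0 \<le> (1 - X x) * f x" if "x \<in> sphere 0 1" for x
  proof (cases "x \<bullet> north_pole \<le> c")
    case True
    then show ?thesis
      using nonneg[OF that True] \<kappa>01 by (simp add: X_def)
  next
    case False
    then show ?thesis
      using \<kappa>1 by (simp add: X_def)
  qed
  have restc: "continuous_on (sphere 0 1) (\<lambda>x. (1 - X x) * f x)"
    by (intro continuous_intros Xc f)
  have resti: "(\<integral>x. (1 - X x) * f x \<partial>sigma_bar) = (\<integral>x. f x \<partial>sigma_bar) - ip X f"
    unfolding ip_def left_diff_distrib mult_1
    by (rule Bochner_Integration.integral_diff)
       (intro integrable_continuous_sigma_bar continuous_intros Xc f)+
  show ?thesis
  proof (cases "M = 0")
    case False
    then have Mpos: "M > 0" using M0 by simp
    have X\<mu>: "(\<integral>x. X x \<partial>sigma_bar) \<le> \<mu>"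
    proof -
      let ?A = "{x \<in> sphere (0 :: real^'d::_) 1. x \<bullet> north_pole \<ge> c'}"
      have A: "?A \<in> sets sigma_bar"
        by (rule cap_in_sets)
      have "(\<integral>x. X x \<partial>sigma_bar) \<le> (\<integral>x. indicator ?A x \<partial>sigma_bar)"
      proof (rule integral_mono)
        show "integrable sigma_bar (indicator ?A :: _ \<Rightarrow> real)"
          using A by (intro integrable_sigma_bar_bounded[where B = 1] borel_measurable_indicator) (auto simp: indicator_def)
        show "X x \<le> indicator ?A x" if "x \<in> space sigma_bar" for x
          using \<kappa>01 \<kappa>0[of "x \<bullet> north_pole"] that by (auto simp: X_def indicator_def)
      qed (rule integrable_continuous_sigma_bar[OF Xc])
      also have "\<dots> = measure sigma_bar (?A \<inter> space sigma_bar)"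
        using A by simp
      also have "?A \<inter> space sigma_bar = ?A"
        by auto
      finally show ?thesis
        unfolding \<mu>_def .
    qed
    have small: "\<bar>\<integral>x. X x * (w x * g x) \<partial>sigma_bar\<bar> \<le> C * M * \<mu>"
      if w: "continuous_on (sphere 0 1) w" "\<And>x. x \<in> sphere 0 1 \<Longrightarrow> \<bar>w x\<bar> \<le> C" "C \<ge> 0" for w C
    proof -
      have "\<bar>\<integral>x. X x * (w x * g x) \<partial>sigma_bar\<bar> \<le> (\<integral>x. \<bar>X x * (w x * g x)\<bar> \<partial>sigma_bar)"
        by (rule integral_abs_bound)
      also have "\<dots> \<le> (\<integral>x. (C * M) * X x \<partial>sigma_bar)"
      proof (rule integral_mono)
        show "integrable sigma_bar (\<lambda>x. \<bar>X x * (w x * g x)\<bar>)" "integrable sigma_bar (\<lambda>x. (C * M) * X x)"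
          by (intro integrable_continuous_sigma_bar continuous_on_rabs continuous_intros Xc w gc)+
        fix x :: "real^'d::_" assume "x \<in> space sigma_bar"
        then have x: "x \<in> sphere 0 1" by simp
        have "\<bar>w x\<bar> * \<bar>g x\<bar> \<le> C * M"
          using w(2)[OF x] gM[OF x] w(3) by (intro mult_mono) auto
        moreover have "0 \<le> X x"
          using \<kappa>01 by (simp add: X_def)
        ultimately have "(\<bar>w x\<bar> * \<bar>g x\<bar>) * X x \<le> (C * M) * X x"
          by (rule mult_right_mono)
        then show "\<bar>X x * (w x * g x)\<bar> \<le> (C * M) * X x"
          using \<open>0 \<le> X x\<close> by (simp add: abs_mult mult.commute)
      qed
      also have "\<dots> = C * M * (\<integral>x. X x \<partial>sigma_bar)"
        by simp
      also have "\<dots> \<le> C * M * \<mu>"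
        using X\<mu> w(3) M0 by (intro mult_left_mono) auto
      finally show ?thesis .
    qed
    have Xg: "\<bar>ip X g\<bar> \<le> M * \<mu>"
      using small[of "\<lambda>x. 1" 1] by (simp add: ip_def)
    have bound: "\<bar>b n\<bar> \<le> 2 * hdim TYPE('d) n * M * \<mu>" for n
    proof -
      obtain \<psi> where \<psi>: "continuous_on {-1..1} \<psi>" "\<And>x. x \<in> sphere 0 1 \<Longrightarrow> Z n x = \<psi> (x \<bullet> north_pole)"
        using Z_zonal_profile[of n] by blast
      let ?h = "real (hdim TYPE('d) n)"
      have "ip (\<lambda>x. X x * Z n x) u = ip (\<lambda>x. \<kappa> (x \<bullet> north_pole) * \<psi> (x \<bullet> north_pole)) u" for u
        by (rule ip_cong) (auto simp: X_def \<psi>(2))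
      then have "ip (\<lambda>x. X x * Z n x) f = ip (\<lambda>x. X x * Z n x) g"
        using zonal_pairing_eq[OF f gc bg continuous_on_mult[OF \<kappa>c \<psi>(1)]] by simp
      also have "\<bar>\<dots>\<bar> \<le> ?h * M * \<mu>"
        using small[OF Z_cont[of n] Z_abs_le[of _ n]] by (simp add: ip_def mult.assoc)
      finally have 1: "\<bar>ip (\<lambda>x. X x * Z n x) f\<bar> \<le> ?h * M * \<mu>" .
      have "\<bar>\<integral>x. Z n x * ((1 - X x) * f x) \<partial>sigma_bar\<bar> \<le> (\<integral>x. \<bar>Z n x * ((1 - X x) * f x)\<bar> \<partial>sigma_bar)"
        by (rule integral_abs_bound)
      also have "\<dots> \<le> (\<integral>x. ?h * ((1 - X x) * f x) \<partial>sigma_bar)"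
      proof (rule integral_mono)
        show "integrable sigma_bar (\<lambda>x. \<bar>Z n x * ((1 - X x) * f x)\<bar>)" "integrable sigma_bar (\<lambda>x. ?h * ((1 - X x) * f x))"
          by (intro integrable_continuous_sigma_bar continuous_on_rabs continuous_intros Xc Z_cont f)+
        fix x :: "real^'d::_" assume "x \<in> space sigma_bar"
        then have x: "x \<in> sphere 0 1" by simp
        show "\<bar>Z n x * ((1 - X x) * f x)\<bar> \<le> ?h * ((1 - X x) * f x)"
          unfolding abs_mult[of "Z n x"] abs_of_nonneg[OF rest[OF x]]
          by (rule mult_right_mono[OF Z_abs_le[OF x] rest[OF x]])
      qed
      also have "\<dots> = ?h * ((\<integral>x. f x \<partial>sigma_bar) - ip X f)"
        by (simp only: integral_mult_right_zero resti)
      also have "\<dots> \<le> ?h * (M * \<mu>)"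
      proof (rule mult_left_mono)
        show "(\<integral>x. f x \<partial>sigma_bar) - ip X f \<le> M * \<mu>"
          using mean Xg Xf by linarith
      qed simp
      finally have 2: "\<bar>\<integral>x. Z n x * ((1 - X x) * f x) \<partial>sigma_bar\<bar> \<le> ?h * M * \<mu>"
        by simp
      have "b n = (\<integral>x. (X x * Z n x) * f x + Z n x * ((1 - X x) * f x) \<partial>sigma_bar)"
        unfolding b_def ip_def by (rule Bochner_Integration.integral_cong) (auto simp: algebra_simps)
      also have "\<dots> = ip (\<lambda>x. X x * Z n x) f + (\<integral>x. Z n x * ((1 - X x) * f x) \<partial>sigma_bar)"
        unfolding ip_def
        by (rule Bochner_Integration.integral_add)
           (intro integrable_continuous_sigma_bar continuous_intros Xc Z_cont f)+
      finally show ?thesis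
        using 1 2 by linarith
    qed
    have "M \<le> 2 * (\<Sum>n<k. 2 * hdim TYPE('d) n * M * \<mu>)"
    proof -
      have "(\<Sum>n<k. \<bar>b n\<bar>) \<le> (\<Sum>n<k. 2 * hdim TYPE('d) n * M * \<mu>)"
        by (rule sum_mono) (rule bound)
      with M show ?thesis by linarith
    qed
    also have "\<dots> = (4 * (\<Sum>n<k. hdim TYPE('d) n) * \<mu>) * M"
      by (simp add: sum_distrib_right sum_distrib_left mult_ac)
    finally have "1 * M \<le> (4 * (\<Sum>n<k. hdim TYPE('d) n) * \<mu>) * M"
      by simp
    then show ?thesis
      unfolding \<mu>_def[symmetric] by (rule mult_right_le_imp_le[OF _ Mpos])
  next
    case True
    have b0: "b n = 0" for n
    proof -
      have "(\<Sum>i\<in>{n}. \<bar>b i\<bar>) \<le> M"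
        unfolding M_def by (rule sum_le_suminf[OF summ]) auto
      then show ?thesis using True by simp
    qed
    \<comment> \<open>Now \<open>g\<close> vanishes, so the nonnegative continuous function (1 - X)
      f has nonpositive integral and is zero; so is \<open>f\<close> at heights below
      \<open>c\<close>.\<close>
    have "\<bar>ip X g\<bar> \<le> 1 * M"
      by (rule ip_abs_le[OF Xc gc]) (use \<kappa>01 gM in \<open>auto simp: X_def\<close>)
    then have "ip X f = 0"
      unfolding Xf using True by simp
    then have "(\<integral>x. (1 - X x) * f x \<partial>sigma_bar) \<le> 0"
      using mean resti by simp
    moreover have "(\<integral>x. (1 - X x) * f x \<partial>sigma_bar) \<ge> 0"
      by (rule Bochner_Integration.integral_nonneg) (use rest in simp)
    ultimately have rest0: "(1 - X x) * f x = 0" if "x \<in> sphere 0 1" for x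
      using continuous_nonneg_integral_zero_sphere[OF restc rest _ that] by simp
    have fzero: "f x = 0" if "x \<in> sphere 0 1" "x \<bullet> north_pole < c" for x
      using rest0[OF that(1)] \<kappa>lt[OF that(2)] by (simp add: X_def)
    obtain N0 where N0: "\<And>n j. n \<ge> N0 \<Longrightarrow> j \<in> {1..hdim TYPE('d) n} \<Longrightarrow> Y n j north_pole > 0"
      using Y_pole_pos by blast
    define N where "N = max N0 k"
    \<comment> \<open>A vanishing sum of nonnegative terms has vanishing terms, and beyond
      \<open>N0\<close> the weight at the pole is strictly positive and can be cancelled.\<close>
    have coef0: "ip f (Y n j) = 0" if n: "n \<ge> N" and j: "j \<in> {1..hdim TYPE('d) n}" for n j
    proof -
      have nn: "0 \<le> Y n i north_pole * (s * ip f (Y n i))" if "i \<in> {1..hdim TYPE('d) n}" for i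
        by (rule mult_nonneg_nonneg[OF Y_pole_nonneg[OF that] coeff[OF _ that]]) (use n in \<open>simp add: N_def\<close>)
      have "(\<Sum>i=1..hdim TYPE('d) n. Y n i north_pole * (s * ip f (Y n i))) = s * b n"
        unfolding b_def ip_Z[OF f] sum_distrib_left by (intro sum.cong refl) (simp add: mult_ac)
      then have sum0: "(\<Sum>i=1..hdim TYPE('d) n. Y n i north_pole * (s * ip f (Y n i))) = 0"
        by (simp only: b0 mult_zero_right)
      have "Y n j north_pole * (s * ip f (Y n j)) = 0"
        by (rule sum_nonneg_0[where f = "\<lambda>i. Y n i north_pole * (s * ip f (Y n i))",
              OF finite_atLeastAtMost _ sum0 j]) (rule nn)
      moreover have "Y n j north_pole > 0"
        by (rule N0[OF _ j]) (use n in \<open>simp add: N_def\<close>)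
      ultimately show ?thesis
        using s by auto
    qed
    define p where "p n x = (\<Sum>j=1..hdim TYPE('d) n. ip f (Y n j) * Y n j x)" for n x
    have p: "p n \<in> sph_harm n" for n
      unfolding p_def[abs_def] by (intro sph_harm_sum sph_harm_cmult Y_in)
    have pc: "continuous_on (sphere 0 1) (p n)" for n
      using continuous_on_sph_harm p by blast
    have pY: "ip (p n) (Y m j) = (if n = m then ip f (Y n j) else 0)" if j: "j \<in> {1..hdim TYPE('d) m}" for n m j
    proof (cases "n = m")
      case True
      have "ip (p n) (Y m j) = (\<Sum>i=1..hdim TYPE('d) n. ip f (Y n i) * ip (Y n i) (Y m j))"
        unfolding p_def[abs_def] by (rule ip_sum_left) (use j Y_cont in blast)+
      also have "\<dots> = (\<Sum>i=1..hdim TYPE('d) n. if i = j then ip f (Y n j) else 0)"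
        by (intro sum.cong refl) (use j Y_orth True in auto)
      finally show ?thesis
        using j True by simp
    next
      case False
      then show ?thesis
        using sph_harm_orthogonal_degrees[OF p Y_in[OF j]] by simp
    qed
    have fp: "f x = (\<Sum>n<N. p n x)" if x: "x \<in> sphere 0 1" for x
    proof -
      have sc: "continuous_on (sphere 0 1) (\<lambda>x. \<Sum>n<N. p n x)"
        by (intro continuous_intros pc)
      have "f x - (\<Sum>n<N. p n x) = 0"
      proof (rule Y_complete[where f = "\<lambda>x. f x - (\<Sum>n<N. p n x)", OF _ _ x])
        show "continuous_on (sphere 0 1) (\<lambda>x. f x - (\<Sum>n<N. p n x))"
          by (intro continuous_intros f pc)
        fix m j assume j: "j \<in> {1..hdim TYPE('d) m}"
        have "ip (\<lambda>x. \<Sum>n<N. p n x) (Y m j) = (\<Sum>n<N. ip (p n) (Y m j))"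
          using ip_sum_left[of "{..<N}" p "Y m j" "\<lambda>_. 1"] pc Y_cont[OF j] by simp
        also have "\<dots> = (if m < N then ip f (Y m j) else 0)"
          using pY[OF j] by simp
        also have "\<dots> = ip f (Y m j)"
          using coef0[of m j] j by auto
        finally show "ip (\<lambda>x. f x - (\<Sum>n<N. p n x)) (Y m j) = 0"
          unfolding ip_diff_left[OF f sc Y_cont[OF j]] by simp
      qed
      then show ?thesis by simp
    qed
    have "\<forall>n. \<exists>P. hom_poly n P \<and> (\<forall>x. x \<in> sphere 0 1 \<longrightarrow> p n x = P x)"
    proof (intro allI)
      fix n
      show "\<exists>P. hom_poly n P \<and> (\<forall>x. x \<in> sphere 0 1 \<longrightarrow> p n x = P x)"
        by (rule sph_harmE[OF p[of n]]) blast
    qed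
    then obtain P where "\<forall>n. hom_poly n (P n) \<and> (\<forall>x. x \<in> sphere 0 1 \<longrightarrow> p n x = P n x)"
      by (rule exE[OF choice])
    then have P: "hom_poly n (P n)" "x \<in> sphere 0 1 \<Longrightarrow> p n x = P n x" for n x
      by simp_all
    have fP: "f x = (\<Sum>n<N. P n x)" if "x \<in> sphere 0 1" for x
      unfolding fp[OF that] by (intro sum.cong refl P(2) that)
    have "(\<Sum>n<N. P n x0) = 0"
      by (rule sphere_polynomial_vanishes[OF card_ge_2 P(1) c(1) _ x0(1)]) (use fP fzero in force)
    then show ?thesis
      using fP[OF x0(1)] x0(2) by simp
  qed
qed

end

subsection \<open>Numerical estimates\<close>

text \<open>The binomial expansion without its terms of order four and higher. The real coefficients
  vanish by themselves when \<open>n\<close> is smaller than the order, and the induction discards a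
  nonnegative quartic term.\<close>

lemma cubic_Bernoulli:
  fixes x :: real
  assumes "x \<ge> 0"
  shows "(1 + x) ^ n \<ge> 1 + n * x + n * (real n - 1) / 2 * x\<^sup>2 + n * (real n - 1) * (real n - 2) / 6 * x ^ 3"
proof (induction n)
  case (Suc n)
  have nonneg: "real n * (real n - 1) * (real n - 2) \<ge> 0"
  proof (cases "n \<ge> 2")
    case False
    then have "n = 0 \<or> n = 1" by auto
    then show ?thesis by auto
  qed simp
  let ?n = "real n"
  have "1 + Suc n * x + Suc n * (real (Suc n) - 1) / 2 * x\<^sup>2 + Suc n * (real (Suc n) - 1) * (real (Suc n) - 2) / 6 * x ^ 3
      = (1 + x) * (1 + ?n * x + ?n * (?n - 1) / 2 * x\<^sup>2 + ?n * (?n - 1) * (?n - 2) / 6 * x ^ 3)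
        - ?n * (?n - 1) * (?n - 2) / 6 * x ^ 4"
    by (simp add: field_simps power2_eq_square power3_eq_cube power4_eq_xxxx)
  also have "\<dots> \<le> (1 + x) * (1 + ?n * x + ?n * (?n - 1) / 2 * x\<^sup>2 + ?n * (?n - 1) * (?n - 2) / 6 * x ^ 3)"
    using nonneg assms by simp
  also have "\<dots> \<le> (1 + x) * (1 + x) ^ n"
    using Suc assms by (intro mult_left_mono) auto
  finally show ?case
    by simp
qed simp

text \<open>The inequality behind the step from d - 2 to d in \<open>Gamma_half_bound\<close>, with
  n = d - 3. It rests on (1 + 4/n)^n \<ge> 16, which the cubic truncation yields from n = 5 on but
  not at n = 4, where it equals 15; smaller n are evaluated.\<close>

lemma power_growth_step:
  assumes "n \<ge> 2"
  shows "16 * (real n + 2)\<^sup>2 * real n ^ n \<le> (real n + 4) ^ (n + 2)"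
proof (cases "n \<ge> 5")
  case False
  with assms have "n = 2 \<or> n = 3 \<or> n = 4" by auto
  then show ?thesis by (elim disjE) simp_all
next
  case True
  define r where "r = real n"
  have r: "r \<ge> 5"
    using True by (simp add: r_def)
  have "16 \<le> 1 + r * (4/r) + r * (r - 1) / 2 * (4/r)\<^sup>2 + r * (r - 1) * (r - 2) / 6 * (4/r) ^ 3"
  proof -
    \<comment> \<open>Written in powers of r - 5, the numerator has only positive
      coefficients.\<close>
    have "1 + r * (4/r) + r * (r - 1) / 2 * (4/r)\<^sup>2 + r * (r - 1) * (r - 2) / 6 * (4/r) ^ 3 - 16
      = (23 * (r - 5)\<^sup>2 + 110 * (r - 5) + 39) / (3 * r\<^sup>2)"
      using r by (simp add: divide_simps) (simp add: algebra_simps power_numeral_reduce)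
    also have "\<dots> \<ge> 0"
      using r by (intro divide_nonneg_nonneg add_nonneg_nonneg) auto
    finally show ?thesis by simp
  qed
  also have "\<dots> \<le> (1 + 4/r) ^ n"
    using cubic_Bernoulli[of "4/r" n] r by (simp add: r_def)
  finally have "16 * r ^ n \<le> (1 + 4/r) ^ n * r ^ n"
    using r by (intro mult_right_mono) auto
  also have "\<dots> = (r + 4) ^ n"
    using r by (simp add: power_mult_distrib[symmetric] distrib_right)
  finally have "16 * r ^ n \<le> (r + 4) ^ n" .
  moreover have "(r + 2)\<^sup>2 \<le> (r + 4)\<^sup>2"
    using r by (intro power_mono) auto
  ultimately have "(16 * r ^ n) * (r + 2)\<^sup>2 \<le> (r + 4) ^ n * (r + 4)\<^sup>2"
    using r by (intro mult_mono) auto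
  then show ?thesis
    by (simp add: r_def power_add power2_eq_square mult_ac)
qed

text \<open>Induction in steps of two through Gamma(x + 1) = x Gamma(x). As
  \<open>power_growth_step\<close> fails for n = 1, d = 4 is a base case besides 2 and 3. For d = 2
  and d = 4 the crude bound pi < 4 suffices.\<close>

lemma Gamma_half_bound:
  assumes "d \<ge> 2"
  shows "Gamma ((real d + 1) / 2) ^ 4 * 16 ^ (d - 1) \<le> 8 * ((real d)\<^sup>2 - 1) ^ (d - 1)"
  using assms
proof (induction d rule: less_induct)
  case (less d)
  have pi2: "pi\<^sup>2 \<le> 4\<^sup>2"
    using pi_less_4 by (intro power_mono) auto
  have Gp: "Gamma (x + 1) = x * Gamma x" if "x > 0" for x :: real
    using that nonpos_Ints_nonpos[of x] by (intro Gamma_plus1) auto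
  have half: "Gamma (3 / 2 :: real) = sqrt pi / 2"
    using Gp[of "1/2"] Gamma_one_half_real by simp
  have fivehalf: "Gamma (5 / 2 :: real) = 3 / 4 * sqrt pi"
    using Gp[of "3/2"] half by simp
  have sq4: "(sqrt pi) ^ 4 = pi\<^sup>2"
    using real_sqrt_pow2[of pi] by (simp add: power4_eq_xxxx power2_eq_square)
  have half4: "Gamma (3 / 2 :: real) ^ 4 = pi\<^sup>2 / 16"
    by (simp only: half power_divide sq4) simp
  have fivehalf4: "Gamma (5 / 2 :: real) ^ 4 = 81 / 256 * pi\<^sup>2"
    by (simp only: fivehalf power_mult_distrib sq4) (simp add: power_divide)
  consider "d = 2" | "d = 3" | "d = 4" | "d \<ge> 5"
    using less.prems by linarith
  then show ?case
  proof cases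
    case 1
    then show ?thesis
      using pi2 by (simp add: half4)
  next
    case 2
    have "Gamma (2 :: real) = 1"
      using Gamma_fact[of 1, where 'a = real] by simp
    then show ?thesis
      using 2 by simp
  next
    case 3
    then show ?thesis
      using pi2 by (simp add: fivehalf4)
  next
    case 4
    define e where "e = d - 2"
    define n where "n = e - 1"
    have e: "d = e + 2" "e \<ge> 3" "e < d" and n: "e = n + 1" "n \<ge> 2"
      using 4 by (auto simp: e_def n_def)
    let ?r = "real n"
    have IH: "Gamma ((?r + 2) / 2) ^ 4 * 16 ^ n \<le> 8 * (?r * (?r + 2)) ^ n"
      using less.IH[OF e(3)] e(2) n by (simp add: power2_eq_square algebra_simps)
    have GG: "Gamma ((real d + 1) / 2) = (?r + 2) / 2 * Gamma ((?r + 2) / 2)"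
    proof -
      have "(real d + 1) / 2 = (?r + 2) / 2 + 1"
        using e n by simp
      moreover have "Gamma ((?r + 2) / 2 + 1) = (?r + 2) / 2 * Gamma ((?r + 2) / 2)"
        by (rule Gp) simp
      ultimately show ?thesis
        by (simp only:)
    qed
    have d1: "d - 1 = n + 2"
      using e n by simp
    have "Gamma ((real d + 1) / 2) ^ 4 * 16 ^ (d - 1)
        = (?r + 2) ^ 4 * 16 * (Gamma ((?r + 2) / 2) ^ 4 * 16 ^ n)"
      unfolding GG d1 by (simp add: power_mult_distrib power_divide power_add)
    also have "\<dots> \<le> (?r + 2) ^ 4 * 16 * (8 * (?r * (?r + 2)) ^ n)"
      using IH by (intro mult_left_mono) auto
    also have "\<dots> = 8 * (?r + 2) ^ (n + 2) * (16 * (?r + 2)\<^sup>2 * ?r ^ n)"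
      by (simp add: power_mult_distrib power_add power2_eq_square power4_eq_xxxx mult_ac)
    also have "\<dots> \<le> 8 * (?r + 2) ^ (n + 2) * (?r + 4) ^ (n + 2)"
      using power_growth_step[OF n(2)] by (intro mult_left_mono) auto
    also have "\<dots> = 8 * ((?r + 2) * (?r + 4)) ^ (n + 2)"
      by (simp only: power_mult_distrib mult.assoc)
    also have "(?r + 2) * (?r + 4) = (real d)\<^sup>2 - 1"
      using e n by (simp add: power2_eq_square algebra_simps)
    finally show ?thesis
      unfolding d1 .
  qed
qed

definition lower_const :: "nat \<Rightarrow> real" where
  "lower_const d = 2 * Gamma ((real d + 1) / 2) powr (2 / (real d - 1))
     / ((4 * exp (1/12)) powr (2 / (real d - 1)) * sqrt ((real d)\<^sup>2 - 1))"

lemma lower_const_nonneg: "lower_const d \<ge> 0" if "d \<ge> 2"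
proof -
  have "(1::real) \<le> (real d)\<^sup>2"
    using that by (simp add: one_le_power)
  then show ?thesis
    by (simp add: lower_const_def)
qed

text \<open>The (d-1)-st power clears \<open>powr\<close>. The constants to be beaten are 4 from
  \<open>cap_uncertainty\<close>, 2 from \<open>sum_h_le\<close> and 2^(d-1) / sqrt 2 from
  \<open>cap_measure\<close>.\<close>

lemma lower_const_power:
  assumes "d \<ge> 2"
  shows "lower_const d ^ (d - 1) * (8 * 2 ^ (d - 1)) \<le> sqrt 2"
proof -
  define n where "n = d - 1"
  define G where "G = Gamma ((real d + 1) / 2)"
  define S where "S = (real d)\<^sup>2 - 1"
  have n: "n \<ge> 1" "real d - 1 = real n"
    using assms by (auto simp: n_def)
  have G: "G > 0"
    unfolding G_def by (intro Gamma_real_pos) auto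
  have "(1::real) < (real d)\<^sup>2"
    using assms by (simp add: one_less_power)
  then have S: "S > 0"
    by (simp add: S_def)
  have pw: "(a powr (2 / real n)) ^ n = a\<^sup>2" if "a > 0" for a :: real
    using that n(1) by (simp add: powr_power powr_numeral)
  have L: "lower_const d ^ n = 2 ^ n * G\<^sup>2 / ((4 * exp (1/12))\<^sup>2 * sqrt S ^ n)"
    unfolding lower_const_def n(2) G_def[symmetric] S_def[symmetric]
    by (simp only: power_divide power_mult_distrib pw[OF G] pw[of "4 * exp (1/12)"]) (simp add: pw)
  \<comment> \<open>Squaring removes sqrt S and sqrt 2 and leaves
    \<open>Gamma_half_bound\<close>.\<close>
  have "(G\<^sup>2 * 4 ^ n)\<^sup>2 \<le> (2 * sqrt 2 * sqrt S ^ n)\<^sup>2"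
  proof -
    have "(G\<^sup>2 * 4 ^ n)\<^sup>2 = G ^ 4 * 16 ^ n"
    proof -
      have "((4::real) ^ n)\<^sup>2 = 16 ^ n"
        by (simp add: power2_eq_square flip: power_mult_distrib)
      then show ?thesis
        by (simp add: power_mult_distrib flip: power_mult)
    qed
    also have "\<dots> \<le> 8 * S ^ n"
      using Gamma_half_bound[OF assms] by (simp add: G_def S_def n_def)
    also have "\<dots> = (2 * sqrt 2 * sqrt S ^ n)\<^sup>2"
    proof -
      have "(sqrt S ^ n)\<^sup>2 = (sqrt S ^ 2) ^ n"
        by (simp only: power_mult[symmetric] mult.commute)
      then show ?thesis
        using S by (simp add: power_mult_distrib)
    qed
    finally show ?thesis .
  qed
  then have GS: "G\<^sup>2 * 4 ^ n \<le> 2 * sqrt 2 * sqrt S ^ n"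
    by (rule power2_le_imp_le) (use S in simp)
  have E: "(1::real) \<le> (exp (1/12))\<^sup>2"
    by (simp add: one_le_power)
  have "lower_const d ^ n * (8 * 2 ^ n) = 8 * (G\<^sup>2 * 4 ^ n) / ((4 * exp (1/12))\<^sup>2 * sqrt S ^ n)"
  proof -
    have "(4::real) ^ n = 2 ^ n * 2 ^ n"
      by (simp flip: power_mult_distrib)
    then show ?thesis
      unfolding L by (simp only: times_divide_eq_left times_divide_eq_right mult_ac)
  qed
  also have "\<dots> \<le> 8 * (2 * sqrt 2 * sqrt S ^ n) / (16 * sqrt S ^ n)"
  proof (rule frac_le)
    show "16 * sqrt S ^ n \<le> (4 * exp (1/12))\<^sup>2 * sqrt S ^ n"
      using E S by (intro mult_right_mono) (auto simp: power_mult_distrib)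
  qed (use GS S in auto)
  also have "\<dots> = sqrt 2"
    using S by simp
  finally show ?thesis
    by (simp add: n_def)
qed

text \<open>Settles caps of at least a hemisphere and the angle pi, where sqrt (1 - c) and k are
  both at least 1.\<close>

lemma lower_const_le_1: "lower_const d \<le> 1" if "d \<ge> 2"
proof -
  have "lower_const d ^ (d - 1) * 8 \<le> lower_const d ^ (d - 1) * (8 * 2 ^ (d - 1))"
    using lower_const_nonneg[OF that] one_le_power[of "2::real" "d - 1"] by (intro mult_left_mono) auto
  also have "\<dots> \<le> sqrt 2"
    by (rule lower_const_power[OF that])
  also have "sqrt 2 \<le> 8"
    by (rule real_le_lsqrt) auto
  finally have "lower_const d ^ (d - 1) \<le> 1 ^ (d - 1)"
    by simp
  then show ?thesis
    by (rule power_mono_iff[THEN iffD1, rotated -1]) (use that lower_const_nonneg[OF that] in auto)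
qed

lemma lower_const_le:
  assumes d: "d \<ge> 2" and k: "k \<ge> 1" and c: "c < 1"
    and \<sigma>: "1 \<le> 4 * (2 * real k ^ (d - 1)) * \<sigma>"
    and cap: "c > 0 \<Longrightarrow> \<sigma> \<le> sqrt (1 - c\<^sup>2) ^ (d - 1) * sqrt 2 ^ d / 2"
  shows "lower_const d \<le> sqrt (1 - c) * real k"
proof (cases "c > 0")
  case False
  have "1 * 1 \<le> sqrt (1 - c) * real k"
    using False k by (intro mult_mono) auto
  then show ?thesis
    using lower_const_le_1[OF d] by simp
next
  case True
  define n where "n = d - 1"
  have n: "d = Suc n" "n \<ge> 1"
    using d by (auto simp: n_def)
  define u where "u = sqrt (1 - c)"
  have u: "u > 0"
    using c by (simp add: u_def)
  \<comment> \<open>Passes from the sine of the cap angle, natural for its measure, to the quantity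
    1 - c in the theorem.\<close>
  have "sqrt (1 - c\<^sup>2) \<le> sqrt 2 * u"
  proof -
    have "1 - c\<^sup>2 = (1 + c) * (1 - c)"
      by (simp add: power2_eq_square algebra_simps)
    also have "\<dots> \<le> 2 * (1 - c)"
      using c by (intro mult_right_mono) auto
    finally show ?thesis
      unfolding u_def real_sqrt_mult[symmetric] by simp
  qed
  moreover have "0 \<le> sqrt (1 - c\<^sup>2)"
    using True c by (simp add: abs_square_le_1)
  ultimately have "sqrt (1 - c\<^sup>2) ^ n \<le> (sqrt 2 * u) ^ n"
    by (intro power_mono)
  then have "\<sigma> \<le> (sqrt 2 * u) ^ n * sqrt 2 ^ d / 2"
    using cap[OF True] by (simp add: n_def) (smt (verit) mult_right_mono zero_le_power real_sqrt_ge_zero)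
  also have "\<dots> = 2 ^ n * u ^ n * sqrt 2 / 2"
  proof -
    have "sqrt 2 ^ n * sqrt 2 ^ n = (2::real) ^ n"
      by (simp flip: power_mult_distrib)
    then show ?thesis
      by (simp add: n(1) power_mult_distrib mult_ac)
  qed
  finally have \<sigma>': "\<sigma> \<le> 2 ^ n * u ^ n * sqrt 2 / 2" .
  have "1 \<le> 4 * (2 * real k ^ n) * (2 ^ n * u ^ n * sqrt 2 / 2)"
  proof -
    have "4 * (2 * real k ^ n) * \<sigma> \<le> 4 * (2 * real k ^ n) * (2 ^ n * u ^ n * sqrt 2 / 2)"
      using \<sigma>' by (intro mult_left_mono) auto
    moreover have "1 \<le> 4 * (2 * real k ^ n) * \<sigma>"
      unfolding n_def by (rule \<sigma>)
    ultimately show ?thesis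
      by linarith
  qed
  also have "\<dots> = (u * real k) ^ n * (8 * 2 ^ n) * sqrt 2 / 2"
    by (simp add: power_mult_distrib)
  finally have "sqrt 2 * 1 \<le> sqrt 2 * ((u * real k) ^ n * (8 * 2 ^ n) * sqrt 2 / 2)"
    by (rule mult_left_mono) simp
  also have "sqrt 2 * (X * sqrt 2 / 2) = X" for X :: real
    by (simp add: field_simps)
  finally have "sqrt 2 \<le> (u * real k) ^ n * (8 * 2 ^ n)"
    by simp
  then have "lower_const d ^ n * (8 * 2 ^ n) \<le> (u * real k) ^ n * (8 * 2 ^ n)"
    unfolding n_def by (rule order_trans[OF lower_const_power[OF d]])
  then have "lower_const d ^ n \<le> (u * real k) ^ n"
    by (rule mult_right_le_imp_le) simp
  moreover have "0 \<le> u * real k"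
    using u by simp
  ultimately show ?thesis
    unfolding u_def[symmetric] using n(2) lower_const_nonneg[OF d] by (subst (asm) power_mono_iff) auto
qed

subsection \<open>Bounds over the admissible class\<close>

context signed_basis
begin

lemma fourier_eq_ip: "fourier Y f n j = ip f (Y n j)"
  by (simp add: fourier_def ip_def)

text \<open>A harmonic of degree 0 is constant, normalisation makes it 1 or -1, and the sign
  condition at the pole selects 1. Hence the first condition in \<open>Bclass\<close> says that the
  mean is nonpositive.\<close>

lemma Y_0_1:
  assumes "x \<in> sphere 0 1"
  shows "Y 0 1 x = 1"
proof -
  have j: "1 \<in> {1..hdim TYPE('d) 0}"
    using h_pos[of 0] by simp
  obtain p where p: "hom_poly 0 p" "\<And>x. laplacian p x = 0"
    "\<And>x. x \<in> sphere 0 1 \<Longrightarrow> Y 0 1 x = p x" "\<And>x. x \<notin> sphere 0 1 \<Longrightarrow> Y 0 1 x = 0"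
    using sph_harmE[OF Y_in[OF j]] by blast
  define c where "c = p 0"
  have pc: "p x = c" for x
    using hom_poly_homogeneous[OF p(1), of 0 x] by (simp add: c_def)
  have Yc: "Y 0 1 x = c" if "x \<in> sphere 0 1" for x
    using p(3)[OF that] pc by simp
  have "1 = ip (Y 0 1) (Y 0 1)"
    using Y_orth[OF j j] by simp
  also have "\<dots> = ip (\<lambda>x :: real^'d::_. c) (\<lambda>x. c)"
    by (rule ip_cong) (use Yc in auto)
  also have "\<dots> = c * c"
    by (simp add: ip_def)
  finally have "c * c = 1"
    by simp
  moreover have "c \<ge> 0"
    using Y_pole_nonneg[OF j] Yc[OF north_pole_in_sphere] by simp
  ultimately have "c = 1"
    by (simp add: square_eq_1_iff)
  then show ?thesis
    using Yc[OF assms] by simp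
qed

lemma fourier_0_1: "fourier Y f 0 1 = (\<integral>x. f x \<partial>sigma_bar)"
  unfolding fourier_def by (rule Bochner_Integration.integral_cong) (use Y_0_1 in auto)

lemma ip_const_Y:
  assumes "j \<in> {1..hdim TYPE('d) n}" "n \<ge> 1"
  shows "ip (\<lambda>x. 1) (Y n j) = 0"
proof -
  have j: "1 \<in> {1..hdim TYPE('d) 0}"
    using h_pos[of 0] by simp
  have "ip (\<lambda>x. 1) (Y n j) = ip (Y 0 1) (Y n j)"
    by (rule ip_cong) (use Y_0_1 in auto)
  then show ?thesis
    using Y_orth[OF j assms(1)] assms(2) by simp
qed

lemma kidx_props:
  assumes "f \<in> Bclass Y s"
  shows "kidx Y s f \<ge> 1"
    "\<And>n j. n \<ge> kidx Y s f \<Longrightarrow> j \<in> {1..hdim TYPE('d) n} \<Longrightarrow> s * fourier Y f n j \<ge> 0"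
proof -
  let ?P = "\<lambda>k. 1 \<le> k \<and> (\<forall>n\<ge>k. \<forall>j\<in>{1..hdim TYPE('d) n}. s * fourier Y f n j \<ge> 0)"
  obtain N where "\<forall>n\<ge>N. \<forall>j\<in>{1..hdim TYPE('d) n}. s * fourier Y f n j \<ge> 0"
    using assms unfolding Bclass_def by blast
  then have "?P (max 1 N)"
    by simp
  then have "?P (kidx Y s f)"
    unfolding kidx_def by (rule LeastI)
  then show "kidx Y s f \<ge> 1"
    "\<And>n j. n \<ge> kidx Y s f \<Longrightarrow> j \<in> {1..hdim TYPE('d) n} \<Longrightarrow> s * fourier Y f n j \<ge> 0"
    by blast+
qed

text \<open>\<open>cap_uncertainty\<close> with c = cos \<theta> and every c' < c, followed by c'
  tending to c. It needs c > -1, so \<theta> = pi is treated apart; there 1 - cos \<theta> =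
  2.\<close>

lemma lower_bound_at_angle:
  assumes f: "f \<in> Bclass Y s" and s: "s = 1 \<or> s = -1"
    and x0: "x0 \<in> sphere 0 1" "f x0 \<noteq> 0" and \<theta>: "\<theta> \<in> theta_set f"
  shows "lower_const CARD('d) \<le> sqrt (1 - cos \<theta>) * kidx Y s f"
proof -
  let ?k = "kidx Y s f"
  have k: "?k \<ge> 1"
    by (rule kidx_props(1)[OF f])
  have fc: "continuous_on (sphere 0 1) f" and mean: "(\<integral>x. f x \<partial>sigma_bar) \<le> 0"
    and pole: "s * f north_pole \<le> 0"
    using f unfolding Bclass_def fourier_0_1 by auto
  have th: "0 < \<theta>" "\<theta> \<le> pi" and nn: "\<And>x. x \<in> sphere 0 1 \<Longrightarrow> arccos (x \<bullet> north_pole) \<ge> \<theta> \<Longrightarrow> f x \<ge> 0"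
    using \<theta> unfolding theta_set_def by auto
  show ?thesis
  proof (cases "\<theta> = pi")
    case True
    have "1 * 1 \<le> sqrt (1 - cos \<theta>) * ?k"
      using k True by (intro mult_mono) auto
    then show ?thesis
      using lower_const_le_1[OF card_ge_2] by simp
  next
    case False
    define c where "c = cos \<theta>"
    have c1: "-1 < c"
      using cos_monotone_0_pi[of \<theta> pi] th False by (simp add: c_def)
    have c2: "c < 1"
      using cos_monotone_0_pi[of 0 \<theta>] th by (simp add: c_def)
    have nonneg: "f x \<ge> 0" if x: "x \<in> sphere 0 1" "x \<bullet> north_pole \<le> c" for x
    proof (rule nn[OF x(1)])
      have "arccos c \<le> arccos (x \<bullet> north_pole)"
        using x(2) sphere_inner_le[OF x(1) north_pole_in_sphere] c1 c2 by (intro arccos_le_arccos) auto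
      then show "\<theta> \<le> arccos (x \<bullet> north_pole)"
        using th by (simp add: c_def arccos_cos)
    qed
    have bound: "lower_const CARD('d) \<le> sqrt (1 - c') * ?k" if c': "c' < c" for c'
    proof (rule lower_const_le[OF card_ge_2 k])
      let ?\<sigma> = "measure sigma_bar {x \<in> sphere (0 :: real^'d::_) 1. x \<bullet> north_pole \<ge> c'}"
      show "c' < 1"
        using c' c2 by simp
      have "1 \<le> real (4 * (\<Sum>n<?k. hdim TYPE('d) n)) * ?\<sigma>"
      proof (rule cap_uncertainty[OF fc s _ pole mean nonneg c1 c' x0])
        show "0 \<le> s * ip f (Y n j)" if "?k \<le> n" "j \<in> {1..hdim TYPE('d) n}" for n j
          using kidx_props(2)[OF f that] by (simp only: fourier_eq_ip)
      qed
      also have "\<dots> \<le> 4 * (2 * real ?k ^ (CARD('d) - 1)) * ?\<sigma>"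
      proof (rule mult_right_mono)
        have "real (4 * (\<Sum>n<?k. hdim TYPE('d) n)) \<le> real (4 * (2 * ?k ^ (CARD('d) - 1)))"
          using sum_h_le[of ?k] unfolding of_nat_le_iff by (rule mult_left_mono) simp
        then show "real (4 * (\<Sum>n<?k. hdim TYPE('d) n)) \<le> 4 * (2 * real ?k ^ (CARD('d) - 1))"
          by simp
      qed simp
      finally show "1 \<le> 4 * (2 * real ?k ^ (CARD('d) - 1)) * ?\<sigma>" .
      show "?\<sigma> \<le> sqrt (1 - c'\<^sup>2) ^ (CARD('d) - 1) * sqrt 2 ^ CARD('d) / 2" if "c' > 0"
        by (rule cap_measure) (use that c' c2 in auto)
    qed
    have "(\<lambda>i. sqrt (1 - (c - inverse (real (Suc i)))) * ?k) \<longlonglongrightarrow> sqrt (1 - (c - 0)) * ?k"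
      by (intro tendsto_intros LIMSEQ_inverse_real_of_nat)
    then have "lower_const CARD('d) \<le> sqrt (1 - (c - 0)) * ?k"
      by (rule LIMSEQ_le_const) (use bound in auto)
    then show ?thesis
      by (simp add: c_def)
  qed
qed

lemma BB_lower:
  assumes s: "s = 1 \<or> s = -1"
  shows "BB Y s \<ge> ereal (lower_const CARD('d))"
  unfolding BB_def
proof (rule INF_greatest)
  fix f assume "f \<in> {f \<in> Bclass Y s. \<exists>\<omega>\<in>sphere 0 1. f \<omega> \<noteq> 0}"
  then obtain x0 where f: "f \<in> Bclass Y s" and x0: "x0 \<in> sphere 0 1" "f x0 \<noteq> 0"
    by blast
  show "ereal (lower_const CARD('d)) \<le> Bval Y s f"
  proof (cases "theta_set f = {}")
    case True
    then show ?thesis by (simp add: Bval_def)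
  next
    case False
    have "bdd_below (theta_set f)"
      by (rule bdd_belowI[of _ 0]) (auto simp: theta_set_def)
    then have "theta f \<in> closure (theta_set f)"
      unfolding theta_def using False by (rule closure_contains_Inf[rotated])
    then have "lower_const CARD('d) \<le> sqrt (1 - cos (theta f)) * kidx Y s f"
      by (rule continuous_ge_on_closure[where f = "\<lambda>\<theta>. sqrt (1 - cos \<theta>) * kidx Y s f", rotated])
         (auto intro!: continuous_intros lower_bound_at_angle[OF f s x0])
    then show ?thesis
      using False by (simp add: Bval_def)
  qed
qed

text \<open>The angle of the test function is never computed: pi is admissible because only the
  south pole lies at distance pi, and 1 - cos is at most 2 at every angle. Only the index
  \<open>k\<close> matters.\<close>

lemma BB_upper:
  assumes f: "f \<in> Bclass Y s" and x0: "x0 \<in> sphere 0 1" "f x0 \<noteq> 0" and "f (- north_pole) \<ge> 0"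
    and k: "k \<ge> 1" "\<And>n j. n \<ge> k \<Longrightarrow> j \<in> {1..hdim TYPE('d) n} \<Longrightarrow> s * fourier Y f n j \<ge> 0"
  shows "BB Y s \<le> ereal (sqrt 2 * k)"
proof -
  have "f x \<ge> 0" if x: "x \<in> sphere 0 1" "arccos (x \<bullet> north_pole) \<ge> pi" for x
  proof -
    have le: "\<bar>x \<bullet> north_pole\<bar> \<le> 1"
      by (rule sphere_inner_le[OF x(1) north_pole_in_sphere])
    then have "arccos (x \<bullet> north_pole) = pi"
      using x(2) arccos_ubound[of "x \<bullet> north_pole"] by (auto simp: abs_le_iff)
    then have "x \<bullet> north_pole = -1"
      using cos_arccos_abs[OF le] by simp
    moreover have "x \<bullet> x = 1" "(north_pole :: real^'d::_) \<bullet> north_pole = 1"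
      using x(1) by (simp_all add: dot_square_norm)
    ultimately have "(x + north_pole) \<bullet> (x + north_pole) = 0"
      by (simp add: inner_add_left inner_add_right inner_commute[of north_pole x])
    then have "x = - north_pole"
      by (simp add: eq_neg_iff_add_eq_0)
    then show ?thesis
      using assms(4) by simp
  qed
  then have "pi \<in> theta_set f"
    by (simp add: theta_set_def)
  then have ne: "theta_set f \<noteq> {}"
    by blast
  have "BB Y s \<le> Bval Y s f"
    unfolding BB_def by (rule INF_lower) (use f x0 in blast)
  also have "\<dots> = ereal (sqrt (1 - cos (theta f)) * kidx Y s f)"
    using ne by (simp add: Bval_def)
  also have "\<dots> \<le> ereal (sqrt 2 * k)"
  proof -
    have "kidx Y s f \<le> k"
      unfolding kidx_def by (rule Least_le) (use k in auto)
    moreover have "sqrt (1 - cos (theta f)) \<le> sqrt 2"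
      using cos_ge_minus_one[of "theta f"] by simp
    ultimately show ?thesis
      by (auto intro!: mult_mono)
  qed
  finally show ?thesis .
qed

text \<open>The kernel (x \<bullet> y)^m is positive definite, so its Funk--Hecke multipliers are
  nonnegative, as are the basis functions at the pole.\<close>

lemma ip_pole_power_nonneg:
  assumes "j \<in> {1..hdim TYPE('d) n}"
  shows "ip (\<lambda>x. (x \<bullet> north_pole) ^ m) (Y n j) \<ge> 0"
proof -
  have "ip (\<lambda>x. (x \<bullet> north_pole) ^ m) (Y n j) = lam (\<lambda>t. t ^ m) n * Y n j north_pole"
    by (rule funk_hecke[where \<phi> = "\<lambda>t. t ^ m", OF _ assms]) (intro continuous_intros)
  moreover have "lam (\<lambda>t. t ^ m) n \<ge> 0"
    using power_kernel_lam(1)[of 0 1 m n] by simp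
  ultimately show ?thesis
    using Y_pole_nonneg[OF assms] by simp
qed

lemma orthogonal_to_pole_exists: "\<exists>w :: real^'d::_. w \<in> sphere 0 1 \<and> w \<bullet> north_pole = 0"
proof -
  obtain a :: 'd where "a \<noteq> Max UNIV"
    using index_ne_exists[OF card_ge_2] by blast
  then have "(axis a 1 :: real^'d::_) $ Max UNIV = 0"
    by (simp add: axis_def)
  then show ?thesis
    by (intro exI[of _ "axis a 1"]) (simp add: inner_north_pole norm_axis_1)
qed

lemma pole_pole: "(north_pole :: real^'d::_) \<bullet> north_pole = 1"
  by (simp add: dot_square_norm)

lemma BB_plus_upper: "BB Y 1 \<le> ereal (sqrt 2)"
proof -
  \<comment> \<open>Nonpositive and zero at both poles. The constant affects only degree 0, so from
    degree 1 on the coefficients are those of t^2 and k = 1 works.\<close>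
  define f where "f x = (x \<bullet> north_pole) ^ 2 - 1" for x :: "real^'d::_"
  have pc: "continuous_on (sphere 0 1) (\<lambda>x :: real^'d::_. (x \<bullet> north_pole) ^ 2)"
    by (intro continuous_intros)
  have fc: "continuous_on (sphere 0 1) f"
    unfolding f_def[abs_def] by (intro continuous_intros)
  have coeff: "1 * fourier Y f n j \<ge> 0" if "n \<ge> 1" "j \<in> {1..hdim TYPE('d) n}" for n j
  proof -
    have "fourier Y f n j = ip (\<lambda>x. (x \<bullet> north_pole) ^ 2) (Y n j) - ip (\<lambda>x. 1) (Y n j)"
      unfolding fourier_eq_ip f_def[abs_def]
      by (rule ip_diff_left[OF pc continuous_on_const Y_cont[OF that(2)]])
    then show ?thesis
      using ip_const_Y[OF that(2,1)] ip_pole_power_nonneg[OF that(2), of 2] by simp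
  qed
  have "(\<integral>x. f x \<partial>sigma_bar) \<le> (\<integral>x. 0 \<partial>(sigma_bar :: (real^'d::_) measure))"
  proof (rule integral_mono)
    fix x :: "real^'d::_" assume "x \<in> space sigma_bar"
    then have "\<bar>x \<bullet> north_pole\<bar> \<le> 1"
      by (intro sphere_inner_le north_pole_in_sphere) simp
    then show "f x \<le> 0"
      by (simp add: f_def abs_square_le_1)
  qed (auto intro: integrable_continuous_sigma_bar fc)
  then have mean: "fourier Y f 0 1 \<le> 0"
    by (simp add: fourier_0_1[simplified])
  have B: "f \<in> Bclass Y 1"
    unfolding Bclass_def using fc mean coeff by (auto simp: f_def pole_pole intro!: exI[of _ 1])
  obtain w :: "real^'d::_" where w: "w \<in> sphere 0 1" "w \<bullet> north_pole = 0"
    using orthogonal_to_pole_exists by blast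
  have "BB Y 1 \<le> ereal (sqrt 2 * real 1)"
    by (rule BB_upper[OF B w(1)]) (use w coeff in \<open>auto simp: f_def pole_pole\<close>)
  then show ?thesis by simp
qed

lemma pole_coordinate_sph_harm: "(\<lambda>x :: real^'d::_. if x \<in> sphere 0 1 then x \<bullet> north_pole else 0) \<in> sph_harm 1"
proof (rule sph_harmI[of 1 "\<lambda>x. x \<bullet> north_pole"])
  show "hom_poly 1 (\<lambda>x :: real^'d::_. x \<bullet> north_pole)"
    unfolding inner_north_pole by (rule hom_poly_coordinate)
  show "laplacian (\<lambda>x :: real^'d::_. x \<bullet> north_pole) x = 0" for x
  proof -
    have "deriv (\<lambda>t. (x + t *\<^sub>R axis i 1) \<bullet> north_pole) = (\<lambda>t. axis i 1 \<bullet> north_pole)" for i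
      by (rule ext, rule DERIV_imp_deriv) (auto simp: inner_add_left intro!: derivative_eq_intros)
    then show ?thesis
      by (simp add: laplacian_def)
  qed
qed auto

lemma BB_minus_upper: "BB Y (-1) \<le> ereal (2 * sqrt 2)"
proof -
  \<comment> \<open>Odd in the height, so of mean zero, and zero at both poles. The linear term
    lives in degree 1, so from degree 2 on only -t^3 contributes, with the sign wanted for s = -1;
    hence k = 2.\<close>
  define f where "f x = (x \<bullet> north_pole) - (x \<bullet> north_pole) ^ 3" for x :: "real^'d::_"
  have pc: "continuous_on (sphere 0 1) (\<lambda>x :: real^'d::_. x \<bullet> north_pole)"
    "continuous_on (sphere 0 1) (\<lambda>x :: real^'d::_. (x \<bullet> north_pole) ^ 3)"
    by (intro continuous_intros)+
  have fc: "continuous_on (sphere 0 1) f"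
    unfolding f_def[abs_def] by (intro continuous_intros)
  have coeff: "(-1) * fourier Y f n j \<ge> 0" if "n \<ge> 2" "j \<in> {1..hdim TYPE('d) n}" for n j
  proof -
    have "ip (\<lambda>x. x \<bullet> north_pole) (Y n j)
        = ip (\<lambda>x :: real^'d::_. if x \<in> sphere 0 1 then x \<bullet> north_pole else 0) (Y n j)"
      by (rule ip_cong) auto
    also have "\<dots> = 0"
      by (rule sph_harm_orthogonal_degrees[OF pole_coordinate_sph_harm Y_in[OF that(2)]]) (use that in auto)
    finally have 1: "ip (\<lambda>x. x \<bullet> north_pole) (Y n j) = 0" .
    have "fourier Y f n j = ip (\<lambda>x. x \<bullet> north_pole) (Y n j) - ip (\<lambda>x. (x \<bullet> north_pole) ^ 3) (Y n j)"
      unfolding fourier_eq_ip f_def[abs_def] by (rule ip_diff_left[OF pc Y_cont[OF that(2)]])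
    then show ?thesis
      using 1 ip_pole_power_nonneg[OF that(2), of 3] by simp
  qed
  have odd: "f (hreflect north_pole x) = - f x" for x
  proof -
    have "hreflect north_pole x \<bullet> north_pole = - (x \<bullet> north_pole)"
      by (simp add: hreflect_def inner_diff_left pole_pole inner_commute[of north_pole x])
    then show ?thesis
      by (simp add: f_def)
  qed
  have "(\<integral>x. f x \<partial>sigma_bar) = (\<integral>x. f (hreflect north_pole x) \<partial>sigma_bar)"
    by (rule integral_sigma_bar_orthogonal[OF orthogonal_hreflect measurable_continuous_sigma_bar[OF fc], symmetric])
  also have "\<dots> = - (\<integral>x. f x \<partial>sigma_bar)"
    by (simp add: odd)
  finally have mean: "fourier Y f 0 1 \<le> 0"
    using fourier_0_1[of f] by simp
  have B: "f \<in> Bclass Y (-1)"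
    unfolding Bclass_def using fc mean coeff by (auto simp: f_def pole_pole intro!: exI[of _ 2])
  obtain w :: "real^'d::_" where w: "w \<in> sphere 0 1" "w \<bullet> north_pole = 0"
    using orthogonal_to_pole_exists by blast
  \<comment> \<open>On the equator the test function vanishes; the triple 3, 4, 5 supplies a point
    of the sphere at height 3/5, where it does not.\<close>
  define x0 where "x0 = (3/5) *\<^sub>R north_pole + (4/5) *\<^sub>R w"
  have "w \<bullet> w = 1"
    using w(1) by (simp add: dot_square_norm)
  then have "x0 \<bullet> x0 = 1"
    using w(2) by (simp add: x0_def inner_add_left inner_add_right pole_pole inner_commute[of north_pole w])
  then have x0: "x0 \<in> sphere 0 1"
    by (simp add: norm_eq_sqrt_inner)
  have t: "x0 \<bullet> north_pole = 3/5"
    using w(2) by (simp add: x0_def inner_add_left pole_pole)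
  have "f x0 \<noteq> 0"
    unfolding f_def t by (simp add: power3_eq_cube)
  then have "BB Y (-1) \<le> ereal (sqrt 2 * real 2)"
    by (rule BB_upper[OF B x0]) (use coeff in \<open>auto simp: f_def pole_pole\<close>)
  then show ?thesis by (simp add: mult.commute)
qed

end

theorem mainTheorem3:
  fixes Y :: "nat \<Rightarrow> nat \<Rightarrow> real^'d::{finite,wellorder} \<Rightarrow> real"
  assumes "CARD('d) \<ge> 2"
    and "signed_onb Y"
  shows "(\<forall>s\<in>{1, -1::real}.
           BB Y s \<ge> ereal (2 * Gamma ((real CARD('d) + 1) / 2) powr (2 / (real CARD('d) - 1))
              / ((4 * exp (1/12)) powr (2 / (real CARD('d) - 1)) * sqrt ((real CARD('d))\<^sup>2 - 1))))
       \<and> BB Y 1 \<le> ereal (sqrt 2)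
       \<and> BB Y (-1) \<le> ereal (2 * sqrt 2)"
proof -
  interpret signed_basis Y
    by unfold_locales (use assms in auto)
  show ?thesis
    using BB_lower[unfolded lower_const_def] BB_plus_upper BB_minus_upper by blast
qed

end
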